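(* Let $t_1,\dots,t_n\in\mathbb T$ be distinct points, let $w_1,\dots,w_n$ be unimodular complex numbers, let $\gamma_1,\dots,\gamma_n\in\mathbb R$, let the associated Pick matrix $P$ be invertible with $\kappa$ negative eigenvalues, let $\mu\in\mathbb T\setminus\{t_1,\dots,t_n\}$ and let $\Theta$ be the associated $2\times 2$ matrix function. Let $\mathcal E\in\mathcal S_0$ and $w=\mathbf T_\Theta[\mathcal E]$. Then $w$ is a solution of the problem $$w\in\mathcal S_\kappa,\qquad d_w(t_i)=\gamma_i\ \text{ and }\ w(t_i)=w_i\quad(i=1,\dots,n)$$ if and only if $\mathcal E$ satisfies, for every $i\in\{1,\dots,n\}$, either condition $\mathbf C_1$ or condition $\mathbf C_2$ at $t_i$.
   Context: $\mathbb D$ is the open unit disk, $\mathbb T$ the unit circle. The Schur class $\mathcal S_0$ is the set of analytic functions $\mathbb D\to\overline{\mathbb D}$. For an integer $k\ge 0$, $\mathcal S_k$ is the class of functions $S/B$ with $S\in\mathcal S_0$ and $B$ a finite Blaschke product of degree $k$, $S$ and $B$ having no common zeroes; a generalized Schur function is an element of $\bigcup_k\mathcal S_k$. All boundary limits are nontangential. For a generalized Schur function $f$ and $t\in\mathbb T$, put $f(t):=\lim_{z\to t}f(z)$ (if the limit exists) and $d_f(t):=\lim_{z\to t}\frac{1-|f(z)|^2}{1-|z|^2}$, which always exists in $(-\infty,+\infty]$. The Pick matrix is the Hermitian matrix $P=[P_{ij}]_{i,j=1}^n$ with $P_{ij}=\frac{1-\overline{w}_iw_j}{1-\overline t_it_j}$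 for $i\ne j$ and $P_{ii}=\gamma_i$; eigenvalues are counted with multiplicities. Further $T=\operatorname{diag}(t_1,\dots,t_n)$, $E=[1\ \cdots\ 1]$, $C=[w_1\ \cdots\ w_n]$, and $$\Theta(z)=\begin{bmatrix}\Theta_{11}(z)&\Theta_{12}(z)\\ \Theta_{21}(z)&\Theta_{22}(z)\end{bmatrix}=I_2+(z-\mu)\begin{bmatrix} C \\ E \end{bmatrix}(zI_n-T)^{-1}P^{-1}(I_n-\mu T^* )^{-1}\begin{bmatrix}C^*&-E^*\end{bmatrix},$$ $\mathbf T_\Theta[\mathcal E]=\frac{\Theta_{11}\mathcal E+\Theta_{12}}{\Theta_{21}\mathcal E+\Theta_{22}}$, which is a generalized Schur function for every $\mathcal E\in\mathcal S_0$. Numbers $\widetilde c_i,\widetilde e_i$ are defined by $\overline{\widetilde c_i}=-\lim_{z\to t_i}(z-t_i)\Theta_{21}(z)$ and $\overline{\widetilde e_i}=\lim_{z\to t_i}(z-t_i)\Theta_{22}(z)$; it holds that $|\widetilde c_i|=|\widetilde e_i|\ne0$, so $\eta_i:=\widetilde c_i/\widetilde e_i$ is unimodular. Conditions on $\mathcal E\in\mathcal S_0$ at $t_i$: $\mathbf C_1$: $\mathcal E$ fails to have nontangential boundary limit $\eta_i$ at $t_i$ (either the limit $\mathcal E(t_i)$ does not exist, or it exists and is not equal to $\eta_i$). $\mathbf C_2$: $\mathcal E(t_i)=\eta_i$ and $d_{\mathcal E}(t_i)=\infty$. *)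

theory Defs
  imports
    "HOL-Complex_Analysis.Complex_Analysis"
    "HOL-Computational_Algebra.Polynomial"
    "Jordan_Normal_Form.Schur_Decomposition"
    "Jordan_Normal_Form.Gauss_Jordan_Elimination"
begin

definition stolz_region :: "real \<Rightarrow> complex \<Rightarrow> complex set" where
  "stolz_region a t = {z. cmod z < 1 \<and> cmod (z - t) < a * (1 - cmod z)}"

definition nt_at :: "complex \<Rightarrow> complex filter" where
  "nt_at t = (SUP a\<in>{1<..}. at t within stolz_region a t)"

lemma tendsto_nt_at_iff:
  "(f \<longlongrightarrow> l) (nt_at t) \<longleftrightarrow> (\<forall>a>1. (f \<longlongrightarrow> l) (at t within stolz_region a t))"
  unfolding nt_at_def filterlim_def filtermap_SUP by (auto simp: SUP_le_iff)

definition has_boundary_value :: "(complex \<Rightarrow> complex) \<Rightarrow> complex \<Rightarrow> complex \<Rightarrow> bool" where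
  "has_boundary_value f t c \<longleftrightarrow> (f \<longlongrightarrow> c) (nt_at t)"

text \<open>\<open>has_boundary_d f t x\<close> says that \<open>d\<^sub>f(t) = x\<close>. The limit is taken in the extended
  reals, so that the value \<open>\<infinity>\<close> is meaningful.\<close>

definition has_boundary_d :: "(complex \<Rightarrow> complex) \<Rightarrow> complex \<Rightarrow> ereal \<Rightarrow> bool" where
  "has_boundary_d f t x \<longleftrightarrow>
     ((\<lambda>z. ereal ((1 - (cmod (f z))\<^sup>2) / (1 - (cmod z)\<^sup>2))) \<longlongrightarrow> x) (nt_at t)"

definition schur_class :: "(complex \<Rightarrow> complex) set" where
  "schur_class = {S. S holomorphic_on ball 0 1 \<and> S ` ball 0 1 \<subseteq> cball 0 1}"

definition finite_blaschke :: "nat \<Rightarrow> (complex \<Rightarrow> complex) set" where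
  "finite_blaschke k = {B. \<exists>c A. cmod c = 1 \<and> size A = k \<and> set_mset A \<subseteq> ball 0 1 \<and>
     (\<forall>z\<in>ball 0 1. B z = c * (\<Prod>a\<in>#A. (z - a) / (1 - cnj a * z)))}"

text \<open>Functions are considered on the open unit disk only, and the elements of the class are
  meromorphic there: the (arbitrary) value that the total function \<open>f\<close> takes at a pole, i.e.
  at a zero of \<open>B\<close>, is irrelevant.\<close>

definition gen_schur_class :: "nat \<Rightarrow> (complex \<Rightarrow> complex) set" where
  "gen_schur_class k = {f. \<exists>S\<in>schur_class. \<exists>B\<in>finite_blaschke k.
     (\<forall>z\<in>ball 0 1. \<not> (S z = 0 \<and> B z = 0)) \<and>
     (\<forall>z\<in>ball 0 1. B z \<noteq> 0 \<longrightarrow> f z = S z / B z)}"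

text \<open>All matrix and point indices run over \<open>0, \<dots>, n - 1\<close>, and the entries of the
  2-by-2 matrix function are indexed by 0 and 1.\<close>

definition pick_matrix ::
  "nat \<Rightarrow> (nat \<Rightarrow> complex) \<Rightarrow> (nat \<Rightarrow> complex) \<Rightarrow> (nat \<Rightarrow> real) \<Rightarrow> complex mat" where
  "pick_matrix n t w \<gamma> = Matrix.mat n n (\<lambda>(i, j).
     if i = j then complex_of_real (\<gamma> i)
     else (1 - cnj (w i) * w j) / (1 - cnj (t i) * t j))"

text \<open>Multiplicities are those of the roots of the characteristic polynomial; for Hermitian
  matrices all roots are real.\<close>

definition num_neg_eigenvalues :: "complex mat \<Rightarrow> nat" where
  "num_neg_eigenvalues A = size {#x \<in># proots (char_poly A). x \<in> \<real> \<and> Re x < 0#}"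

definition mat_inv :: "complex mat \<Rightarrow> complex mat" where
  "mat_inv A = the (mat_inverse A)"

definition Theta ::
  "nat \<Rightarrow> (nat \<Rightarrow> complex) \<Rightarrow> (nat \<Rightarrow> complex) \<Rightarrow> (nat \<Rightarrow> real) \<Rightarrow> complex
     \<Rightarrow> complex \<Rightarrow> complex mat" where
  "Theta n t w \<gamma> \<mu> z =
    (let T = mat_diag n t;
         C = Matrix.mat 1 n (\<lambda>(_, j). w j);
         E = Matrix.mat 1 n (\<lambda>_. 1);
         C_over_E = C @\<^sub>r E;
         Cadj_minus_Eadj = mat_adjoint (C @\<^sub>r (- E))
     in 1\<^sub>m 2 + (z - \<mu>) \<cdot>\<^sub>m
        (C_over_E * mat_inv (z \<cdot>\<^sub>m 1\<^sub>m n - T) * mat_inv (pick_matrix n t w \<gamma>) *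
         mat_inv (1\<^sub>m n - \<mu> \<cdot>\<^sub>m mat_adjoint T) * Cadj_minus_Eadj))"

text \<open>For \<open>\<Theta>\<close> as above, \<open>\<Theta>(z)\<close> is invertible at every point of the disk, so the numerator and the
  denominator have no common zeros there, and the zeros of the denominator are exactly the poles.\<close>

definition lin_frac ::
  "(complex \<Rightarrow> complex mat) \<Rightarrow> (complex \<Rightarrow> complex) \<Rightarrow> complex \<Rightarrow> complex" where
  "lin_frac \<Theta> \<E> z =
     (\<Theta> z $$ (0, 0) * \<E> z + \<Theta> z $$ (0, 1)) / (\<Theta> z $$ (1, 0) * \<E> z + \<Theta> z $$ (1, 1))"

definition c_tilde :: "(complex \<Rightarrow> complex mat) \<Rightarrow> complex \<Rightarrow> complex" where
  "c_tilde \<Theta> s = cnj (- Lim (nt_at s) (\<lambda>z. (z - s) * \<Theta> z $$ (1, 0)))"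

definition e_tilde :: "(complex \<Rightarrow> complex mat) \<Rightarrow> complex \<Rightarrow> complex" where
  "e_tilde \<Theta> s = cnj (Lim (nt_at s) (\<lambda>z. (z - s) * \<Theta> z $$ (1, 1)))"

definition eta :: "(complex \<Rightarrow> complex mat) \<Rightarrow> complex \<Rightarrow> complex" where
  "eta \<Theta> s = c_tilde \<Theta> s / e_tilde \<Theta> s"

definition is_solution ::
  "nat \<Rightarrow> (nat \<Rightarrow> complex) \<Rightarrow> (nat \<Rightarrow> complex) \<Rightarrow> (nat \<Rightarrow> real) \<Rightarrow> nat
     \<Rightarrow> (complex \<Rightarrow> complex) \<Rightarrow> bool" where
  "is_solution n t w \<gamma> \<kappa> f \<longleftrightarrow> f \<in> gen_schur_class \<kappa> \<and>
     (\<forall>i<n. has_boundary_d f (t i) (ereal (\<gamma> i)) \<and> has_boundary_value f (t i) (w i))"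

definition cond_C1 :: "(complex \<Rightarrow> complex mat) \<Rightarrow> complex \<Rightarrow> (complex \<Rightarrow> complex) \<Rightarrow> bool" where
  "cond_C1 \<Theta> s \<E> \<longleftrightarrow> \<not> has_boundary_value \<E> s (eta \<Theta> s)"

definition cond_C2 :: "(complex \<Rightarrow> complex mat) \<Rightarrow> complex \<Rightarrow> (complex \<Rightarrow> complex) \<Rightarrow> bool" where
  "cond_C2 \<Theta> s \<E> \<longleftrightarrow> has_boundary_value \<E> s (eta \<Theta> s) \<and> has_boundary_d \<E> s \<infinity>"

end

theory Submission
  imports Defs "HOL-Real_Asymp.Real_Asymp"
begin

text \<open>Put \<open>w = N / D\<close> with \<open>N = \<Theta>\<^sub>1\<^sub>1 \<E> + \<Theta>\<^sub>1\<^sub>2\<close> and \<open>D = \<Theta>\<^sub>2\<^sub>1 \<E> + \<Theta>\<^sub>2\<^sub>2\<close>. The pair \<open>(N, D)\<close> is governed by a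
vector function \<open>v\<close> with values in \<open>\<complex>\<^sup>n\<close>, whose \<open>i\<close>-th component has its only boundary pole at
\<open>t\<^sub>i\<close>, through two identities:
the relation \<open>cnj w\<^sub>i N - D = (1 - z cnj t\<^sub>i) (P v)\<^sub>i\<close> (\<open>node_residual\<close>), and the kernel identity
\<open>D(z) cnj D(x) - N(z) cnj N(x) = 1 - \<E>(z) cnj \<E>(x) + (1 - z cnj x) v(x)\<^sup>* P v(z)\<close>
(\<open>kernel_identity\<close>).

\<^emph>\<open>Boundary conditions.\<close> The first relation says that the boundary difference quotients
\<open>q\<^sub>i = (1 - cnj w\<^sub>i w) / (1 - cnj t\<^sub>i z)\<close> form the vector \<open>- P (v / D)\<close>. By the Julia-Caratheodory
theorem for generalized Schur functions, \<open>w(t\<^sub>i) = w\<^sub>i\<close> and \<open>d\<^sub>w(t\<^sub>i) = \<gamma>\<^sub>i\<close> hold together exactly if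
\<open>q\<^sub>i\<close> tends to \<open>\<gamma>\<^sub>i\<close>, and it is enough to check this along one filter inside one Stolz region. Near
\<open>t\<^sub>i\<close> all components of \<open>v\<close> other than \<open>v\<^sub>i\<close> are bounded, while \<open>v\<^sub>i\<close> is comparable to
\<open>(\<E> - \<eta>\<^sub>i) / (z - t\<^sub>i)\<close>. If this ratio tends to infinity along some nontangential filter, then
\<open>v / D\<close> tends to minus the \<open>i\<close>-th unit vector and \<open>q\<^sub>i\<close> to \<open>P\<^sub>i\<^sub>i = \<gamma>\<^sub>i\<close>
(\<open>quotient_limit_of_unbounded_rate\<close>). Conversely the boundary conditions force the same limit of
\<open>v / D\<close>, hence \<open>1 / D\<close> tends to 0, which is impossible if the ratio stays bounded
(\<open>boundary_data_excludes_bounded_rate\<close>). Finally \<open>\<^bold>C\<^sub>1\<close> or \<open>\<^bold>C\<^sub>2\<close> holds exactly if the ratio is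
unbounded in this sense: under \<open>\<^bold>C\<^sub>1\<close> this is clear, under \<open>\<^bold>C\<^sub>2\<close> it follows from
\<open>1 - \<bar>\<E>\<bar> \<le> \<bar>\<E> - \<eta>\<^sub>i\<bar>\<close>, and if both fail, then Julia's lemma bounds the ratio.

\<^emph>\<open>Number of poles.\<close> Write \<open>\<kappa>\<close> for the number of negative eigenvalues of \<open>P\<close>. The kernel of a
function \<open>S / B\<close> with a Blaschke product \<open>B\<close> of degree \<open>k\<close> is congruent to a positive kernel minus
one of rank \<open>k\<close>; as \<open>P\<close> is a limit of values of this kernel, \<open>\<kappa> \<le> k\<close>
(\<open>negative_index_le_pole_count\<close>). For the opposite inequality, evaluate the kernel identity at the
zeros of \<open>D\<close>: the left side is a negative definite Szego matrix, the right side is bounded below by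
a form with \<open>\<kappa>\<close> negative squares, so \<open>D\<close> has at most \<open>\<kappa>\<close> distinct zeros. Multiplicities, and the
behaviour of \<open>w\<close> at the boundary, are dealt with by replacing \<open>\<E>\<close> by \<open>\<rho> \<E> + \<beta>\<close> with \<open>\<rho> < 1\<close> and a
small generic constant \<open>\<beta>\<close>: then the zeros of \<open>D\<close> are simple, \<open>D\<close> is bounded away from 0 near the
circle, and the maximum principle yields \<open>\<bar>N\<bar> \<bar>B\<bar> \<le> \<bar>D\<bar>\<close> for a Blaschke product \<open>B\<close> of degree at
most \<open>\<kappa>\<close>. This inequality survives the limit \<open>\<rho> \<rightarrow> 1\<close>, \<open>\<beta> \<rightarrow> 0\<close> (\<open>blaschke_bound\<close>) and puts \<open>w\<close> in
some generalized Schur class of index at most \<open>\<kappa>\<close> (\<open>gen_schur_of_blaschke_bound\<close>), whether or not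
the boundary conditions hold.\<close>

section \<open>Hermitian matrices and linear systems\<close>

lemma mat_adjoint_simps [simp]:
  fixes A :: "complex mat"
  shows "dim_row (mat_adjoint A) = dim_col A" "dim_col (mat_adjoint A) = dim_row A"
    "i < dim_col A \<Longrightarrow> j < dim_row A \<Longrightarrow> mat_adjoint A $$ (i, j) = cnj (A $$ (j, i))"
  by (simp_all add: mat_adjoint_def mat_of_rows_index)

lemma mat_adjoint_carrier [simp]:
  "(A :: complex mat) \<in> carrier_mat n m \<Longrightarrow> mat_adjoint A \<in> carrier_mat m n"
  by (rule carrier_matI) simp_all

lemma mat_adjoint_index:
  "(A :: complex mat) \<in> carrier_mat n m \<Longrightarrow> i < m \<Longrightarrow> j < n \<Longrightarrow> mat_adjoint A $$ (i, j) = cnj (A $$ (j, i))"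
  by simp

lemma mat_mult_index_sum:
  "A \<in> carrier_mat n k \<Longrightarrow> B \<in> carrier_mat k m \<Longrightarrow> i < n \<Longrightarrow> j < m \<Longrightarrow>
     (A * B) $$ (i, j) = (\<Sum>l<k. A $$ (i, l) * B $$ (l, j))"
  by (auto simp: scalar_prod_def atLeast0LessThan)

lemma mat_adjoint_mult:
  fixes A B :: "complex mat"
  assumes A: "A \<in> carrier_mat n k" and B: "B \<in> carrier_mat k m"
  shows "mat_adjoint (A * B) = mat_adjoint B * mat_adjoint A"
proof (rule eq_matI)
  have AB: "A * B \<in> carrier_mat n m" using A B by simp
  have BA: "mat_adjoint B * mat_adjoint A \<in> carrier_mat m n" using A B by (meson mat_adjoint_carrier mult_carrier_mat)
  show "dim_row (mat_adjoint (A * B)) = dim_row (mat_adjoint B * mat_adjoint A)"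
    "dim_col (mat_adjoint (A * B)) = dim_col (mat_adjoint B * mat_adjoint A)"
    using A B by auto
  fix i j assume "i < dim_row (mat_adjoint B * mat_adjoint A)" "j < dim_col (mat_adjoint B * mat_adjoint A)"
  then have i: "i < m" and j: "j < n" using BA by auto
  show "mat_adjoint (A * B) $$ (i, j) = (mat_adjoint B * mat_adjoint A) $$ (i, j)"
    unfolding mat_adjoint_index[OF AB i j] mat_mult_index_sum[OF A B j i]
      mat_mult_index_sum[OF mat_adjoint_carrier[OF B] mat_adjoint_carrier[OF A] i j]
    using A B i j by (simp add: mult.commute)
qed

lemma mat_adjoint_mat_adjoint: "mat_adjoint (mat_adjoint A) = (A :: complex mat)"
  by (rule eq_matI) auto

text \<open>Gram-Schmidt on a completion of \<open>v\<close> to a basis, followed by normalization. The first column keeps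
the direction of \<open>v\<close>, which is all that deflation by an eigenvector needs.\<close>

lemma unitary_completion:
  assumes v: "v \<in> carrier_vec n" and v0: "v \<noteq> 0\<^sub>v n"
  obtains W c where "W \<in> carrier_mat n n" "mat_adjoint W * W = 1\<^sub>m n" "col W 0 = c \<cdot>\<^sub>v v" "c \<noteq> (0::complex)"
proof -
  interpret cof_vec_space n "TYPE(complex)" .
  define b where "b = basis_completion v"
  define ws where "ws = gram_schmidt n b"
  from basis_completion[OF v v0, folded b_def]
  have dist_b: "distinct b" and indep: "\<not> lin_dep (set b)" and b: "set b \<subseteq> carrier_vec n" 
    and hdb: "hd b = v" and len_b: "length b = n" by auto
  have n: "n \<noteq> 0" using v v0 by (auto simp: vec_eq_iff)
  obtain vs where bv: "b = v # vs" using hdb len_b n by (cases b) auto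
  from gram_schmidt_result[OF b dist_b indep refl, folded ws_def]
  have ws: "set ws \<subseteq> carrier_vec n" "corthogonal ws" "length ws = n" by (auto simp: len_b)
  have hdws: "ws ! 0 = v" using gram_schmidt_hd[OF v, of vs, folded bv] ws(3) n
    unfolding ws_def by (cases "gram_schmidt n b") auto
  have wsi: "ws ! i \<in> carrier_vec n" if "i < n" for i using ws that by auto
  have inner: "ws ! i \<bullet>c ws ! j = (\<Sum>l<n. ws ! i $ l * cnj (ws ! j $ l))" if "i < n" "j < n" for i j
    using wsi[OF that(1)] wsi[OF that(2)] by (simp add: scalar_prod_def atLeast0LessThan)
  define s where "s = (\<lambda>i. \<Sum>l<n. (cmod (ws ! i $ l))\<^sup>2)"
  have sc: "complex_of_real (s i) = ws ! i \<bullet>c ws ! i" if "i < n" for i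
    unfolding s_def inner[OF that that] of_real_sum by (intro sum.cong refl) (metis complex_norm_square)
  have s: "s i > 0" if "i < n" for i
  proof -
    have "s i \<noteq> 0" using sc[OF that] corthogonalD[OF ws(2), of i i] ws(3) that by auto
    moreover have "s i \<ge> 0" unfolding s_def by (intro sum_nonneg) auto
    ultimately show ?thesis by simp
  qed
  (* the normalizing factors of the columns *)
  define k where "k = (\<lambda>i. complex_of_real (1 / sqrt (s i)))"
  define W where "W = Matrix.mat n n (\<lambda>(i, j). k j * ws ! j $ i)"
  have W: "W \<in> carrier_mat n n" by (simp add: W_def)
  have "mat_adjoint W * W = 1\<^sub>m n"
  proof (rule eq_matI)
    fix i j assume "i < dim_row (1\<^sub>m n :: complex mat)" "j < dim_col (1\<^sub>m n :: complex mat)"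
    then have i: "i < n" and j: "j < n" by auto
    have "(mat_adjoint W * W) $$ (i, j) = (\<Sum>l<n. cnj (W $$ (l, i)) * W $$ (l, j))"
      unfolding mat_mult_index_sum[OF mat_adjoint_carrier[OF W] W i j] using W i by simp
    also have "\<dots> = cnj (k i) * k j * (ws ! j \<bullet>c ws ! i)"
      unfolding inner[OF j i] using i j by (simp add: W_def sum_distrib_left mult_ac)
    also have "\<dots> = (if i = j then 1 else 0)"
    proof (cases "i = j")
      case True
      have "cnj (k i) * k j * (ws ! j \<bullet>c ws ! i) = complex_of_real (1 / sqrt (s i) * (1 / sqrt (s i)) * s i)"
        unfolding True sc[OF j, symmetric] k_def complex_cnj_complex_of_real of_real_mult[symmetric] ..
      also have "1 / sqrt (s i) * (1 / sqrt (s i)) * s i = 1" using s[OF i] by (simp add: field_simps)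
      finally show ?thesis using True by simp
    next
      case False
      then show ?thesis using corthogonalD[OF ws(2), of j i] ws(3) i j by auto
    qed
    finally show "(mat_adjoint W * W) $$ (i, j) = 1\<^sub>m n $$ (i, j)" using i j by simp
  qed (use W in auto)
  moreover have "col W 0 = k 0 \<cdot>\<^sub>v v"
    by (rule eq_vecI) (use W v n hdws in \<open>auto simp: W_def\<close>)
  moreover have "k 0 \<noteq> 0" using s[of 0] n by (simp add: k_def)
  ultimately show ?thesis using W that by blast
qed

lemma mult_block_diag_mat:
  assumes "A \<in> carrier_mat k k" "B \<in> carrier_mat k k" "X \<in> carrier_mat m m" "Y \<in> carrier_mat m m"
  shows "four_block_mat A (0\<^sub>m k m) (0\<^sub>m m k) X * four_block_mat B (0\<^sub>m k m) (0\<^sub>m m k) Y =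
    (four_block_mat (A * B) (0\<^sub>m k m) (0\<^sub>m m k) (X * Y) :: complex mat)"
  by (subst mult_four_block_mat[OF assms(1) _ _ assms(3,2) _ _ assms(4)]) (use assms in auto)

text \<open>Deflation: in a unitary basis that starts with an eigenvector, a Hermitian matrix splits into a
block of size 1 and a smaller Hermitian block whose characteristic polynomial is the quotient. The
list \<open>es\<close> is kept in the statement so that the diagonal carries the roots of the characteristic
polynomial with their multiplicities.\<close>

theorem hermitian_spectral_theorem:
  fixes A :: "complex mat"
  assumes "A \<in> carrier_mat n n" "mat_adjoint A = A"
    "char_poly A = (\<Prod>e\<leftarrow>es. [:- e, 1:])" "length es = n"
  shows "\<exists>U \<in> carrier_mat n n. mat_adjoint U * U = 1\<^sub>m n \<and>
    mat_adjoint U * A * U = mat_diag n (\<lambda>i. es ! i) \<and> (\<forall>e\<in>set es. e \<in> \<real>)"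
  using assms
proof (induction n arbitrary: A es)
  case 0
  then show ?case by (intro bexI[of _ "1\<^sub>m 0"]) (auto intro!: eq_matI simp: mat_diag_def)
next
  case (Suc m)
  note A = Suc.prems(1)
  obtain e es' where es: "es = e # es'" "length es' = m" using Suc.prems(4) by (cases es) auto
  have cp: "char_poly A = [:- e, 1:] * (\<Prod>e\<leftarrow>es'. [:- e, 1:])" using Suc.prems(3) es by simp
  have "eigenvalue A e" unfolding eigenvalue_root_char_poly[OF A] cp by simp
  then obtain v where v: "v \<in> carrier_vec (Suc m)" "v \<noteq> 0\<^sub>v (Suc m)" "A *\<^sub>v v = e \<cdot>\<^sub>v v"
    using A unfolding eigenvalue_def eigenvector_def by auto
  obtain W c where W: "W \<in> carrier_mat (Suc m) (Suc m)" "mat_adjoint W * W = 1\<^sub>m (Suc m)" 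
    "col W 0 = c \<cdot>\<^sub>v v" "c \<noteq> 0"
    using unitary_completion[OF v(1,2)] by metis
  define W' where "W' = mat_adjoint W"
  have W': "W' \<in> carrier_mat (Suc m) (Suc m)" using W by (simp add: W'_def)
  have W'W: "W' * W = 1\<^sub>m (Suc m)" using W by (simp add: W'_def)
  have WW': "W * W' = 1\<^sub>m (Suc m)" by (rule mat_mult_left_right_inverse[OF W' W(1) W'W])
  define B where "B = W' * A * W"
  have B: "B \<in> carrier_mat (Suc m) (Suc m)" using W' A W by (simp add: B_def)
  have WA: "W' * A \<in> carrier_mat (Suc m) (Suc m)" using W' A by simp
  have Bh: "mat_adjoint B = B"
    unfolding B_def mat_adjoint_mult[OF WA W(1)] mat_adjoint_mult[OF W' A] Suc.prems(2)
    unfolding W'_def mat_adjoint_mat_adjoint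
    by (rule assoc_mult_mat[symmetric, OF W'[unfolded W'_def] A W(1)])
  have Bsym: "B $$ (i, j) = cnj (B $$ (j, i))" if "i < Suc m" "j < Suc m" for i j
    using mat_adjoint_index[OF B that] unfolding Bh .
  have cW: "col W 0 \<in> carrier_vec (Suc m)" by (metis W(1) carrier_matD(1) col_dim)
  have col0: "B $$ (i, 0) = (if i = 0 then e else 0)" if i: "i < Suc m" for i
  proof -
    have "col B 0 = W' *\<^sub>v (A *\<^sub>v col W 0)"
      unfolding B_def col_mult2[OF WA W(1) zero_less_Suc]
      by (rule assoc_mult_mat_vec[OF W' A cW])
    also have "A *\<^sub>v col W 0 = e \<cdot>\<^sub>v col W 0"
      unfolding W(3) using v A by (simp add: mult_mat_vec smult_smult_assoc mult.commute)
    also have "W' *\<^sub>v (e \<cdot>\<^sub>v col W 0) = e \<cdot>\<^sub>v (W' *\<^sub>v col W 0)"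
      by (rule mult_mat_vec[OF W' cW])
    also have "W' *\<^sub>v col W 0 = col (W' * W) 0"
      by (rule col_mult2[OF W' W(1) zero_less_Suc, symmetric])
    also have "\<dots> = col (1\<^sub>m (Suc m)) 0" unfolding W'W ..
    finally have "col B 0 $ i = (e \<cdot>\<^sub>v col (1\<^sub>m (Suc m)) 0) $ i" by simp
    then show ?thesis using i B by auto
  qed
  have row0: "B $$ (0, j) = (if j = 0 then e else 0)" if j: "j < Suc m" for j
    using Bsym[OF _ j, of 0] col0[OF j] Bsym[of 0 0] col0[of 0] by auto
  have er: "e \<in> \<real>" using Bsym[of 0 0] col0[of 0] by (simp add: Reals_cnj_iff)
  define A3 where "A3 = Matrix.mat m m (\<lambda>(i, j). B $$ (Suc i, Suc j))"
  define E where "E = Matrix.mat 1 1 (\<lambda>_. e)"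
  have A3: "A3 \<in> carrier_mat m m" and E: "E \<in> carrier_mat 1 1" by (auto simp: A3_def E_def)
  have Bblock: "B = four_block_mat E (0\<^sub>m 1 m) (0\<^sub>m m 1) A3"
    by (rule eq_matI) (use B col0 row0 in \<open>auto simp: A3_def E_def\<close>)
  have "similar_mat_wit B A W' W"
    by (rule similar_mat_witI[of _ _ "Suc m"]) (use W'W WW' B A W' W in \<open>auto simp: B_def\<close>)
  then have "char_poly B = char_poly A" using char_poly_similar similar_mat_def by blast
  moreover have "char_poly B = char_poly E * char_poly A3"
    unfolding Bblock by (rule char_poly_four_block_zeros_col[OF E _ A3]) simp
  moreover have "char_poly E = [:- e, 1:]" by (simp add: E_def char_poly_defs det_def sign_def)
  ultimately have "[:- e, 1:] * char_poly A3 = [:- e, 1:] * (\<Prod>e\<leftarrow>es'. [:- e, 1:])" using cp by simp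
  then have cp3: "char_poly A3 = (\<Prod>e\<leftarrow>es'. [:- e, 1:])"
    by (metis mult_cancel_left pCons_eq_0_iff zero_neq_one)
  have A3h: "mat_adjoint A3 = A3"
  proof (rule eq_matI)
    fix i j assume "i < dim_row A3" "j < dim_col A3"
    then have i: "i < m" and j: "j < m" using A3 by auto
    show "mat_adjoint A3 $$ (i, j) = A3 $$ (i, j)"
      unfolding mat_adjoint_index[OF A3 i j] using i j Bsym[of "Suc i" "Suc j"] by (simp add: A3_def)
  qed (use A3 in auto)
  obtain U3 where U3: "U3 \<in> carrier_mat m m" "mat_adjoint U3 * U3 = 1\<^sub>m m"
    "mat_adjoint U3 * A3 * U3 = mat_diag m (\<lambda>i. es' ! i)" and er': "\<forall>e\<in>set es'. e \<in> \<real>"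
    using Suc.IH[OF A3 A3h cp3 es(2)] by blast
  define V where "V = four_block_mat (1\<^sub>m 1) (0\<^sub>m 1 m) (0\<^sub>m m 1) U3"
  define V' where "V' = four_block_mat (1\<^sub>m 1) (0\<^sub>m 1 m) (0\<^sub>m m 1) (mat_adjoint U3)"
  have U3': "mat_adjoint U3 \<in> carrier_mat m m" using U3 by simp
  have V: "V \<in> carrier_mat (Suc m) (Suc m)" using U3 by (auto simp: V_def)
  have V'eq: "mat_adjoint V = V'"
    by (rule eq_matI) (use U3 in \<open>auto simp: V_def V'_def\<close>)
  have V': "V' \<in> carrier_mat (Suc m) (Suc m)" using V V'eq by auto
  have V'V: "V' * V = 1\<^sub>m (Suc m)"
    unfolding V_def V'_def
    by (subst mult_block_diag_mat[OF _ _ U3' U3(1)]) (auto simp: U3(2))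
  have V'BV: "V' * B * V = mat_diag (Suc m) (\<lambda>i. es ! i)"
  proof -
    have "V' * B = four_block_mat E (0\<^sub>m 1 m) (0\<^sub>m m 1) (mat_adjoint U3 * A3)"
      unfolding V'_def Bblock
      by (subst mult_block_diag_mat[OF _ E U3' A3]) (use E in auto)
    also have "\<dots> * V = four_block_mat E (0\<^sub>m 1 m) (0\<^sub>m m 1) (mat_adjoint U3 * A3 * U3)"
      unfolding V_def
      by (subst mult_block_diag_mat[OF E _ mult_carrier_mat[OF U3' A3] U3(1)]) (use E in auto)
    also have "\<dots> = mat_diag (Suc m) (\<lambda>i. es ! i)"
      unfolding U3(3) by (rule eq_matI) (auto simp: E_def mat_diag_def es nth_Cons')
    finally show ?thesis .
  qed
  define U where "U = W * V"
  have U: "U \<in> carrier_mat (Suc m) (Suc m)" using W V by (simp add: U_def)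
  have U'eq: "mat_adjoint U = V' * W'" unfolding U_def mat_adjoint_mult[OF W(1) V] V'eq W'_def ..
  have "mat_adjoint U * U = V' * (W' * W) * V"
    unfolding U'eq unfolding U_def using V V' W(1) W' by (simp add: assoc_mult_mat[of _ "Suc m" "Suc m" _ "Suc m" _ "Suc m"])
  then have "mat_adjoint U * U = 1\<^sub>m (Suc m)" unfolding W'W using V' V V'V by simp
  moreover have "mat_adjoint U * A * U = V' * B * V"
    unfolding U'eq unfolding U_def B_def using V V' W(1) W' A by (simp add: assoc_mult_mat[of _ "Suc m" "Suc m" _ "Suc m" _ "Suc m"])
  ultimately show ?case using U V'BV er er' es by (intro bexI[of _ U]) auto
qed

lemma proots_prod_linear: "proots (\<Prod>e\<leftarrow>es. [:- e, 1:]) = mset (es :: complex list)"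
proof (induction es)
  case (Cons e es)
  have "(\<Prod>e\<leftarrow>es. [:- e, 1:]) \<noteq> 0" by (auto simp: prod_list_zero_iff)
  then show ?case using Cons by (simp add: proots_mult del: mult_pCons_left)
qed simp

text \<open>The spectral decomposition in entries. It turns the number of negative eigenvalues into a count of
indices: the negative columns of \<open>U\<close> span a subspace on which the form of \<open>A\<close> is negative definite,
and the form is nonnegative on the orthogonal complement.\<close>

theorem hermitian_inertia:
  assumes A: "A \<in> carrier_mat n n" and herm: "\<And>i j. i < n \<Longrightarrow> j < n \<Longrightarrow> A $$ (i, j) = cnj (A $$ (j, i))"
  obtains U :: "nat \<Rightarrow> nat \<Rightarrow> complex" and d :: "nat \<Rightarrow> real" where
    "\<And>i j. i < n \<Longrightarrow> j < n \<Longrightarrow> A $$ (i, j) = (\<Sum>l<n. complex_of_real (d l) * (U i l * cnj (U j l)))"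
    "\<And>l m. l < n \<Longrightarrow> m < n \<Longrightarrow> (\<Sum>i<n. cnj (U i l) * U i m) = (if l = m then 1 else 0)"
    "num_neg_eigenvalues A = card {l. l < n \<and> d l < 0}"
proof -
  obtain es where es: "char_poly A = (\<Prod>e\<leftarrow>es. [:- e, 1:])" "length es = n"
    using char_poly_factorized[OF A] by (elim exE conjE)
  have h: "mat_adjoint A = A"
  proof (rule eq_matI)
    fix i j assume "i < dim_row A" "j < dim_col A"
    then have i: "i < n" and j: "j < n" using A by auto
    show "mat_adjoint A $$ (i, j) = A $$ (i, j)"
      unfolding mat_adjoint_index[OF A i j] by (rule herm[OF i j, symmetric])
  qed (use A in auto)
  obtain M where M: "M \<in> carrier_mat n n" "mat_adjoint M * M = 1\<^sub>m n"
    "mat_adjoint M * A * M = mat_diag n (\<lambda>i. es ! i)" and er: "\<forall>e\<in>set es. e \<in> \<real>"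
    using hermitian_spectral_theorem[OF A h es] by blast
  define M' where "M' = mat_adjoint M"
  have M': "M' \<in> carrier_mat n n" using M by (simp add: M'_def)
  have MM': "M * M' = 1\<^sub>m n" unfolding M'_def
    by (rule mat_mult_left_right_inverse[OF mat_adjoint_carrier[OF M(1)] M(1) M(2)])
  define D where "D = mat_diag n (\<lambda>i. es ! i)"
  have D: "D \<in> carrier_mat n n" by (simp add: D_def)
  have "A = (M * M') * A * (M * M')" unfolding MM' using A by simp
  also have "\<dots> = M * (M' * A * M) * M'"
    using M(1) M' A by (simp add: assoc_mult_mat[of _ n n _ n _ n])
  also have "M' * A * M = D" using M(3) by (simp add: M'_def D_def)
  finally have AD: "A = M * D * M'" .
  define d where "d = (\<lambda>i. Re (es ! i))"
  have ed: "es ! i = complex_of_real (d i)" if "i < n" for i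
    using er es(2) that by (simp add: d_def)
  show ?thesis
  proof (rule that[of d "\<lambda>i j. M $$ (i, j)"])
    fix i j assume i: "i < n" and j: "j < n"
    have "A $$ (i, j) = (\<Sum>l<n. (M * D) $$ (i, l) * M' $$ (l, j))"
      by (subst AD) (rule mat_mult_index_sum[OF mult_carrier_mat[OF M(1) D] M' i j])
    also have "\<dots> = (\<Sum>l<n. complex_of_real (d l) * (M $$ (i, l) * cnj (M $$ (j, l))))"
      using M(1) i j ed by (intro sum.cong refl) (auto simp: D_def mat_diag_mult_right[OF M(1)] M'_def)
    finally show "A $$ (i, j) = (\<Sum>l<n. complex_of_real (d l) * (M $$ (i, l) * cnj (M $$ (j, l))))" .
  next
    fix l m assume l: "l < n" and m: "m < n"
    have "(M' * M) $$ (l, m) = (\<Sum>i<n. M' $$ (l, i) * M $$ (i, m))"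
      by (rule mat_mult_index_sum[OF M' M(1) l m])
    also have "\<dots> = (\<Sum>i<n. cnj (M $$ (i, l)) * M $$ (i, m))"
      using M(1) l by (simp add: M'_def)
    finally show "(\<Sum>i<n. cnj (M $$ (i, l)) * M $$ (i, m)) = (if l = m then 1 else 0)"
      using M(2) l m by (simp add: M'_def)
  next
    have "proots (char_poly A) = mset es"
      unfolding es(1) by (rule proots_prod_linear)
    then have "num_neg_eigenvalues A = length (filter (\<lambda>x. x \<in> \<real> \<and> Re x < 0) es)"
      by (simp add: num_neg_eigenvalues_def flip: mset_filter)
    also have "\<dots> = card {l. l < n \<and> (es ! l \<in> \<real> \<and> Re (es ! l) < 0)}"
      by (simp add: length_filter_conv_card es(2))
    also have "{l. l < n \<and> (es ! l \<in> \<real> \<and> Re (es ! l) < 0)} = {l. l < n \<and> d l < 0}"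
      using ed by auto
    finally show "num_neg_eigenvalues A = card {l. l < n \<and> d l < 0}" .
  qed
qed

text \<open>Gaussian elimination: the last equation expresses one unknown by the others.\<close>

lemma underdetermined_system_nonzero:
  fixes A :: "nat \<Rightarrow> 'j \<Rightarrow> 'a :: field"
  assumes "finite J" "k < card J"
  shows "\<exists>\<alpha>. (\<exists>j\<in>J. \<alpha> j \<noteq> 0) \<and> (\<forall>l<k. (\<Sum>j\<in>J. A l j * \<alpha> j) = 0)"
  using assms
proof (induction k arbitrary: A J)
  case 0
  then obtain j where "j \<in> J" by fastforce
  then show ?case by (intro exI[of _ "\<lambda>_. 1"]) auto
next
  case (Suc k)
  show ?case
  proof (cases "\<forall>j\<in>J. A k j = 0")
    case True
    obtain \<alpha> where "\<exists>j\<in>J. \<alpha> j \<noteq> 0" "\<forall>l<k. (\<Sum>j\<in>J. A l j * \<alpha> j) = 0"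
      using Suc.IH[of J A] Suc.prems by auto
    then show ?thesis using True by (intro exI[of _ \<alpha>]) (auto simp: less_Suc_eq)
  next
    case False
    then obtain p where p: "p \<in> J" "A k p \<noteq> 0" by blast
    define A' where "A' = (\<lambda>l j. A l j - A l p * A k j / A k p)"
    have "k < card (J - {p})" using Suc.prems p by simp
    then obtain \<alpha> where \<alpha>: "\<exists>j\<in>J - {p}. \<alpha> j \<noteq> 0" "\<forall>l<k. (\<Sum>j\<in>J - {p}. A' l j * \<alpha> j) = 0"
      using Suc.IH[of "J - {p}" A'] Suc.prems by auto
    define \<beta> where "\<beta> = \<alpha>(p := - (\<Sum>j\<in>J - {p}. A k j * \<alpha> j) / A k p)"
    have sum: "(\<Sum>j\<in>J. A l j * \<beta> j) = (\<Sum>j\<in>J - {p}. A' l j * \<alpha> j)" for l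
    proof -
      have "(\<Sum>j\<in>J. A l j * \<beta> j) = A l p * \<beta> p + (\<Sum>j\<in>J - {p}. A l j * \<beta> j)"
        using Suc.prems p by (simp add: sum.remove)
      also have "(\<Sum>j\<in>J - {p}. A l j * \<beta> j) = (\<Sum>j\<in>J - {p}. A l j * \<alpha> j)"
        by (intro sum.cong) (auto simp: \<beta>_def)
      also have "A l p * \<beta> p = (\<Sum>j\<in>J - {p}. - (A l p * A k j / A k p) * \<alpha> j)"
        by (simp add: \<beta>_def sum_distrib_left sum_divide_distrib sum_negf mult_ac)
      finally show ?thesis by (simp add: A'_def left_diff_distrib sum_subtractf sum_negf)
    qed
    have "(\<Sum>j\<in>J. A l j * \<beta> j) = 0" if "l < Suc k" for l
    proof (cases "l = k")
      case True
      then show ?thesis unfolding sum using p by (simp add: A'_def)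
    next
      case False
      then show ?thesis unfolding sum using \<alpha>(2) that by simp
    qed
    moreover have "\<exists>j\<in>J. \<beta> j \<noteq> 0" using \<alpha>(1) by (auto simp: \<beta>_def)
    ultimately show ?thesis by blast
  qed
qed

lemma underdetermined_system:
  fixes A :: "nat \<Rightarrow> 'j \<Rightarrow> complex"
  assumes "finite J" "k < card J"
  obtains \<alpha> where "(\<Sum>j\<in>J. (cmod (\<alpha> j))\<^sup>2) = 1" "\<And>l. l < k \<Longrightarrow> (\<Sum>j\<in>J. A l j * \<alpha> j) = 0"
proof -
  obtain \<alpha> where \<alpha>: "\<exists>j\<in>J. \<alpha> j \<noteq> 0" "\<And>l. l < k \<Longrightarrow> (\<Sum>j\<in>J. A l j * \<alpha> j) = 0"
    using underdetermined_system_nonzero[OF assms, of A] by blast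
  define s where "s = (\<Sum>j\<in>J. (cmod (\<alpha> j))\<^sup>2)"
  from \<alpha>(1) obtain p where p: "p \<in> J" "\<alpha> p \<noteq> 0" by blast
  have s: "s > 0" unfolding s_def by (rule sum_pos2[OF assms(1) p(1)]) (use p in auto)
  show ?thesis
  proof (rule that[of "\<lambda>j. \<alpha> j / complex_of_real (sqrt s)"])
    show "(\<Sum>j\<in>J. (cmod (\<alpha> j / complex_of_real (sqrt s)))\<^sup>2) = 1"
      using s by (simp add: norm_divide power_divide sum_divide_distrib[symmetric] s_def[symmetric])
    show "(\<Sum>j\<in>J. A l j * (\<alpha> j / complex_of_real (sqrt s))) = 0" if "l < k" for l
      using \<alpha>(2)[OF that] by (simp add: sum_divide_distrib[symmetric])
  qed
qed

section \<open>The Schur class and its kernel\<close>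

text \<open>The form of the maximum principle used throughout: the bound near the circle may depend on the
radius, provided that it tends to 1.\<close>

lemma maximum_principle_radial_bound:
  assumes f: "f holomorphic_on ball 0 1"
    and h: "(h \<longlongrightarrow> 1) (at_left 1)"
    and le: "r0 < 1" "\<And>z. r0 < cmod z \<Longrightarrow> cmod z < 1 \<Longrightarrow> cmod (f z) \<le> h (cmod z)"
    and z: "cmod z < 1"
  shows "cmod (f z) \<le> 1"
proof (rule field_le_epsilon)
  fix e :: real assume e: "e > 0"
  define m where "m = max 0 (max r0 (cmod z))"
  have m: "m < 1" using le z by (auto simp: m_def)
  have "eventually (\<lambda>s. h s < 1 + e) (at_left 1)"
    using h e by (intro order_tendstoD) auto
  moreover have "eventually (\<lambda>s. s \<in> {m<..<1}) (at_left (1::real))"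
    by (rule eventually_at_leftI[OF _ m]) auto
  ultimately have "eventually (\<lambda>s. h s < 1 + e \<and> s \<in> {m<..<1}) (at_left (1::real))"
    by eventually_elim auto
  then obtain s where s: "h s < 1 + e" "m < s" "s < 1"
    using eventually_happens'[OF trivial_limit_at_left_real] by force
  have sub: "cball 0 s \<subseteq> ball (0::complex) 1" using s by auto
  show "cmod (f z) \<le> 1 + e"
  proof (rule maximum_modulus_frontier[where f = f and S = "cball 0 s" and \<xi> = z])
    show "f holomorphic_on interior (cball 0 s)"
      using f sub by (meson holomorphic_on_subset interior_subset order_trans)
    show "continuous_on (closure (cball 0 s)) f"
      using holomorphic_on_imp_continuous_on[OF holomorphic_on_subset[OF f sub]] by simp
    show "bounded (cball (0::complex) s)" by simp
    show "z \<in> cball 0 s" using s by (auto simp: m_def)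
    fix u :: complex assume "u \<in> frontier (cball 0 s)"
    then have u: "cmod u = s" by (simp add: frontier_cball)
    have "cmod (f u) \<le> h (cmod u)"
      using u s by (intro le) (auto simp: m_def)
    then show "cmod (f u) \<le> 1 + e" using u s by simp
  qed
qed

definition blaschke_factor :: "complex \<Rightarrow> complex \<Rightarrow> complex" where
  "blaschke_factor a z = (z - a) / (1 - cnj a * z)"

lemma one_minus_cnj_mult_neq_0:
  assumes "cmod a \<le> 1" "cmod z < 1" shows "1 - cnj a * z \<noteq> 0"
proof
  assume "1 - cnj a * z = 0"
  then have "cmod (cnj a * z) = 1" by (metis eq_iff_diff_eq_0 norm_one)
  moreover have "cmod (cnj a * z) \<le> 1 * cmod z"
    unfolding norm_mult by (rule mult_right_mono) (use assms in auto)
  ultimately show False using assms by simp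
qed

lemma cmod_power2_complex: "complex_of_real ((cmod z)\<^sup>2) = z * cnj z"
  by (metis complex_norm_square)

text \<open>The polarized version of the formula for the modulus of a Moebius transformation; it makes the
kernel of a single Blaschke factor a rank one kernel.\<close>

lemma blaschke_factor_kernel:
  assumes "cmod a < 1" "cmod z < 1" "cmod x < 1"
  shows "1 - blaschke_factor a z * cnj (blaschke_factor a x) =
    (1 - a * cnj a) * (1 - z * cnj x) / ((1 - cnj a * z) * cnj (1 - cnj a * x))"
proof -
  have "1 - cnj a * z \<noteq> 0" "1 - cnj a * x \<noteq> 0"
    using assms by (simp_all only: one_minus_cnj_mult_neq_0 less_imp_le not_False_eq_True)
  then have "1 - cnj a * z \<noteq> 0" "cnj (1 - cnj a * x) \<noteq> 0" by (metis complex_cnj_zero_iff)+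
  then show ?thesis
    unfolding blaschke_factor_def complex_cnj_divide
    by (simp add: divide_simps) (simp add: algebra_simps)
qed

lemma blaschke_factor_modulus:
  assumes "cmod a < 1" "cmod z < 1"
  shows "1 - (cmod (blaschke_factor a z))\<^sup>2 =
    (1 - (cmod a)\<^sup>2) * (1 - (cmod z)\<^sup>2) / (cmod (1 - cnj a * z))\<^sup>2"
proof -
  have "complex_of_real (1 - (cmod (blaschke_factor a z))\<^sup>2) =
    complex_of_real ((1 - (cmod a)\<^sup>2) * (1 - (cmod z)\<^sup>2) / (cmod (1 - cnj a * z))\<^sup>2)"
    unfolding of_real_diff of_real_mult of_real_divide cmod_power2_complex of_real_1
    by (rule blaschke_factor_kernel) (use assms in auto)
  then show ?thesis using of_real_eq_iff by blast
qed

lemma blaschke_factor_less_1: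
  assumes "cmod a < 1" "cmod z < 1"
  shows "cmod (blaschke_factor a z) < 1"
proof -
  have "0 < (1 - (cmod a)\<^sup>2) * (1 - (cmod z)\<^sup>2) / (cmod (1 - cnj a * z))\<^sup>2"
    using assms one_minus_cnj_mult_neq_0[of a z]
    by (intro divide_pos_pos mult_pos_pos) (auto simp: power_less_one_iff abs_square_less_1)
  then show ?thesis
    unfolding blaschke_factor_modulus[OF assms, symmetric] by (simp add: abs_square_less_1)
qed

lemma blaschke_factor_holomorphic:
  "cmod a < 1 \<Longrightarrow> blaschke_factor a holomorphic_on ball 0 1"
  unfolding blaschke_factor_def[abs_def]
  by (intro holomorphic_intros) (use one_minus_cnj_mult_neq_0[of a] in auto)

lemma schur_classD:
  assumes "S \<in> schur_class"
  shows "S holomorphic_on ball 0 1" "cmod z < 1 \<Longrightarrow> cmod (S z) \<le> 1"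
  using assms by (auto simp: schur_class_def image_subset_iff)

lemma schur_classI:
  assumes "S holomorphic_on ball 0 1" "\<And>z. cmod z < 1 \<Longrightarrow> cmod (S z) \<le> 1"
  shows "S \<in> schur_class"
  using assms by (auto simp: schur_class_def image_subset_iff)

text \<open>Schwarz's lemma at an arbitrary point. The quotient is bounded near the circle because the modulus
of the Blaschke factor tends to 1 there, uniformly in the argument.\<close>

lemma schur_class_divide_blaschke_factor:
  assumes S: "S \<in> schur_class" and a: "cmod a < 1" and z: "S a = 0"
  obtains S1 where "S1 \<in> schur_class" "\<And>z. cmod z < 1 \<Longrightarrow> S z = blaschke_factor a z * S1 z"
proof -
  note hol = schur_classD(1)[OF S]
  define g where "g = (\<lambda>z. if z = a then deriv S a else S z / (z - a) - S a / (z - a))"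
  have g: "g holomorphic_on ball 0 1"
    unfolding g_def by (rule pole_theorem_open[OF hol]) auto
  have Sg: "S z = (z - a) * g z" for z using z by (simp add: g_def)
  define S1 where "S1 = (\<lambda>z. g z * (1 - cnj a * z))"
  have hol1: "S1 holomorphic_on ball 0 1" unfolding S1_def using g by (intro holomorphic_intros)
  have eq: "S z = blaschke_factor a z * S1 z" if "cmod z < 1" for z
    using one_minus_cnj_mult_neq_0[of a z] a that
    by (simp add: S1_def blaschke_factor_def Sg)
  define c where "c = (1 - (cmod a)\<^sup>2) / (1 - cmod a)\<^sup>2"
  have c: "c > 0" unfolding c_def using a by (intro divide_pos_pos) (auto simp: abs_square_less_1)
  define h where "h = (\<lambda>s. 1 / sqrt (1 - c * (1 - s\<^sup>2)))"
  have h: "(h \<longlongrightarrow> 1) (at_left 1)"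
    unfolding h_def by (rule tendsto_eq_intros refl | simp)+
  have "((\<lambda>s. 1 - c * (1 - s\<^sup>2)) \<longlongrightarrow> 1 - c * (1 - 1\<^sup>2)) (at_left (1::real))"
    by (intro tendsto_intros)
  then have "eventually (\<lambda>s. 1 - c * (1 - s\<^sup>2) > 0) (at_left (1::real))"
    by (intro order_tendstoD) auto
  then obtain r0 where r0: "r0 < 1" "\<And>s. r0 < s \<Longrightarrow> s < 1 \<Longrightarrow> 1 - c * (1 - s\<^sup>2) > 0"
    unfolding eventually_at_left_field by auto
  have "S1 \<in> schur_class"
  proof (rule schur_classI[OF hol1], rule maximum_principle_radial_bound[OF hol1 h r0(1)])
    fix z assume "r0 < cmod z" and z1: "cmod z < 1"
    with r0 have pos: "1 - c * (1 - (cmod z)\<^sup>2) > 0" by blast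
    have "1 - cmod a \<le> 1 - cmod (cnj a * z)"
      using z1 by (simp add: norm_mult mult_left_le)
    also have "\<dots> \<le> cmod (1 - cnj a * z)" by (metis norm_one norm_triangle_ineq2)
    finally have "(1 - cmod a)\<^sup>2 \<le> (cmod (1 - cnj a * z))\<^sup>2" using a by (intro power_mono) auto
    then have "(1 - (cmod a)\<^sup>2) * (1 - (cmod z)\<^sup>2) / (cmod (1 - cnj a * z))\<^sup>2 \<le>
        (1 - (cmod a)\<^sup>2) * (1 - (cmod z)\<^sup>2) / (1 - cmod a)\<^sup>2"
      using a z1 one_minus_cnj_mult_neq_0[of a z]
      by (intro divide_left_mono mult_nonneg_nonneg mult_pos_pos) (auto simp: abs_square_le_1)
    then have "1 - (cmod (blaschke_factor a z))\<^sup>2 \<le> c * (1 - (cmod z)\<^sup>2)"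
      unfolding blaschke_factor_modulus[OF a z1] c_def by simp
    then have "sqrt (1 - c * (1 - (cmod z)\<^sup>2)) \<le> cmod (blaschke_factor a z)"
      by (intro real_le_lsqrt) auto
    then have "cmod (S1 z) * sqrt (1 - c * (1 - (cmod z)\<^sup>2)) \<le> cmod (S1 z) * cmod (blaschke_factor a z)"
      by (intro mult_left_mono) auto
    also have "\<dots> = cmod (S z)" using eq[OF z1] by (simp add: norm_mult)
    also have "\<dots> \<le> 1" using schur_classD(2)[OF S z1] .
    finally show "cmod (S1 z) \<le> h (cmod z)"
      unfolding h_def using pos by (simp add: pos_le_divide_eq)
  qed auto
  with eq show ?thesis by (intro that)
qed

lemma schur_class_unimodular_value_const:
  assumes S: "S \<in> schur_class" and a: "cmod a < 1" "cmod (S a) = 1" and z: "cmod z < 1"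
  shows "S z = S a"
proof -
  have "S constant_on ball 0 1"
    by (rule maximum_modulus_principle[OF schur_classD(1)[OF S], of "ball 0 1" a])
       (use a schur_classD(2)[OF S] in auto)
  then show ?thesis using a z unfolding constant_on_def by auto
qed

text \<open>One step of the Schur algorithm: \<open>S1\<close> is the function to which the Schur class is reduced after
moving \<open>S a\<close> to 0 by a Moebius transformation and dividing by the Blaschke factor.\<close>

lemma schur_algorithm_step:
  assumes S: "S \<in> schur_class" and a: "cmod a < 1" and s: "cmod (S a) < 1"
  obtains S1 where "S1 \<in> schur_class"
    "\<And>z. cmod z < 1 \<Longrightarrow> S z - S a = blaschke_factor a z * S1 z * (1 - cnj (S a) * S z)"
proof -
  have nz: "1 - cnj (S a) * S z \<noteq> 0" if "cmod z < 1" for z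
    using one_minus_cnj_mult_neq_0[of "S z" "S a"] schur_classD(2)[OF S that] s
    by (metis complex_cnj_cnj complex_cnj_diff complex_cnj_mult complex_cnj_one complex_cnj_zero_iff mult.commute)
  define G where "G = (\<lambda>z. (S z - S a) / (1 - cnj (S a) * S z))"
  have "G \<in> schur_class"
  proof (rule schur_classI)
    show "G holomorphic_on ball 0 1"
      unfolding G_def using nz by (intro holomorphic_intros schur_classD[OF S]) auto
    fix z assume z: "cmod z < 1"
    show "cmod (G z) \<le> 1"
    proof (cases "cmod (S z) = 1")
      case True
      have "S a = S z" using schur_class_unimodular_value_const[OF S z True a] .
      then show ?thesis using True s by simp
    next
      case False
      then have "cmod (S z) < 1" using schur_classD(2)[OF S z] by simp
      from blaschke_factor_less_1[OF s this] show ?thesis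
        by (simp add: G_def blaschke_factor_def)
    qed
  qed
  moreover have "G a = 0" by (simp add: G_def)
  ultimately obtain S1 where S1: "S1 \<in> schur_class"
    "\<And>z. cmod z < 1 \<Longrightarrow> G z = blaschke_factor a z * S1 z"
    using schur_class_divide_blaschke_factor[OF _ a] by metis
  have "S z - S a = blaschke_factor a z * S1 z * (1 - cnj (S a) * S z)" if "cmod z < 1" for z
    using S1(2)[OF that] nz[OF that] by (simp add: G_def field_simps)
  with S1(1) show ?thesis by (rule that)
qed

text \<open>Free of divisions, so that \<open>a\<close> may tend to the boundary in Julia's lemma.\<close>

lemma schwarz_pick:
  assumes S: "S \<in> schur_class" and a: "cmod a < 1" and z: "cmod z < 1"
  shows "(cmod (1 - cnj (S a) * S z))\<^sup>2 * ((1 - (cmod a)\<^sup>2) * (1 - (cmod z)\<^sup>2)) \<le>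
    (1 - (cmod (S a))\<^sup>2) * (1 - (cmod (S z))\<^sup>2) * (cmod (1 - cnj a * z))\<^sup>2"
proof -
  have id: "(cmod (1 - cnj p * q))\<^sup>2 - (cmod (q - p))\<^sup>2 = (1 - (cmod p)\<^sup>2) * (1 - (cmod q)\<^sup>2)" for p q
    unfolding cmod_power2 by (simp add: algebra_simps power2_eq_square)
  have main: "(cmod (S z - S a))\<^sup>2 * (cmod (1 - cnj a * z))\<^sup>2 \<le>
    (cmod (z - a))\<^sup>2 * (cmod (1 - cnj (S a) * S z))\<^sup>2"
  proof (cases "cmod (S a) = 1")
    case True
    then have "S z = S a" using schur_class_unimodular_value_const[OF S a True z] by simp
    then show ?thesis by simp
  next
    case False
    then have "cmod (S a) < 1" using schur_classD(2)[OF S a] by simp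
    then obtain S1 where S1: "S1 \<in> schur_class"
      and eq: "S z - S a = blaschke_factor a z * S1 z * (1 - cnj (S a) * S z)"
      using schur_algorithm_step[OF S a] z by metis
    have nz: "1 - cnj a * z \<noteq> 0" using one_minus_cnj_mult_neq_0 a z by simp
    have "(S z - S a) * (1 - cnj a * z) = (z - a) * (1 - cnj (S a) * S z) * S1 z"
      unfolding eq using nz by (simp add: blaschke_factor_def)
    then have "cmod (S z - S a) * cmod (1 - cnj a * z) = cmod (z - a) * cmod (1 - cnj (S a) * S z) * cmod (S1 z)"
      by (metis norm_mult)
    also have "\<dots> \<le> cmod (z - a) * cmod (1 - cnj (S a) * S z) * 1"
      using schur_classD(2)[OF S1 z] by (intro mult_left_mono) auto
    finally have "(cmod (S z - S a) * cmod (1 - cnj a * z))\<^sup>2 \<le> (cmod (z - a) * cmod (1 - cnj (S a) * S z))\<^sup>2"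
      by (intro power_mono) auto
    then show ?thesis by (simp add: power_mult_distrib)
  qed
  have i1: "(cmod (S z - S a))\<^sup>2 = (cmod (1 - cnj (S a) * S z))\<^sup>2 - (1 - (cmod (S a))\<^sup>2) * (1 - (cmod (S z))\<^sup>2)"
    using id[of "S a" "S z"] by simp
  have i2: "(cmod (z - a))\<^sup>2 = (cmod (1 - cnj a * z))\<^sup>2 - (1 - (cmod a)\<^sup>2) * (1 - (cmod z)\<^sup>2)"
    using id[of a z] by simp
  show ?thesis using main unfolding i1 i2 by (simp add: algebra_simps)
qed

definition schur_kernel :: "(complex \<Rightarrow> complex) \<Rightarrow> complex \<Rightarrow> complex \<Rightarrow> complex" where
  "schur_kernel S z x = (1 - S z * cnj (S x)) / (1 - z * cnj x)"

lemma sum_sum_mult_cnj: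
  "(\<Sum>i\<in>I. \<Sum>j\<in>I. F i * cnj (F j)) = complex_of_real ((cmod (\<Sum>i\<in>I. F i))\<^sup>2)"
  unfolding cmod_power2_complex by (simp add: sum_product)

lemma blaschke_factor_kernel_rank_one:
  assumes "cmod a < 1" "cmod z < 1" "cmod x < 1"
  shows "(1 - blaschke_factor a z * cnj (blaschke_factor a x)) / (1 - z * cnj x) =
    (complex_of_real (sqrt (1 - (cmod a)\<^sup>2)) / (1 - cnj a * z)) * 
     cnj (complex_of_real (sqrt (1 - (cmod a)\<^sup>2)) / (1 - cnj a * x))"
proof -
  have "1 - z * cnj x \<noteq> 0"
    using one_minus_cnj_mult_neq_0[of x z] assms by (simp add: mult.commute)
  moreover have "complex_of_real (sqrt (1 - (cmod a)\<^sup>2)) * complex_of_real (sqrt (1 - (cmod a)\<^sup>2)) = 1 - a * cnj a"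
    using assms unfolding of_real_mult[symmetric] cmod_power2_complex[symmetric]
    by (subst real_sqrt_mult_self) (simp add: abs_square_le_1)
  ultimately show ?thesis
    unfolding blaschke_factor_kernel[OF assms] by simp
qed

text \<open>The effect of a Schur step on the kernel: it splits off a square, and the remaining kernel is
multiplied by a factor \<open>g\<close> that vanishes at \<open>a\<close>, so that the point \<open>a\<close> drops out of the form.\<close>

lemma schur_kernel_step:
  assumes S: "S \<in> schur_class" and a: "cmod a < 1" and s: "cmod (S a) < 1"
  obtains S1 f g where "S1 \<in> schur_class" "g a = 0"
    "\<And>z x. cmod z < 1 \<Longrightarrow> cmod x < 1 \<Longrightarrow>
       schur_kernel S z x = f z * cnj (f x) + g z * cnj (g x) * schur_kernel S1 z x"
proof -
  obtain S1 where S1: "S1 \<in> schur_class"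
    and eq: "\<And>z. cmod z < 1 \<Longrightarrow> S z - S a = blaschke_factor a z * S1 z * (1 - cnj (S a) * S z)"
    using schur_algorithm_step[OF S a s] by metis
  define c where "c = S a"
  define q where "q = (\<lambda>z. 1 + cnj c * blaschke_factor a z * S1 z)"
  define r where "r = complex_of_real (sqrt (1 - (cmod c)\<^sup>2))"
  have r: "r * cnj r = 1 - c * cnj c"
    unfolding r_def complex_cnj_complex_of_real of_real_mult[symmetric] cmod_power2_complex[symmetric]
    using s by (subst real_sqrt_mult_self) (simp add: c_def abs_square_le_1)
  define k where "k = (\<lambda>z. complex_of_real (sqrt (1 - (cmod a)\<^sup>2)) / (1 - cnj a * z))"
  have qS: "q z * S z = c + blaschke_factor a z * S1 z" if "cmod z < 1" for z
    using eq[OF that] by (simp add: q_def c_def algebra_simps)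
  have qnz: "q z \<noteq> 0" if "cmod z < 1" for z
  proof
    assume 0: "q z = 0"
    then have "blaschke_factor a z * S1 z = - c" using qS[OF that] by (simp add: eq_neg_iff_add_eq_0 add.commute)
    then have "1 - cnj c * c = 0" using 0 by (simp add: q_def mult.assoc)
    then show False using one_minus_cnj_mult_neq_0[of c c] s by (simp add: c_def)
  qed
  show ?thesis
  proof (rule that[OF S1, of "\<lambda>z. r * blaschke_factor a z / q z" "\<lambda>z. r * k z / q z"])
    fix z x assume z: "cmod z < 1" and x: "cmod x < 1"
    define B where "B = blaschke_factor a z"
    define Bx where "Bx = cnj (blaschke_factor a x)"
    have Dnz: "1 - z * cnj x \<noteq> 0"
      using one_minus_cnj_mult_neq_0[of x z] z x by (simp add: mult.commute)
    have k: "1 - B * Bx = k z * cnj (k x) * (1 - z * cnj x)"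
      using blaschke_factor_kernel_rank_one[OF a z x] Dnz unfolding k_def B_def Bx_def by (simp add: field_simps)
    have "q z * cnj (q x) * (1 - S z * cnj (S x)) = q z * cnj (q x) - (q z * S z) * cnj (q x * S x)"
      by (simp add: algebra_simps)
    also have "\<dots> = (1 - c * cnj c) * (1 - B * Bx * S1 z * cnj (S1 x))"
      unfolding qS[OF z] qS[OF x] by (simp add: q_def B_def Bx_def algebra_simps)
    also have "\<dots> = r * cnj r * ((1 - B * Bx) + B * Bx * (1 - S1 z * cnj (S1 x)))"
      unfolding r by (simp add: algebra_simps)
    also have "\<dots> = r * cnj r * (k z * cnj (k x) + B * Bx * schur_kernel S1 z x) * (1 - z * cnj x)"
      unfolding k using Dnz by (simp add: schur_kernel_def field_simps)
    finally have "schur_kernel S z x = r * cnj r * (k z * cnj (k x) + B * Bx * schur_kernel S1 z x) / (q z * cnj (q x))"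
      using qnz[OF z] qnz[OF x] Dnz by (simp add: schur_kernel_def field_simps)
    then show "schur_kernel S z x = r * k z / q z * cnj (r * k x / q x) +
       r * blaschke_factor a z / q z * cnj (r * blaschke_factor a x / q x) * schur_kernel S1 z x"
      using qnz[OF z] qnz[OF x] by (simp add: B_def Bx_def field_simps)
  qed (simp add: blaschke_factor_def)
qed

text \<open>Pick's theorem (the easy half), by induction on the number of points: \<open>schur_kernel_step\<close> at one of
the points removes it. The indexing by \<open>z\<close> allows repeated points.\<close>

lemma schur_kernel_psd:
  assumes "finite I" "\<And>i. i \<in> I \<Longrightarrow> cmod (z i) < 1" "S \<in> schur_class"
  shows "0 \<le> Re (\<Sum>i\<in>I. \<Sum>j\<in>I. c i * cnj (c j) * schur_kernel S (z i) (z j))"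
  using assms
proof (induction I arbitrary: S c rule: finite_induct)
  case (insert k I)
  have zk: "cmod (z k) < 1" and zI: "\<And>i. i \<in> insert k I \<Longrightarrow> cmod (z i) < 1" using insert.prems by auto
  show ?case
  proof (cases "cmod (S (z k)) = 1")
    case True
    have "schur_kernel S (z i) (z j) = 0" if "i \<in> insert k I" "j \<in> insert k I" for i j
    proof -
      have "S (z i) = S (z k)" "S (z j) = S (z k)"
        by (rule schur_class_unimodular_value_const[OF insert.prems(2) zk True], rule zI, fact that)+
      then show ?thesis using True cmod_power2_complex[of "S (z k)"] by (simp add: schur_kernel_def)
    qed
    then show ?thesis by simp
  next
    case False
    then have "cmod (S (z k)) < 1" using schur_classD(2)[OF insert.prems(2) zk] by simp
    then obtain S1 f g where S1: "S1 \<in> schur_class" and g: "g (z k) = 0" and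
      eq: "\<And>z x. cmod z < 1 \<Longrightarrow> cmod x < 1 \<Longrightarrow>
         schur_kernel S z x = f z * cnj (f x) + g z * cnj (g x) * schur_kernel S1 z x"
      using schur_kernel_step[OF insert.prems(2) zk] by metis
    define H where "H = (\<lambda>i j. (c i * g (z i)) * cnj (c j * g (z j)) * schur_kernel S1 (z i) (z j))"
    have "(\<Sum>i\<in>insert k I. \<Sum>j\<in>insert k I. c i * cnj (c j) * schur_kernel S (z i) (z j)) =
       (\<Sum>i\<in>insert k I. \<Sum>j\<in>insert k I. (c i * f (z i)) * cnj (c j * f (z j)) + H i j)"
      by (intro sum.cong refl) (simp only: eq[OF zI zI] H_def, simp add: algebra_simps)
    also have "\<dots> = complex_of_real ((cmod (\<Sum>i\<in>insert k I. c i * f (z i)))\<^sup>2) +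
        (\<Sum>i\<in>insert k I. \<Sum>j\<in>insert k I. H i j)"
      unfolding sum.distrib sum_sum_mult_cnj ..
    also have "(\<Sum>i\<in>insert k I. \<Sum>j\<in>insert k I. H i j) = (\<Sum>i\<in>I. \<Sum>j\<in>I. H i j)"
      using insert.hyps g by (simp add: H_def)
    finally have "Re (\<Sum>i\<in>insert k I. \<Sum>j\<in>insert k I. c i * cnj (c j) * schur_kernel S (z i) (z j)) =
      (cmod (\<Sum>i\<in>insert k I. c i * f (z i)))\<^sup>2 + Re (\<Sum>i\<in>I. \<Sum>j\<in>I. H i j)"
      by simp
    moreover have "0 \<le> Re (\<Sum>i\<in>I. \<Sum>j\<in>I. H i j)"
      unfolding H_def by (rule insert.IH) (use zI S1 in auto)
    ultimately show ?thesis by (metis add_nonneg_nonneg zero_le_power2)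
  qed
qed simp

lemma zero_in_schur_class: "(\<lambda>_. 0) \<in> schur_class"
  by (rule schur_classI) auto

text \<open>The same induction for \<open>S = 0\<close>, with the equality case: the Blaschke factor does not vanish at the
other points, and the square that is split off does not vanish at \<open>z k\<close>.\<close>

lemma szego_kernel_pos_def:
  assumes "finite I" "\<And>i. i \<in> I \<Longrightarrow> cmod (z i) < 1" "inj_on z I"
    and "Re (\<Sum>i\<in>I. \<Sum>j\<in>I. c i * cnj (c j) / (1 - z i * cnj (z j))) \<le> 0"
  shows "\<forall>i\<in>I. c i = 0"
  using assms
proof (induction I arbitrary: c rule: finite_induct)
  case (insert k I)
  have zk: "cmod (z k) < 1" and zI: "\<And>i. i \<in> insert k I \<Longrightarrow> cmod (z i) < 1" using insert.prems by auto
  define f where "f = (\<lambda>x. complex_of_real (sqrt (1 - (cmod (z k))\<^sup>2)) / (1 - cnj (z k) * x))"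
  define g where "g = blaschke_factor (z k)"
  have gk: "g (z k) = 0" by (simp add: g_def blaschke_factor_def)
  have eq: "1 / (1 - x * cnj y) = f x * cnj (f y) + g x * cnj (g y) / (1 - x * cnj y)"
    if "cmod x < 1" "cmod y < 1" for x y
    unfolding f_def g_def blaschke_factor_kernel_rank_one[OF zk that, symmetric]
    by (simp add: add_divide_distrib[symmetric])
  define H where "H = (\<lambda>i j. (c i * g (z i)) * cnj (c j * g (z j)) / (1 - z i * cnj (z j)))"
  have "(\<Sum>i\<in>insert k I. \<Sum>j\<in>insert k I. c i * cnj (c j) / (1 - z i * cnj (z j))) =
     (\<Sum>i\<in>insert k I. \<Sum>j\<in>insert k I. c i * cnj (c j) * (1 / (1 - z i * cnj (z j))))" by simp
  also have "\<dots> =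
     (\<Sum>i\<in>insert k I. \<Sum>j\<in>insert k I. (c i * f (z i)) * cnj (c j * f (z j)) + H i j)"
    by (intro sum.cong refl) (simp only: eq[OF zI zI] H_def, simp add: algebra_simps)
  also have "\<dots> = complex_of_real ((cmod (\<Sum>i\<in>insert k I. c i * f (z i)))\<^sup>2) +
      (\<Sum>i\<in>insert k I. \<Sum>j\<in>insert k I. H i j)"
    unfolding sum.distrib sum_sum_mult_cnj ..
  also have "(\<Sum>i\<in>insert k I. \<Sum>j\<in>insert k I. H i j) = (\<Sum>i\<in>I. \<Sum>j\<in>I. H i j)"
    using insert.hyps gk by (simp add: H_def)
  finally have tot: "(cmod (\<Sum>i\<in>insert k I. c i * f (z i)))\<^sup>2 + Re (\<Sum>i\<in>I. \<Sum>j\<in>I. H i j) \<le> 0"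
    using insert.prems(3) by simp
  have "0 \<le> Re (\<Sum>i\<in>I. \<Sum>j\<in>I. (c i * g (z i)) * cnj (c j * g (z j)) * schur_kernel (\<lambda>_. 0) (z i) (z j))"
    by (rule schur_kernel_psd) (use insert zI zero_in_schur_class in auto)
  then have nn: "0 \<le> Re (\<Sum>i\<in>I. \<Sum>j\<in>I. H i j)" by (simp add: H_def schur_kernel_def)
  with tot have 1: "(cmod (\<Sum>i\<in>insert k I. c i * f (z i)))\<^sup>2 \<le> 0" by linarith
  have 2: "Re (\<Sum>i\<in>I. \<Sum>j\<in>I. H i j) \<le> 0"
    using tot zero_le_power2[of "cmod (\<Sum>i\<in>insert k I. c i * f (z i))"] by linarith
  have "\<forall>i\<in>I. c i * g (z i) = 0"
    by (rule insert.IH) (use zI insert.prems 2 in \<open>auto simp: H_def inj_on_def\<close>)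
  moreover have "g (z i) \<noteq> 0" if "i \<in> I" for i
  proof -
    have "z i \<noteq> z k" using insert.prems(2) insert.hyps that by (auto simp: inj_on_def)
    moreover have "1 - cnj (z k) * z i \<noteq> 0" using one_minus_cnj_mult_neq_0[of "z k" "z i"] zI that zk by simp
    ultimately show ?thesis by (simp add: g_def blaschke_factor_def)
  qed
  ultimately have cI: "\<forall>i\<in>I. c i = 0" by auto
  then have "(\<Sum>i\<in>insert k I. c i * f (z i)) = c k * f (z k)" using insert.hyps by simp
  with 1 have "c k * f (z k) = 0" by simp
  moreover have "f (z k) \<noteq> 0"
  proof -
    have "1 - (cmod (z k))\<^sup>2 > 0" using zk by (simp add: abs_square_less_1)
    then have "sqrt (1 - (cmod (z k))\<^sup>2) \<noteq> 0" by simp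
    moreover have "1 - cnj (z k) * z k \<noteq> 0" using one_minus_cnj_mult_neq_0[of "z k" "z k"] zk by simp
    ultimately show ?thesis unfolding f_def by (simp only: divide_eq_0_iff of_real_eq_0_iff) simp
  qed
  ultimately show ?case using cI by simp
qed simp

section \<open>Nontangential limits and the Julia-Caratheodory theorem\<close>

abbreviation boundary_quotient :: "(complex \<Rightarrow> complex) \<Rightarrow> complex \<Rightarrow> complex \<Rightarrow> complex \<Rightarrow> complex" where
  "boundary_quotient f w t \<equiv> \<lambda>z. (1 - cnj w * f z) / (1 - cnj t * z)"

abbreviation modulus_quotient :: "(complex \<Rightarrow> complex) \<Rightarrow> complex \<Rightarrow> real" where
  "modulus_quotient f \<equiv> \<lambda>z. (1 - (cmod (f z))\<^sup>2) / (1 - (cmod z)\<^sup>2)"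

text \<open>Boundary limits are taken along arbitrary filters below a Stolz filter. Such a filter replaces the
choice of a sequence that tends to \<open>t\<close> nontangentially.\<close>

lemma eventually_stolz_region:
  assumes "cmod t = 1" "F \<le> at t within stolz_region a t"
  shows "eventually (\<lambda>z. z \<in> stolz_region a t) F" "eventually (\<lambda>z. cmod z < 1) F"
    "filterlim (\<lambda>z. z) (nhds t) F"
proof -
  have 1: "eventually (\<lambda>z. z \<in> stolz_region a t) (at t within stolz_region a t)"
    by (simp add: eventually_at_filter)
  then show 2: "eventually (\<lambda>z. z \<in> stolz_region a t) F" using assms(2) filter_leD by blast
  then show "eventually (\<lambda>z. cmod z < 1) F" by eventually_elim (auto simp: stolz_region_def)
  show "filterlim (\<lambda>z. z) (nhds t) F"
    using tendsto_mono[OF assms(2) tendsto_ident_at] .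
qed

lemma filterlim_radial_stolz_region:
  assumes "cmod t = 1" "a > 1"
  shows "filterlim (\<lambda>r. complex_of_real r * t) (at t within stolz_region a t) (at_left 1)"
proof -
  have "((\<lambda>r. complex_of_real r * t) \<longlongrightarrow> complex_of_real 1 * t) (at_left 1)"
    by (intro tendsto_intros)
  then have "((\<lambda>r. complex_of_real r * t) \<longlongrightarrow> t) (at_left 1)" by simp
  moreover have "eventually (\<lambda>r. r \<in> {0<..<1}) (at_left (1::real))"
    by (rule eventually_at_leftI[of 0]) auto
  then have "eventually (\<lambda>r. complex_of_real r * t \<in> stolz_region a t \<and> complex_of_real r * t \<noteq> t) (at_left 1)"
  proof eventually_elim
    case (elim r)
    have "complex_of_real r * t - t = complex_of_real (r - 1) * t" by (simp add: algebra_simps)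
    then have "cmod (complex_of_real r * t - t) = 1 - r" 
      using elim assms by (simp add: norm_mult del: of_real_diff)
    moreover have "t \<noteq> 0" using assms by auto
    ultimately show ?case using elim assms by (auto simp: stolz_region_def norm_mult)
  qed
  ultimately show ?thesis unfolding filterlim_at by (auto elim: eventually_mono)
qed

lemma at_within_stolz_region_nontrivial:
  assumes "cmod t = 1" "a > 1"
  shows "at t within stolz_region a t \<noteq> bot"
proof
  assume "at t within stolz_region a t = bot"
  then have "filterlim (\<lambda>r. complex_of_real r * t) bot (at_left (1::real))"
    using filterlim_radial_stolz_region[OF assms] by simp
  then have "filtermap (\<lambda>r. complex_of_real r * t) (at_left (1::real)) = bot"
    unfolding filterlim_def by (rule bot.extremum_uniqueI)
  then have "at_left (1::real) = bot" by (simp only: filtermap_bot_iff)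
  then show False by simp
qed

lemma at_within_stolz_region_le_nt_at: "a > 1 \<Longrightarrow> at t within stolz_region a t \<le> nt_at t"
  unfolding nt_at_def by (rule SUP_upper) auto

lemma nt_at_nontrivial: "cmod t = 1 \<Longrightarrow> nt_at t \<noteq> bot"
  using at_within_stolz_region_nontrivial[of t 2] at_within_stolz_region_le_nt_at[of 2 t]
  by (metis le_bot one_less_numeral_iff semiring_norm(76))

lemma tendsto_nt_at_stolz:
  "(f \<longlongrightarrow> l) (nt_at t) \<Longrightarrow> a > 1 \<Longrightarrow> F \<le> at t within stolz_region a t \<Longrightarrow> (f \<longlongrightarrow> l) F"
  unfolding tendsto_nt_at_iff using tendsto_mono by blast

lemma tendsto_nt_at_if_continuous:
  "isCont f t \<Longrightarrow> (f \<longlongrightarrow> f t) (nt_at t)"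
  unfolding tendsto_nt_at_iff isCont_def
  by (meson at_le subset_UNIV tendsto_mono)

lemma tendsto_nt_at_ident: "((\<lambda>z. z) \<longlongrightarrow> t) (nt_at t)"
  unfolding tendsto_nt_at_iff by auto

lemma eventually_nt_at_disk: "cmod t = 1 \<Longrightarrow> eventually (\<lambda>z. cmod z < 1) (nt_at t)"
  unfolding nt_at_def eventually_Sup
  using eventually_stolz_region(2)[of t] by auto

lemma tendsto_nt_at_cong:
  assumes "\<And>z. cmod z < 1 \<Longrightarrow> f z = g z" "cmod t = 1"
  shows "(f \<longlongrightarrow> l) (nt_at t) \<longleftrightarrow> (g \<longlongrightarrow> l) (nt_at t)"
  by (rule tendsto_cong, rule eventually_mono[OF eventually_nt_at_disk[OF assms(2)]]) (use assms in auto)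

lemma eventually_at_within_stolz_region_ball:
  "eventually (\<lambda>z. cmod (z - t) < e) (at t within stolz_region a t)" if "e > 0"
  using that tendsto_ident_at[of t "stolz_region a t", THEN tendstoD, of e] by (simp add: dist_norm)

text \<open>Julia's lemma is the limit of the Schwarz-Pick inequality as one of the points tends to \<open>t\<close> along a
filter on which the boundary quotient stays bounded by \<open>\<alpha>\<close>.\<close>

lemma julia_lemma:
  assumes S: "S \<in> schur_class" and F: "F \<noteq> bot"
    and disk: "eventually (\<lambda>a. cmod a < 1) F" and t: "((\<lambda>a. a) \<longlongrightarrow> t) F" and s: "(S \<longlongrightarrow> s) F"
    and bound: "eventually (\<lambda>a. 1 - (cmod (S a))\<^sup>2 \<le> \<alpha> * (1 - (cmod a)\<^sup>2)) F"
    and z: "cmod z < 1"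
  shows "(cmod (1 - cnj s * S z))\<^sup>2 * (1 - (cmod z)\<^sup>2) \<le>
    \<alpha> * (1 - (cmod (S z))\<^sup>2) * (cmod (1 - cnj t * z))\<^sup>2"
proof (rule tendsto_le[OF F])
  show "((\<lambda>a. \<alpha> * (1 - (cmod (S z))\<^sup>2) * (cmod (1 - cnj a * z))\<^sup>2) \<longlongrightarrow>
    \<alpha> * (1 - (cmod (S z))\<^sup>2) * (cmod (1 - cnj t * z))\<^sup>2) F"
    by (intro tendsto_intros t)
  show "((\<lambda>a. (cmod (1 - cnj (S a) * S z))\<^sup>2 * (1 - (cmod z)\<^sup>2)) \<longlongrightarrow>
    (cmod (1 - cnj s * S z))\<^sup>2 * (1 - (cmod z)\<^sup>2)) F"
    by (intro tendsto_intros s)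
  show "eventually (\<lambda>a. (cmod (1 - cnj (S a) * S z))\<^sup>2 * (1 - (cmod z)\<^sup>2) \<le>
    \<alpha> * (1 - (cmod (S z))\<^sup>2) * (cmod (1 - cnj a * z))\<^sup>2) F"
    using disk bound
  proof eventually_elim
    case (elim a)
    have pos: "1 - (cmod a)\<^sup>2 > 0" using elim by (simp add: abs_square_less_1)
    have nn: "0 \<le> (1 - (cmod (S z))\<^sup>2) * (cmod (1 - cnj a * z))\<^sup>2"
      using schur_classD(2)[OF S z] by (intro mult_nonneg_nonneg) (auto simp: abs_square_le_1)
    have "(1 - (cmod a)\<^sup>2) * ((cmod (1 - cnj (S a) * S z))\<^sup>2 * (1 - (cmod z)\<^sup>2)) \<le>
      (1 - (cmod (S a))\<^sup>2) * ((1 - (cmod (S z))\<^sup>2) * (cmod (1 - cnj a * z))\<^sup>2)"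
      using schwarz_pick[OF S elim(1) z] by (simp add: mult_ac)
    also have "\<dots> \<le> (\<alpha> * (1 - (cmod a)\<^sup>2)) * ((1 - (cmod (S z))\<^sup>2) * (cmod (1 - cnj a * z))\<^sup>2)"
      using elim nn by (intro mult_right_mono)
    also have "\<dots> = (1 - (cmod a)\<^sup>2) * (\<alpha> * (1 - (cmod (S z))\<^sup>2) * (cmod (1 - cnj a * z))\<^sup>2)"
      by simp
    finally show ?case using pos by (simp only: mult_le_cancel_left_pos)
  qed
qed

lemma cayley_re:
  assumes "q + 1 \<noteq> 0"
  shows "1 - (cmod ((q - 1) / (q + 1)))\<^sup>2 = 4 * Re q / (cmod (q + 1))\<^sup>2"
proof -
  have "(cmod (q + 1))\<^sup>2 - (cmod (q - 1))\<^sup>2 = 4 * Re q"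
    unfolding cmod_power2 by (simp add: power2_eq_square algebra_simps)
  moreover have "(cmod (q + 1))\<^sup>2 \<noteq> 0" using assms by simp
  ultimately show ?thesis by (simp add: norm_divide power_divide field_simps)
qed

text \<open>The Schwarz-Pick inequality for maps into the right half-plane, by the Cayley transform.\<close>

lemma schwarz_pick_half_plane:
  assumes H: "H holomorphic_on ball 0 1" and Re: "\<And>z. cmod z < 1 \<Longrightarrow> Re (H z) \<ge> 0"
    and a: "cmod a < 1" and z: "cmod z < 1"
  shows "(cmod (H z - H a))\<^sup>2 * ((1 - (cmod a)\<^sup>2) * (1 - (cmod z)\<^sup>2)) \<le>
    4 * Re (H z) * Re (H a) * (cmod (z - a))\<^sup>2"
proof -
  have nz: "H z + 1 \<noteq> 0" if "cmod z < 1" for z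
  proof
    assume "H z + 1 = 0"
    then have "Re (H z + 1) = 0" by simp
    with Re[OF that] show False by simp
  qed
  define S where "S = (\<lambda>z. (H z - 1) / (H z + 1))"
  have S: "S \<in> schur_class"
  proof (rule schur_classI)
    show "S holomorphic_on ball 0 1" unfolding S_def using nz by (intro holomorphic_intros H) auto
    fix z assume z: "cmod z < 1"
    have "0 \<le> 1 - (cmod (S z))\<^sup>2" unfolding S_def cayley_re[OF nz[OF z]] using Re[OF z] by simp
    then show "cmod (S z) \<le> 1" by (simp add: abs_square_le_1)
  qed
  have id: "(cmod (1 - cnj p * q))\<^sup>2 = (cmod (q - p))\<^sup>2 + (1 - (cmod p)\<^sup>2) * (1 - (cmod q)\<^sup>2)" for p q
    unfolding cmod_power2 by (simp add: algebra_simps power2_eq_square)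
  define A where "A = (1 - (cmod a)\<^sup>2) * (1 - (cmod z)\<^sup>2)"
  define X where "X = (1 - (cmod (S a))\<^sup>2) * (1 - (cmod (S z))\<^sup>2)"
  have *: "(cmod (S z - S a))\<^sup>2 * A \<le> X * (cmod (z - a))\<^sup>2"
    using schwarz_pick[OF S a z] unfolding id A_def[symmetric] X_def[symmetric]
    by (simp add: algebra_simps)
  define M where "M = (cmod (H z + 1))\<^sup>2 * (cmod (H a + 1))\<^sup>2"
  have Mpos: "M > 0" using nz[OF z] nz[OF a] by (simp add: M_def)
  have X: "X * M = 16 * Re (H z) * Re (H a)"
    unfolding X_def S_def cayley_re[OF nz[OF z]] cayley_re[OF nz[OF a]] M_def
    using nz[OF z] nz[OF a] by simp
  have "S z - S a = 2 * (H z - H a) / ((H z + 1) * (H a + 1))"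
    unfolding S_def using nz[OF z] nz[OF a] by (simp add: divide_simps) (simp add: algebra_simps)
  then have "(cmod (S z - S a))\<^sup>2 = 4 * (cmod (H z - H a))\<^sup>2 / M"
    by (simp only: norm_divide norm_mult power_divide power_mult_distrib M_def) simp
  then have SM: "(cmod (S z - S a))\<^sup>2 * M = 4 * (cmod (H z - H a))\<^sup>2" using Mpos by simp
  have "(cmod (S z - S a))\<^sup>2 * A * M \<le> X * (cmod (z - a))\<^sup>2 * M"
    using * Mpos by (intro mult_right_mono) auto
  then have "((cmod (S z - S a))\<^sup>2 * M) * A \<le> (X * M) * (cmod (z - a))\<^sup>2" by (simp add: mult_ac)
  then show ?thesis unfolding SM X A_def[symmetric] by (simp add: mult_ac)
qed

lemma poisson_kernel_Re:
  assumes "cmod t = 1"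
  shows "Re ((t + z) / (t - z)) = (1 - (cmod z)\<^sup>2) / (cmod (t - z))\<^sup>2"
proof -
  have "Re ((t + z) / (t - z)) = Re ((t + z) * cnj (t - z)) / (cmod (t - z))\<^sup>2"
    by (metis Re_complex_div_eq_0 Re_divide_of_real complex_div_cnj of_real_power)
  also have "Re ((t + z) * cnj (t - z)) = (cmod t)\<^sup>2 - (cmod z)\<^sup>2"
    unfolding cmod_power2 by (simp add: algebra_simps power2_eq_square)
  finally show ?thesis using assms by simp
qed

text \<open>This is the elementary core of the Julia-Caratheodory theorem. If \<open>Re h\<close> is smaller than \<open>e\<close> times
the Poisson kernel at a single point \<open>a\<close>, then the Schwarz-Pick inequality between \<open>z\<close> and \<open>a\<close>
bounds \<open>(t - z) h z\<close> by a constant multiple of \<open>e\<close> once \<open>z\<close> is close to \<open>t\<close> in a Stolz region.\<close>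

lemma nontangential_little_o_half_plane:
  assumes h: "h holomorphic_on ball 0 1" and Re: "\<And>z. cmod z < 1 \<Longrightarrow> Re (h z) \<ge> 0"
    and t: "cmod t = 1"
    and inf: "\<And>e. e > 0 \<Longrightarrow> \<exists>a. cmod a < 1 \<and> Re (h a) < e * ((1 - (cmod a)\<^sup>2) / (cmod (t - a))\<^sup>2)"
  shows "((\<lambda>z. (t - z) * h z) \<longlongrightarrow> 0) (nt_at t)"
  unfolding tendsto_nt_at_iff
proof (intro allI impI)
  fix k :: real assume k: "k > 1"
  show "((\<lambda>z. (t - z) * h z) \<longlongrightarrow> 0) (at t within stolz_region k t)" (is "(_ \<longlongrightarrow> 0) ?F")
  proof (rule tendstoI)
    fix d :: real assume d: "d > 0"
    (* chosen so that the bound 64 e k obtained below is less than d *)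
    define e where "e = d / (128 * k)"
    have e: "e > 0" using d k by (simp add: e_def)
    obtain a where a: "cmod a < 1" and ha: "Re (h a) < e * ((1 - (cmod a)\<^sup>2) / (cmod (t - a))\<^sup>2)"
      using inf[OF e] by blast
    define r where "r = min (cmod (t - a)) (d / (4 * (cmod (h a) + 1)))"
    have ta: "cmod (t - a) > 0" using a t by auto
    have pa: "1 - (cmod a)\<^sup>2 > 0" using a by (simp add: abs_square_less_1)
    have "r > 0" using ta d by (auto simp: r_def intro!: divide_pos_pos mult_pos_pos add_nonneg_pos)
    then have "eventually (\<lambda>z. cmod (z - t) < r) ?F" by (rule eventually_at_within_stolz_region_ball)
    then show "eventually (\<lambda>z. dist ((t - z) * h z) 0 < d) ?F"
      using eventually_stolz_region(1)[OF t order.refl]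
    proof eventually_elim
      case (elim z)
      then have z: "cmod z < 1" and st: "cmod (z - t) < k * (1 - cmod z)" by (auto simp: stolz_region_def)
      have tz: "cmod (t - z) = cmod (z - t)" by (simp add: norm_minus_commute)
      have tz0: "cmod (t - z) > 0" using z t by auto
      define L where "L = cmod (h z)"
      have za: "cmod (z - a) \<le> 2 * cmod (t - a)"
        using norm_triangle_ineq[of "z - t" "t - a"] elim(1) by (simp add: r_def)
      have "1 - cmod z \<le> 1 - (cmod z)\<^sup>2" using z by (simp add: power2_eq_square mult_left_le)
      then have st': "cmod (t - z) \<le> k * (1 - (cmod z)\<^sup>2)"
        using st k by (smt (verit) mult_left_mono tz)
      have "(cmod (h z - h a))\<^sup>2 * ((1 - (cmod a)\<^sup>2) * (1 - (cmod z)\<^sup>2)) \<le>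
        4 * Re (h z) * Re (h a) * (cmod (z - a))\<^sup>2"
        by (rule schwarz_pick_half_plane[OF h Re a z])
      also have "\<dots> \<le> 4 * L * (e * ((1 - (cmod a)\<^sup>2) / (cmod (t - a))\<^sup>2)) * (2 * cmod (t - a))\<^sup>2"
        unfolding L_def
        by (intro mult_mono power_mono za mult_nonneg_nonneg mult_left_mono less_imp_le[OF ha])
           (use Re[OF z] Re[OF a] e pa complex_Re_le_cmod in \<open>auto intro!: mult_nonneg_nonneg divide_nonneg_nonneg\<close>)
      also have "\<dots> = (16 * e * L) * (1 - (cmod a)\<^sup>2)"
        using ta by (simp add: power_mult_distrib)
      finally have "((cmod (h z - h a))\<^sup>2 * (1 - (cmod z)\<^sup>2)) * (1 - (cmod a)\<^sup>2) \<le> (16 * e * L) * (1 - (cmod a)\<^sup>2)"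
        by (simp add: mult_ac)
      then have 1: "(cmod (h z - h a))\<^sup>2 * (1 - (cmod z)\<^sup>2) \<le> 16 * e * L" using pa by simp
      have "(cmod (h z - h a))\<^sup>2 * cmod (t - z) \<le> (cmod (h z - h a))\<^sup>2 * (k * (1 - (cmod z)\<^sup>2))"
        using st' by (intro mult_left_mono) auto
      also have "\<dots> = k * ((cmod (h z - h a))\<^sup>2 * (1 - (cmod z)\<^sup>2))" by simp
      also have "\<dots> \<le> k * (16 * e * L)" using 1 k by (intro mult_left_mono) auto
      finally have 2: "(cmod (h z - h a))\<^sup>2 * cmod (t - z) \<le> 16 * e * k * L" by (simp add: mult_ac)
      (* if h z dominates h a, the inequality is quadratic in L on the left and linear on the right *)
      have "cmod (t - z) * L < d"
      proof (cases "L \<ge> 2 * cmod (h a)")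
        case True
        have "L - cmod (h a) \<le> cmod (h z - h a)" unfolding L_def by (rule norm_triangle_ineq2)
        then have "L / 2 \<le> cmod (h z - h a)" using True by linarith
        then have "(L / 2)\<^sup>2 \<le> (cmod (h z - h a))\<^sup>2" by (intro power_mono) (auto simp: L_def)
        then have "(L / 2)\<^sup>2 * cmod (t - z) \<le> (cmod (h z - h a))\<^sup>2 * cmod (t - z)" by (intro mult_right_mono) auto
        with 2 have "(L / 2)\<^sup>2 * cmod (t - z) \<le> 16 * e * k * L" by linarith
        then have "L * (cmod (t - z) * L) \<le> L * (64 * e * k)" by (simp add: power2_eq_square field_simps)
        moreover have "64 * e * k < d" using d k by (simp add: e_def)
        ultimately show ?thesis
        proof (cases "L = 0")
          case False
          then have "L > 0" by (simp add: L_def)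
          then have "cmod (t - z) * L \<le> 64 * e * k"
            using \<open>L * (cmod (t - z) * L) \<le> L * (64 * e * k)\<close> by (simp only: mult_le_cancel_left_pos)
          then show ?thesis using \<open>64 * e * k < d\<close> by linarith
        qed (use d in auto)
      next
        case False
        have "cmod (t - z) * L \<le> cmod (t - z) * (2 * (cmod (h a) + 1))"
          using False by (intro mult_left_mono) auto
        also have "\<dots> < (d / (4 * (cmod (h a) + 1))) * (2 * (cmod (h a) + 1))"
          using elim(1) tz by (intro mult_strict_right_mono) (auto simp: r_def intro!: add_nonneg_pos)
        also have "\<dots> = d / 2"
        proof -
          have "cmod (h a) + 1 \<noteq> 0" by (smt (verit) norm_ge_zero)
          then show ?thesis by (simp add: field_simps)
        qed
        finally show ?thesis using d by simp
      qed
      then show ?case by (simp add: L_def norm_mult)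
    qed
  qed
qed

text \<open>The number \<open>c\<close> is the infimum of \<open>Re H\<close> over the Poisson kernel at \<open>t\<close>, that is, the mass of \<open>t\<close> in
the Herglotz measure of \<open>H\<close>. After subtraction of \<open>c\<close> times the Herglotz kernel of \<open>t\<close> the infimum
is 0, and \<open>nontangential_little_o_half_plane\<close> applies to the rest.\<close>

lemma half_plane_boundary_mass:
  assumes H: "H holomorphic_on ball 0 1" and Re: "\<And>z. cmod z < 1 \<Longrightarrow> Re (H z) \<ge> 0"
    and t: "cmod t = 1"
  obtains c where "c \<ge> 0"
    "\<forall>c'. (\<forall>z. cmod z < 1 \<longrightarrow> c' * ((1 - (cmod z)\<^sup>2) / (cmod (t - z))\<^sup>2) \<le> Re (H z)) \<longrightarrow> c' \<le> c"
    "((\<lambda>z. (t - z) * H z) \<longlongrightarrow> 2 * t * complex_of_real c) (nt_at t)"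
    "((\<lambda>z. Re (H z) / ((1 - (cmod z)\<^sup>2) / (cmod (t - z))\<^sup>2)) \<longlongrightarrow> c) (nt_at t)"
proof -
  define p where "p = (\<lambda>z. (1 - (cmod z)\<^sup>2) / (cmod (t - z))\<^sup>2)"
  have p: "p z > 0" if "cmod z < 1" for z
    unfolding p_def using that t by (intro divide_pos_pos) (auto simp: abs_square_less_1)
  define X where "X = (\<lambda>z. Re (H z) / p z) ` ball 0 1"
  have X0: "x \<ge> 0" if "x \<in> X" for x
    using that Re p by (auto simp: X_def intro!: divide_nonneg_nonneg less_imp_le[OF p])
  then have bdd: "bdd_below X" by (rule bdd_belowI)
  have ne: "X \<noteq> {}" by (auto simp: X_def)
  define c where "c = Inf X"
  have c0: "c \<ge> 0" unfolding c_def using ne X0 by (rule cInf_greatest)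
  have cle: "c * p z \<le> Re (H z)" if "cmod z < 1" for z
  proof -
    have "c \<le> Re (H z) / p z"
      unfolding c_def by (rule cInf_lower[OF _ bdd]) (use that in \<open>auto simp: X_def\<close>)
    then show ?thesis using p[OF that] by (simp add: pos_le_divide_eq)
  qed
  have cmax: "c' \<le> c" if "\<And>z. cmod z < 1 \<Longrightarrow> c' * p z \<le> Re (H z)" for c'
    unfolding c_def
  proof (rule cInf_greatest[OF ne])
    fix x assume "x \<in> X"
    then obtain z where z: "cmod z < 1" "x = Re (H z) / p z" by (auto simp: X_def)
    then show "c' \<le> x" using that[OF z(1)] p[OF z(1)] by (simp add: pos_le_divide_eq)
  qed
  define h where "h = (\<lambda>z. H z - complex_of_real c * ((t + z) / (t - z)))"
  have hol: "h holomorphic_on ball 0 1"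
    unfolding h_def using t by (intro holomorphic_intros H) auto
  have Reh: "Re (h z) = Re (H z) - c * p z" if "cmod z < 1" for z
    using poisson_kernel_Re[OF t, of z] unfolding h_def p_def minus_complex.simps Re_complex_of_real times_complex.simps
    by simp
  have lim: "((\<lambda>z. (t - z) * h z) \<longlongrightarrow> 0) (nt_at t)"
  proof (rule nontangential_little_o_half_plane[OF hol _ t])
    show "Re (h z) \<ge> 0" if "cmod z < 1" for z using cle[OF that] Reh[OF that] by simp
    fix e :: real assume e: "e > 0"
    then have "Inf X < c + e" by (simp add: c_def)
    then obtain x where "x \<in> X" "x < c + e" using cInf_lessD[OF ne] by blast
    then obtain a where a: "cmod a < 1" "Re (H a) / p a < c + e" by (auto simp: X_def)
    then have "Re (h a) < e * p a" using p[OF a(1)] Reh[OF a(1)] by (simp add: pos_divide_less_eq algebra_simps)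
    then show "\<exists>a. cmod a < 1 \<and> Re (h a) < e * ((1 - (cmod a)\<^sup>2) / (cmod (t - a))\<^sup>2)"
      using a(1) unfolding p_def by blast
  qed
  have disk: "eventually (\<lambda>z. cmod z < 1) (nt_at t)" by (rule eventually_nt_at_disk[OF t])
  have "((\<lambda>z. (t - z) * h z + complex_of_real c * (t + z)) \<longlongrightarrow> 0 + complex_of_real c * (t + t)) (nt_at t)"
    by (intro tendsto_intros lim tendsto_nt_at_ident)
  moreover have "eventually (\<lambda>z. (t - z) * h z + complex_of_real c * (t + z) = (t - z) * H z) (nt_at t)"
    using disk
  proof eventually_elim
    case (elim z)
    then have "t - z \<noteq> 0" using t by auto
    then show ?case by (simp add: h_def field_simps)
  qed
  ultimately have "((\<lambda>z. (t - z) * H z) \<longlongrightarrow> 0 + complex_of_real c * (t + t)) (nt_at t)"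
    by (rule Lim_transform_eventually)
  then have lim1: "((\<lambda>z. (t - z) * H z) \<longlongrightarrow> 2 * t * complex_of_real c) (nt_at t)" by (simp add: algebra_simps)
  have lim2: "((\<lambda>z. Re (H z) / p z) \<longlongrightarrow> c) (nt_at t)"
    unfolding tendsto_nt_at_iff
  proof (intro allI impI)
    fix k :: real assume k: "k > 1"
    let ?F = "at t within stolz_region k t"
    have lim': "((\<lambda>z. (t - z) * h z) \<longlongrightarrow> 0) ?F" using lim k unfolding tendsto_nt_at_iff by blast
    have "((\<lambda>z. k * cmod ((t - z) * h z)) \<longlongrightarrow> k * cmod 0) ?F" by (intro tendsto_intros lim')
    then have "((\<lambda>z. k * cmod ((t - z) * h z)) \<longlongrightarrow> 0) ?F" by simp
    then have "((\<lambda>z. Re (H z) / p z - c) \<longlongrightarrow> 0) ?F"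
    proof (rule Lim_null_comparison[rotated])
      show "\<forall>\<^sub>F z in ?F. norm (Re (H z) / p z - c) \<le> k * cmod ((t - z) * h z)"
        using eventually_stolz_region(1)[OF t order.refl]
      proof eventually_elim
        case (elim z)
        then have z: "cmod z < 1" and st: "cmod (z - t) < k * (1 - cmod z)" by (auto simp: stolz_region_def)
        have "1 - cmod z \<le> 1 - (cmod z)\<^sup>2" using z by (simp add: power2_eq_square mult_left_le)
        then have st': "cmod (t - z) \<le> k * (1 - (cmod z)\<^sup>2)"
          using st k by (smt (verit) mult_left_mono norm_minus_commute)
        have pos: "1 - (cmod z)\<^sup>2 > 0" using z by (simp add: abs_square_less_1)
        have eq: "Re (H z) / p z - c = Re (h z) / p z" using p[OF z] Reh[OF z] by (simp add: field_simps)
        have "Re (h z) \<ge> 0" using cle[OF z] Reh[OF z] by simp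
        then have "norm (Re (H z) / p z - c) = Re (h z) / p z" unfolding eq using p[OF z] by simp
        also have "\<dots> \<le> cmod (h z) / p z"
          using p[OF z] complex_Re_le_cmod by (intro divide_right_mono) auto
        also have "\<dots> = cmod (h z) * cmod (t - z) * (cmod (t - z) / (1 - (cmod z)\<^sup>2))"
          by (simp add: p_def power2_eq_square)
        also have "\<dots> \<le> cmod (h z) * cmod (t - z) * k"
          using st' pos by (intro mult_left_mono) (auto simp: pos_divide_le_eq)
        finally show ?case by (simp add: norm_mult mult_ac)
      qed
    qed
    then show "((\<lambda>z. Re (H z) / p z) \<longlongrightarrow> c) ?F" by (simp add: LIM_zero_iff)
  qed
  show ?thesis
    by (rule that[OF c0 _ lim1 lim2[unfolded p_def]]) (use cmax[unfolded p_def] in blast)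
qed

lemma schur_class_cayley:
  assumes S: "S \<in> schur_class" and s: "cmod s = 1" and ne: "\<forall>z. cmod z < 1 \<longrightarrow> S z \<noteq> s"
  shows "(\<lambda>z. (s + S z) / (s - S z)) holomorphic_on ball 0 1" 
    "Re ((s + S z) / (s - S z)) = (1 - (cmod (S z))\<^sup>2) / (cmod (s - S z))\<^sup>2"
    "cmod z < 1 \<Longrightarrow> Re ((s + S z) / (s - S z)) \<ge> 0"
proof -
  show "(\<lambda>z. (s + S z) / (s - S z)) holomorphic_on ball 0 1"
    by (intro holomorphic_intros schur_classD[OF S]) (metis eq_iff_diff_eq_0 mem_ball_0 ne)
  show *: "Re ((s + S z) / (s - S z)) = (1 - (cmod (S z))\<^sup>2) / (cmod (s - S z))\<^sup>2" for z
    by (rule poisson_kernel_Re[OF s])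
  show "Re ((s + S z) / (s - S z)) \<ge> 0" if z: "cmod z < 1"
    unfolding * using schur_classD(2)[OF S z] by (intro divide_nonneg_nonneg) (auto simp: abs_square_le_1)
qed

text \<open>The reciprocal of \<open>c\<close> is the angular derivative of \<open>S\<close> at \<open>t\<close>. It is finite as soon as Julia's
inequality holds with some \<open>\<alpha>\<close>, because that inequality is a lower bound for \<open>Re H\<close>.\<close>

lemma schur_class_boundary_derivative:
  assumes S: "S \<in> schur_class" and s: "cmod s = 1" and t: "cmod t = 1"
    and ne: "\<forall>z. cmod z < 1 \<longrightarrow> S z \<noteq> s"
  obtains c where "c \<ge> 0"
    "((\<lambda>z. (t - z) * ((s + S z) / (s - S z))) \<longlongrightarrow> 2 * t * complex_of_real c) (nt_at t)"
    "\<forall>\<alpha>>0. (\<forall>z. cmod z < 1 \<longrightarrow> (cmod (1 - cnj s * S z))\<^sup>2 * (1 - (cmod z)\<^sup>2) \<le>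
        \<alpha> * (1 - (cmod (S z))\<^sup>2) * (cmod (1 - cnj t * z))\<^sup>2) \<longrightarrow> c > 0"
    "c > 0 \<Longrightarrow> (boundary_quotient S s t \<longlongrightarrow> complex_of_real (1 / c)) (nt_at t)"
    "c > 0 \<Longrightarrow> (modulus_quotient S \<longlongrightarrow> 1 / c) (nt_at t)"
proof -
  define H where "H = (\<lambda>z. (s + S z) / (s - S z))"
  define p where "p = (\<lambda>z. (1 - (cmod z)\<^sup>2) / (cmod (t - z))\<^sup>2)"
  have cay: "H holomorphic_on ball 0 1" "Re (H z) = (1 - (cmod (S z))\<^sup>2) / (cmod (s - S z))\<^sup>2"
    "cmod z < 1 \<Longrightarrow> Re (H z) \<ge> 0" for z
    unfolding H_def using schur_class_cayley[OF S s ne] by blast+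
  obtain c where c: "c \<ge> 0"
    "\<forall>c'. (\<forall>z. cmod z < 1 \<longrightarrow> c' * p z \<le> Re (H z)) \<longrightarrow> c' \<le> c"
    "((\<lambda>z. (t - z) * H z) \<longlongrightarrow> 2 * t * complex_of_real c) (nt_at t)"
    "((\<lambda>z. Re (H z) / p z) \<longlongrightarrow> c) (nt_at t)"
    unfolding p_def by (rule half_plane_boundary_mass[OF cay(1) cay(3) t], assumption, rule that[unfolded p_def], assumption+)
  have ss: "cnj s * s = 1" and tt: "cnj t * t = 1"
    using s t cmod_power2_complex[of s] cmod_power2_complex[of t] by (auto simp: mult.commute)
  have es: "1 - cnj s * S z = cnj s * (s - S z)" for z using ss by (simp add: algebra_simps)
  have et: "1 - cnj t * z = cnj t * (t - z)" for z using tt by (simp add: algebra_simps)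
  have cs: "cmod (1 - cnj s * S z) = cmod (s - S z)" for z unfolding es using s by (simp add: norm_mult)
  have ct: "cmod (1 - cnj t * z) = cmod (t - z)" for z unfolding et using t by (simp add: norm_mult)
  have disk: "eventually (\<lambda>z. cmod z < 1) (nt_at t)" by (rule eventually_nt_at_disk[OF t])
  (* Julia's inequality says that Re H is at least 1 / alpha times the Poisson kernel *)
  have cpos: "c > 0" if al: "\<alpha> > 0" "\<And>z. cmod z < 1 \<Longrightarrow> (cmod (1 - cnj s * S z))\<^sup>2 * (1 - (cmod z)\<^sup>2) \<le>
        \<alpha> * (1 - (cmod (S z))\<^sup>2) * (cmod (1 - cnj t * z))\<^sup>2" for \<alpha>
  proof -
    have "1 / \<alpha> \<le> c"
    proof (rule c(2)[rule_format])
      fix z assume z: "cmod z < 1"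
      have "t - z \<noteq> 0" using z t by auto
      moreover have "s - S z \<noteq> 0" using ne[rule_format, OF z] by auto
      ultimately show "1 / \<alpha> * p z \<le> Re (H z)"
        using al(2)[OF z] al(1) unfolding cs ct cay(2) p_def by (simp add: field_simps)
    qed
    then show "c > 0" using al(1) by (smt (verit) divide_pos_pos)
  qed
  have q: "(boundary_quotient S s t \<longlongrightarrow> complex_of_real (1 / c)) (nt_at t)" if "c > 0"
  proof -
    have t0: "t \<noteq> 0" using t by auto
    have "((\<lambda>z. 2 * t / ((t - z) * H z + (t - z))) \<longlongrightarrow> 2 * t / (2 * t * complex_of_real c + (t - t))) (nt_at t)"
      using that t0 by (intro tendsto_intros c(3) tendsto_nt_at_ident) auto
    moreover have "2 * t / (2 * t * complex_of_real c + (t - t)) = complex_of_real (1 / c)" using t0 by simp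
    moreover have "eventually (\<lambda>z. 2 * t / ((t - z) * H z + (t - z)) = (1 - cnj s * S z) / (1 - cnj t * z)) (nt_at t)"
      using disk
    proof eventually_elim
      case (elim z)
      have nz: "t - z \<noteq> 0" "s - S z \<noteq> 0" using elim t ne[rule_format, OF elim] by auto
      have "(t - z) * H z + (t - z) = (t - z) * (2 * s / (s - S z))"
        using nz by (simp add: H_def field_simps)
      moreover have s0: "s \<noteq> 0" using s by auto
      moreover have "cnj s = 1 / s" "cnj t = 1 / t" using ss tt s0 t0 by (auto simp: field_simps)
      ultimately show ?case unfolding es et using nz t0 by (simp add: mult.commute)
    qed
    ultimately show ?thesis using Lim_transform_eventually by fastforce
  qed
  have d: "(modulus_quotient S \<longlongrightarrow> 1 / c) (nt_at t)" if cp: "c > 0"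
  proof -
    have "((\<lambda>z. Re (H z) / p z * (cmod ((1 - cnj s * S z) / (1 - cnj t * z)))\<^sup>2) \<longlongrightarrow>
       c * (cmod (complex_of_real (1 / c)))\<^sup>2) (nt_at t)"
      by (intro tendsto_intros c(4) q[OF cp])
    moreover have "c * (cmod (complex_of_real (1 / c)))\<^sup>2 = 1 / c"
      using cp unfolding norm_of_real by (simp add: power2_eq_square)
    moreover have "eventually (\<lambda>z. Re (H z) / p z * (cmod ((1 - cnj s * S z) / (1 - cnj t * z)))\<^sup>2 =
       (1 - (cmod (S z))\<^sup>2) / (1 - (cmod z)\<^sup>2)) (nt_at t)"
      using disk
    proof eventually_elim
      case (elim z)
      have nz: "t - z \<noteq> 0" "s - S z \<noteq> 0" using elim t ne[rule_format, OF elim] by auto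
      show ?case unfolding norm_divide cs ct cay(2) p_def using nz by (simp add: power_divide)
    qed
    ultimately show ?thesis using Lim_transform_eventually by fastforce
  qed
  show ?thesis
    by (rule that[OF c(1) c(3)[unfolded H_def] _ q d]) (use cpos in blast)+
qed

text \<open>A finite limit of the difference quotient along one filter excludes \<open>c = 0\<close> in
\<open>schur_class_boundary_derivative\<close>: the product of the quotient with \<open>(t - z) (s + S) / (s - S)\<close>
tends to \<open>2 t\<close>.\<close>

theorem julia_caratheodory_quotient:
  assumes S: "S \<in> schur_class" and s: "cmod s = 1" and t: "cmod t = 1"
    and F: "F \<noteq> bot" "a > 1" "F \<le> at t within stolz_region a t"
    and lim: "(boundary_quotient S s t \<longlongrightarrow> \<gamma>) F"
  shows "\<gamma> = complex_of_real (Re \<gamma>)"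
    "(boundary_quotient S s t \<longlongrightarrow> \<gamma>) (nt_at t)"
    "(modulus_quotient S \<longlongrightarrow> Re \<gamma>) (nt_at t)"
proof -
  note ev = eventually_stolz_region[OF t F(3)]
  have ss: "cnj s * s = 1" and tt: "cnj t * t = 1" and t0: "t \<noteq> 0" and s0: "s \<noteq> 0"
    using s t cmod_power2_complex[of s] cmod_power2_complex[of t] by (auto simp: mult.commute)
  have "\<gamma> = complex_of_real (Re \<gamma>) \<and>
    (boundary_quotient S s t \<longlongrightarrow> \<gamma>) (nt_at t) \<and>
    (modulus_quotient S \<longlongrightarrow> Re \<gamma>) (nt_at t)"
  proof (cases "\<exists>z. cmod z < 1 \<and> S z = s")
    case True
    then obtain b where b: "cmod b < 1" "S b = s" by blast
    have const: "S z = s" if "cmod z < 1" for z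
      using schur_class_unimodular_value_const[OF S b(1) _ that] b s by simp
    have q0: "(1 - cnj s * S z) / (1 - cnj t * z) = 0" if "cmod z < 1" for z
      using const[OF that] ss by simp
    have "eventually (\<lambda>z. (1 - cnj s * S z) / (1 - cnj t * z) = 0) F"
      using ev(2) by eventually_elim (rule q0)
    then have "(boundary_quotient S s t \<longlongrightarrow> 0) F" by (rule tendsto_eventually)
    then have g: "\<gamma> = 0" using tendsto_unique[OF F(1) lim] by simp
    have "(boundary_quotient S s t \<longlongrightarrow> 0) (nt_at t)"
      by (rule tendsto_eventually, rule eventually_mono[OF eventually_nt_at_disk[OF t]]) (rule q0)
    moreover have "(modulus_quotient S \<longlongrightarrow> 0) (nt_at t)"
      by (rule tendsto_eventually, rule eventually_mono[OF eventually_nt_at_disk[OF t]]) (simp add: const s)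
    ultimately show ?thesis using g by simp
  next
    case False
    then have ne: "\<forall>z. cmod z < 1 \<longrightarrow> S z \<noteq> s" by blast
    obtain c where c: "c \<ge> 0"
      "((\<lambda>z. (t - z) * ((s + S z) / (s - S z))) \<longlongrightarrow> 2 * t * complex_of_real c) (nt_at t)"
      "c > 0 \<Longrightarrow> (boundary_quotient S s t \<longlongrightarrow> complex_of_real (1 / c)) (nt_at t)"
      "c > 0 \<Longrightarrow> (modulus_quotient S \<longlongrightarrow> 1 / c) (nt_at t)"
      by (rule schur_class_boundary_derivative[OF S s t ne], rule that, assumption+)
    define q where "q = boundary_quotient S s t"
    have nz: "t - z \<noteq> 0" "1 - cnj t * z \<noteq> 0" "s - S z \<noteq> 0" if "cmod z < 1" for z
      using that t ne[rule_format, OF that] one_minus_cnj_mult_neq_0[of t z] by auto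
    have SF: "(S \<longlongrightarrow> s) F"
    proof -
      have "((\<lambda>z. s - s * q z * (1 - cnj t * z)) \<longlongrightarrow> s - s * \<gamma> * (1 - cnj t * t)) F"
        unfolding q_def by (intro tendsto_intros lim ev(3))
      moreover have "eventually (\<lambda>z. s - s * q z * (1 - cnj t * z) = S z) F"
        using ev(2)
      proof eventually_elim
        case (elim z)
        have "s - s * q z * (1 - cnj t * z) = s - s * (1 - cnj s * S z)"
          using nz(2)[OF elim] by (simp add: q_def)
        also have "\<dots> = (cnj s * s) * S z" by (simp add: algebra_simps)
        finally show ?case by (simp add: ss)
      qed
      ultimately have "(S \<longlongrightarrow> s - s * \<gamma> * (1 - cnj t * t)) F" by (rule Lim_transform_eventually)
      then show ?thesis using tt by simp
    qed
    have l1: "((\<lambda>z. q z * ((t - z) * ((s + S z) / (s - S z)))) \<longlongrightarrow> \<gamma> * (2 * t * complex_of_real c)) F"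
      unfolding q_def by (intro tendsto_intros lim tendsto_nt_at_stolz[OF c(2) F(2,3)])
    have l2: "((\<lambda>z. cnj s * t * (s + S z)) \<longlongrightarrow> cnj s * t * (s + s)) F"
      by (intro tendsto_intros SF)
    have l3: "eventually (\<lambda>z. q z * ((t - z) * ((s + S z) / (s - S z))) = cnj s * t * (s + S z)) F"
      using ev(2)
    proof eventually_elim
      case (elim z)
      have "1 - cnj s * S z = cnj s * (s - S z)" "1 - cnj t * z = cnj t * (t - z)" 
        using ss tt by (auto simp: algebra_simps)
      then have "q z * ((t - z) * ((s + S z) / (s - S z))) = cnj s * (s + S z) / cnj t"
        using nz[OF elim] unfolding q_def by simp
      also have "\<dots> = cnj s * (s + S z) * (cnj t * t) / cnj t" by (simp add: tt)
      also have "\<dots> = cnj s * t * (s + S z)" using t0 by simp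
      finally show ?case .
    qed
    have "\<gamma> * (2 * t * complex_of_real c) = cnj s * t * (s + s)"
      by (rule tendsto_unique[OF F(1) Lim_transform_eventually[OF l1 l3] l2])
    then have "2 * t * (\<gamma> * complex_of_real c) = 2 * t * (cnj s * s)" by (simp add: algebra_simps)
    then have gc: "\<gamma> * complex_of_real c = 1" using t0 ss by simp
    then have cp: "c > 0" using c(1) by (cases "c = 0") auto
    then have g: "\<gamma> = complex_of_real (1 / c)" using gc by (simp add: field_simps)
    then show ?thesis using c(3,4)[OF cp] by simp
  qed
  then show "\<gamma> = complex_of_real (Re \<gamma>)"
    "(boundary_quotient S s t \<longlongrightarrow> \<gamma>) (nt_at t)"
    "(modulus_quotient S \<longlongrightarrow> Re \<gamma>) (nt_at t)" by blast+
qed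

text \<open>Here the hypothesis is on the moduli only, as it is in the definition of \<open>d\<^sub>f\<close>; Julia's lemma
provides the lower bound that makes the angular derivative finite.\<close>

theorem julia_caratheodory_bounded:
  assumes S: "S \<in> schur_class" and s: "cmod s = 1" and t: "cmod t = 1"
    and F: "F \<noteq> bot" "F \<le> at t within stolz_region a t"
    and lim: "(S \<longlongrightarrow> s) F"
    and bound: "eventually (\<lambda>a. 1 - (cmod (S a))\<^sup>2 \<le> \<alpha> * (1 - (cmod a)\<^sup>2)) F"
  obtains g where 
    "(boundary_quotient S s t \<longlongrightarrow> complex_of_real g) (nt_at t)"
    "(modulus_quotient S \<longlongrightarrow> g) (nt_at t)"
proof (cases "\<exists>z. cmod z < 1 \<and> S z = s")
  case True
  then obtain b where b: "cmod b < 1" "S b = s" by blast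
  have const: "S z = s" if "cmod z < 1" for z
    using schur_class_unimodular_value_const[OF S b(1) _ that] b s by simp
  have ss: "cnj s * s = 1"
    using s cmod_power2_complex[of s] by (auto simp: mult.commute)
  have "(boundary_quotient S s t \<longlongrightarrow> complex_of_real 0) (nt_at t)"
    by (rule tendsto_eventually, rule eventually_mono[OF eventually_nt_at_disk[OF t]]) (simp add: const ss)
  moreover have "(modulus_quotient S \<longlongrightarrow> 0) (nt_at t)"
    by (rule tendsto_eventually, rule eventually_mono[OF eventually_nt_at_disk[OF t]]) (simp add: const s)
  ultimately show ?thesis by (rule that)
next
  case False
  then have ne: "\<forall>z. cmod z < 1 \<longrightarrow> S z \<noteq> s" by blast
  define \<beta> where "\<beta> = max \<alpha> 1"
  note ev = eventually_stolz_region[OF t F(2)]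
  have "eventually (\<lambda>a. 1 - (cmod (S a))\<^sup>2 \<le> \<beta> * (1 - (cmod a)\<^sup>2)) F"
    using bound ev(2)
  proof eventually_elim
    case (elim a)
    then have "1 - (cmod a)\<^sup>2 \<ge> 0" by (simp add: abs_square_le_1)
    then have "\<alpha> * (1 - (cmod a)\<^sup>2) \<le> \<beta> * (1 - (cmod a)\<^sup>2)" by (intro mult_right_mono) (auto simp: \<beta>_def)
    then show ?case using elim by linarith
  qed
  note julia = julia_lemma[OF S F(1) ev(2,3) lim this]
  obtain c where c: 
    "\<forall>\<alpha>>0. (\<forall>z. cmod z < 1 \<longrightarrow> (cmod (1 - cnj s * S z))\<^sup>2 * (1 - (cmod z)\<^sup>2) \<le>
        \<alpha> * (1 - (cmod (S z))\<^sup>2) * (cmod (1 - cnj t * z))\<^sup>2) \<longrightarrow> c > 0"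
    "c > 0 \<Longrightarrow> (boundary_quotient S s t \<longlongrightarrow> complex_of_real (1 / c)) (nt_at t)"
    "c > 0 \<Longrightarrow> (modulus_quotient S \<longlongrightarrow> 1 / c) (nt_at t)"
    by (rule schur_class_boundary_derivative[OF S s t ne], rule that, assumption+)
  have "c > 0" by (rule c(1)[rule_format, of \<beta>]) (use julia in \<open>auto simp: \<beta>_def\<close>)
  then show ?thesis using c(2,3) that by blast
qed

section \<open>Finite Blaschke products and generalized Schur functions\<close>

lemma finite_blaschkeE:
  assumes "B \<in> finite_blaschke k"
  obtains c A where "cmod c = 1" "size A = k" "\<forall>a. a \<in># A \<longrightarrow> cmod a < 1"
    "\<forall>z. cmod z < 1 \<longrightarrow> B z = c * (\<Prod>a\<in>#A. blaschke_factor a z)"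
proof -
  from assms obtain c A where cA: "cmod c = 1" "size A = k" "set_mset A \<subseteq> ball 0 1"
    "\<forall>z\<in>ball 0 1. B z = c * (\<Prod>a\<in>#A. (z - a) / (1 - cnj a * z))"
    unfolding finite_blaschke_def by blast
  show ?thesis
  proof (rule that[OF cA(1,2)])
    show "\<forall>a. a \<in># A \<longrightarrow> cmod a < 1" using cA(3) by (meson mem_ball_0 subsetD)
    show "\<forall>z. cmod z < 1 \<longrightarrow> B z = c * (\<Prod>a\<in>#A. blaschke_factor a z)"
      unfolding blaschke_factor_def using cA(4) by (metis mem_ball_0)
  qed
qed

lemma blaschke_factor_at_circle:
  assumes "cmod a < 1" "cmod t = 1"
  shows "1 - cnj a * t \<noteq> 0" "cmod (blaschke_factor a t) = 1"
proof -
  have "1 - cnj t * a \<noteq> 0" using one_minus_cnj_mult_neq_0[of t a] assms by simp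
  then have "cnj (1 - cnj t * a) \<noteq> 0" by (metis complex_cnj_zero_iff)
  then show 1: "1 - cnj a * t \<noteq> 0" by (simp add: mult.commute)
  have "t * cnj t = 1" using assms cmod_power2_complex[of t] by simp
  then have "1 - cnj a * t = t * cnj (t - a)" by (simp add: algebra_simps)
  then have "cmod (1 - cnj a * t) = cmod (t - a)" using assms by (simp only: norm_mult complex_mod_cnj)
  then show "cmod (blaschke_factor a t) = 1" using 1 assms by (auto simp: blaschke_factor_def norm_divide)
qed

lemma finite_blaschke_extends_to_circle:
  assumes A: "\<And>a. a \<in># A \<Longrightarrow> cmod a < 1" and c: "cmod c = 1" and t: "cmod t = 1"
  defines "b \<equiv> \<lambda>z. c * (\<Prod>a\<in>#A. blaschke_factor a z)"
  shows "cmod (b t) = 1" "b field_differentiable at t" "b \<in> schur_class"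
proof -
  have "cmod (\<Prod>a\<in>#A. blaschke_factor a t) = 1" using A
    by (induction A) (auto simp: norm_mult blaschke_factor_at_circle t)
  then show "cmod (b t) = 1" by (simp add: b_def norm_mult c)
  have "(\<lambda>z. \<Prod>a\<in>#A. blaschke_factor a z) field_differentiable at t" using A
  proof (induction A)
    case (add a A)
    have "(\<lambda>z. (z - a) / (1 - cnj a * z)) field_differentiable at t"
      using blaschke_factor_at_circle(1)[of a t] add.prems t by (intro derivative_intros) auto
    then have "(\<lambda>z. blaschke_factor a z * (\<Prod>a\<in>#A. blaschke_factor a z)) field_differentiable at t"
      unfolding blaschke_factor_def[of a] using add by (intro field_differentiable_mult) auto
    then show ?case by simp
  qed simp
  then show "b field_differentiable at t" unfolding b_def by (intro derivative_intros)
  have "(\<lambda>z. \<Prod>a\<in>#A. blaschke_factor a z) \<in> schur_class" using A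
  proof (induction A)
    case (add a A)
    then have IH: "(\<lambda>z. \<Prod>a\<in>#A. blaschke_factor a z) \<in> schur_class" and a: "cmod a < 1" by auto
    show ?case
    proof (rule schur_classI)
      have "(\<lambda>z. blaschke_factor a z * (\<Prod>a\<in>#A. blaschke_factor a z)) holomorphic_on ball 0 1"
        by (intro holomorphic_on_mult schur_classD(1)[OF IH] blaschke_factor_holomorphic a)
      then show "(\<lambda>z. \<Prod>a\<in>#add_mset a A. blaschke_factor a z) holomorphic_on ball 0 1" by simp
      fix z assume z: "cmod z < 1"
      have "cmod (blaschke_factor a z) * cmod (\<Prod>a\<in>#A. blaschke_factor a z) \<le> 1 * 1"
        using blaschke_factor_less_1[OF a z] schur_classD(2)[OF IH z] by (intro mult_mono) auto
      then show "cmod (\<Prod>a\<in>#add_mset a A. blaschke_factor a z) \<le> 1" by (simp add: norm_mult)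
    qed
  qed (auto intro!: schur_classI)
  from schur_classD[OF this] show "b \<in> schur_class"
    unfolding b_def using c by (intro schur_classI holomorphic_intros) (auto simp: norm_mult)
qed

text \<open>A finite Blaschke product is differentiable at \<open>t\<close>, so its difference quotient converges; that the
limit is real and agrees with the limit for the moduli is again the Julia-Caratheodory theorem.\<close>

lemma finite_blaschke_boundary:
  assumes B: "B \<in> finite_blaschke k" and t: "cmod t = 1"
  obtains u \<beta> where "cmod u = 1" "(B \<longlongrightarrow> u) (nt_at t)"
    "(boundary_quotient B u t \<longlongrightarrow> complex_of_real \<beta>) (nt_at t)"
    "(modulus_quotient B \<longlongrightarrow> \<beta>) (nt_at t)"
proof -
  obtain c A where cA: "cmod c = 1" "size A = k" "\<forall>a. a \<in># A \<longrightarrow> cmod a < 1"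
    "\<forall>z. cmod z < 1 \<longrightarrow> B z = c * (\<Prod>a\<in>#A. blaschke_factor a z)"
    by (rule finite_blaschkeE[OF B], rule that, assumption+)
  define b where "b = (\<lambda>z. c * (\<Prod>a\<in>#A. blaschke_factor a z))"
  have b: "cmod (b t) = 1" "b field_differentiable at t" "b \<in> schur_class"
    unfolding b_def using finite_blaschke_extends_to_circle[OF cA(3)[rule_format] cA(1) t] by auto
  define u where "u = b t"
  have Bb: "B z = b z" if "cmod z < 1" for z using cA(4) that by (simp add: b_def)
  have uu: "cnj u * u = 1" and tt: "cnj t * t = 1" and t0: "t \<noteq> 0"
    using b(1) t cmod_power2_complex[of u] cmod_power2_complex[of t] by (auto simp: mult.commute u_def)
  obtain D where "(b has_field_derivative D) (at t)" using b(2) by (auto simp: field_differentiable_def)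
  then have D: "((\<lambda>z. (b z - b t) / (z - t)) \<longlongrightarrow> D) (at t)" by (simp add: has_field_derivative_iff)
  let ?F = "at t within stolz_region 2 t"
  have F: "?F \<noteq> bot" "?F \<le> ?F" using at_within_stolz_region_nontrivial[OF t] by auto
  have "((\<lambda>z. cnj u * t * ((b z - b t) / (z - t))) \<longlongrightarrow> cnj u * t * D) ?F"
    by (intro tendsto_intros tendsto_mono[OF _ D] at_le) auto
  moreover have "eventually (\<lambda>z. cnj u * t * ((b z - b t) / (z - t)) = (1 - cnj u * b z) / (1 - cnj t * z)) ?F"
    using eventually_stolz_region(2)[OF t F(2)]
  proof eventually_elim
    case (elim z)
    have z: "z - t \<noteq> 0" "1 - cnj t * z \<noteq> 0" using elim t one_minus_cnj_mult_neq_0[of t z] by auto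
    have "cnj u * t * (b z - b t) * (1 - cnj t * z) = (1 - cnj u * b z) * (z - t) 
        + (cnj u * b z - cnj u * u) * (t - cnj t * t * z) - (1 - cnj u * b z) * (z - t)"
      by (simp add: u_def algebra_simps)
    also have "\<dots> = (1 - cnj u * b z) * (z - t)" unfolding uu tt by (simp add: algebra_simps)
    finally show ?case using z by (simp add: divide_simps)
  qed
  ultimately have "(boundary_quotient b u t \<longlongrightarrow> cnj u * t * D) ?F"
    by (rule Lim_transform_eventually)
  note jc = julia_caratheodory_quotient[OF b(3) b(1)[folded u_def] t F(1) _ F(2) this]
  have cont: "(b \<longlongrightarrow> u) (nt_at t)"
    unfolding u_def by (rule tendsto_nt_at_if_continuous, rule field_differentiable_imp_continuous_at[OF b(2)])
  show ?thesis
  proof (rule that[of u "Re (cnj u * t * D)"])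
    show "cmod u = 1" using b(1) by (simp add: u_def)
    show "(B \<longlongrightarrow> u) (nt_at t)" using cont by (subst tendsto_nt_at_cong[OF Bb t]) auto
    have "(boundary_quotient b u t \<longlongrightarrow> complex_of_real (Re (cnj u * t * D))) (nt_at t)"
      using jc(1,2) by simp
    then show "(boundary_quotient B u t \<longlongrightarrow> complex_of_real (Re (cnj u * t * D))) (nt_at t)"
      by (subst tendsto_nt_at_cong[where g = "\<lambda>z. (1 - cnj u * b z) / (1 - cnj t * z)"]) (auto simp: Bb t)
    show "(modulus_quotient B \<longlongrightarrow> Re (cnj u * t * D)) (nt_at t)"
      using jc(3)
      by (subst tendsto_nt_at_cong[where g = "\<lambda>z. (1 - (cmod (b z))\<^sup>2) / (1 - (cmod z)\<^sup>2)"]) (auto simp: Bb t)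
  qed
qed

lemma gen_schur_classE:
  assumes "f \<in> gen_schur_class k"
  obtains S B where "S \<in> schur_class" "B \<in> finite_blaschke k" 
    "\<forall>z. cmod z < 1 \<longrightarrow> B z \<noteq> 0 \<longrightarrow> f z = S z / B z"
proof -
  from assms obtain S B where SB: "S \<in> schur_class" "B \<in> finite_blaschke k" 
    "\<forall>z\<in>ball 0 1. B z \<noteq> 0 \<longrightarrow> f z = S z / B z"
    unfolding gen_schur_class_def by blast
  have "\<forall>z. cmod z < 1 \<longrightarrow> B z \<noteq> 0 \<longrightarrow> f z = S z / B z"
    using SB(3) by (metis mem_ball_0)
  then show ?thesis by (rule that[OF SB(1,2)])
qed

lemma boundary_value_of_quotient:
  assumes w: "cmod w = 1" and t: "cmod t = 1" and F: "((\<lambda>z. z) \<longlongrightarrow> t) F" "eventually (\<lambda>z. cmod z < 1) F"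
    and lim: "(boundary_quotient f w t \<longlongrightarrow> \<gamma>) F"
  shows "((\<lambda>z. cnj w * f z) \<longlongrightarrow> 1) F" "(f \<longlongrightarrow> w) F"
proof -
  have ww: "w * cnj w = 1" and tt: "cnj t * t = 1"
    using w t cmod_power2_complex[of w] cmod_power2_complex[of t] by (auto simp: mult.commute)
  have "((\<lambda>z. 1 - (1 - cnj w * f z) / (1 - cnj t * z) * (1 - cnj t * z)) \<longlongrightarrow> 1 - \<gamma> * (1 - cnj t * t)) F"
    by (intro tendsto_intros lim F)
  moreover have "eventually (\<lambda>z. 1 - (1 - cnj w * f z) / (1 - cnj t * z) * (1 - cnj t * z) = cnj w * f z) F"
    using F(2) by eventually_elim (use one_minus_cnj_mult_neq_0[of t] t in auto)
  ultimately have "((\<lambda>z. cnj w * f z) \<longlongrightarrow> 1 - \<gamma> * (1 - cnj t * t)) F"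
    by (rule Lim_transform_eventually)
  then show 1: "((\<lambda>z. cnj w * f z) \<longlongrightarrow> 1) F" using tt by simp
  have "((\<lambda>z. w * (cnj w * f z)) \<longlongrightarrow> w * 1) F" by (intro tendsto_intros 1)
  then show "(f \<longlongrightarrow> w) F" by (simp add: mult.assoc[symmetric] ww)
qed

text \<open>For \<open>f = S / B\<close> the quotient of \<open>S = f B\<close> is, up to a factor that tends to 1 in the second term, the
sum of the quotients of \<open>f\<close> and of \<open>B\<close>. Thus the Julia-Caratheodory theorem for \<open>S\<close> and for \<open>B\<close>
gives the theorem for \<open>f\<close>, with a limit \<open>\<gamma>\<close> of either sign.\<close>

theorem gen_schur_boundary_data_of_quotient:
  assumes f: "f \<in> gen_schur_class k" and w: "cmod w = 1" and t: "cmod t = 1"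
    and F: "F \<noteq> bot" "a > 1" "F \<le> at t within stolz_region a t"
    and lim: "(boundary_quotient f w t \<longlongrightarrow> complex_of_real \<gamma>) F"
  shows "has_boundary_value f t w" "has_boundary_d f t (ereal \<gamma>)"
proof -
  obtain S B where S: "S \<in> schur_class" and B: "B \<in> finite_blaschke k" 
    and fSB: "\<forall>z. cmod z < 1 \<longrightarrow> B z \<noteq> 0 \<longrightarrow> f z = S z / B z"
    by (rule gen_schur_classE[OF f], rule that, assumption+)
  obtain u \<beta> where u: "cmod u = 1" and Bu: "(B \<longlongrightarrow> u) (nt_at t)" and
    qB: "(boundary_quotient B u t \<longlongrightarrow> complex_of_real \<beta>) (nt_at t)" and
    dB: "(modulus_quotient B \<longlongrightarrow> \<beta>) (nt_at t)"
    by (rule finite_blaschke_boundary[OF B t], rule that, assumption+)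
  have u0: "u \<noteq> 0" using u by auto
  have ev: "eventually (\<lambda>z. cmod z < 1 \<and> B z \<noteq> 0) (nt_at t)"
    using eventually_nt_at_disk[OF t] tendsto_imp_eventually_ne[OF Bu u0] by eventually_elim auto
  have Fnt: "F \<le> nt_at t" using F(3) at_within_stolz_region_le_nt_at[OF F(2)] by (rule order_trans)
  note evF = eventually_stolz_region[OF t F(3)]
  define s where "s = w * u"
  have s: "cmod s = 1" using w u by (simp add: s_def norm_mult)
  note wf = boundary_value_of_quotient(1)[OF w t evF(3,2) lim]
  have "((\<lambda>z. (1 - cnj w * f z) / (1 - cnj t * z) + cnj w * f z * ((1 - cnj u * B z) / (1 - cnj t * z)))
    \<longlongrightarrow> complex_of_real \<gamma> + 1 * complex_of_real \<beta>) F"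
    by (intro tendsto_intros lim wf tendsto_mono[OF Fnt qB])
  moreover have "eventually (\<lambda>z. (1 - cnj w * f z) / (1 - cnj t * z) + cnj w * f z * ((1 - cnj u * B z) / (1 - cnj t * z)) =
     (1 - cnj s * S z) / (1 - cnj t * z)) F"
    using filter_leD[OF Fnt ev]
  proof eventually_elim
    case (elim z)
    then have "S z = f z * B z" using fSB by simp
    then show ?case by (simp add: s_def add_divide_distrib[symmetric]) (simp add: algebra_simps)
  qed
  ultimately have "(boundary_quotient S s t \<longlongrightarrow> complex_of_real \<gamma> + 1 * complex_of_real \<beta>) F"
    by (rule Lim_transform_eventually)
  then have "(boundary_quotient S s t \<longlongrightarrow> complex_of_real (\<gamma> + \<beta>)) F" by simp
  note jc = julia_caratheodory_quotient[OF S s t F this]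
  have "(S \<longlongrightarrow> s) (nt_at t)"
    by (rule boundary_value_of_quotient(2)[OF s t tendsto_nt_at_ident eventually_nt_at_disk[OF t] jc(2)])
  then have "((\<lambda>z. S z / B z) \<longlongrightarrow> s / u) (nt_at t)" by (intro tendsto_divide Bu u0)
  moreover have "eventually (\<lambda>z. S z / B z = f z) (nt_at t)" using ev by eventually_elim (simp add: fSB)
  ultimately have "(f \<longlongrightarrow> s / u) (nt_at t)" by (rule Lim_transform_eventually)
  then show "has_boundary_value f t w" using u0 by (simp add: has_boundary_value_def s_def)
  have "((\<lambda>z. ((1 - (cmod (S z))\<^sup>2) / (1 - (cmod z)\<^sup>2) - (1 - (cmod (B z))\<^sup>2) / (1 - (cmod z)\<^sup>2)) / (cmod (B z))\<^sup>2)
     \<longlongrightarrow> (Re (complex_of_real (\<gamma> + \<beta>)) - \<beta>) / (cmod u)\<^sup>2) (nt_at t)"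
    by (intro tendsto_intros jc(3) dB Bu) (use u0 in auto)
  moreover have "eventually (\<lambda>z. ((1 - (cmod (S z))\<^sup>2) / (1 - (cmod z)\<^sup>2) - (1 - (cmod (B z))\<^sup>2) / (1 - (cmod z)\<^sup>2)) / (cmod (B z))\<^sup>2
     = (1 - (cmod (f z))\<^sup>2) / (1 - (cmod z)\<^sup>2)) (nt_at t)"
    using ev
  proof eventually_elim
    case (elim z)
    have SBf: "S z = B z * f z" using fSB[rule_format, of z] elim by simp
    have eq: "((1 - (cmod (S z))\<^sup>2) - (1 - (cmod (B z))\<^sup>2)) / (cmod (B z))\<^sup>2 = 1 - (cmod (f z))\<^sup>2"
      using elim by (simp add: SBf norm_mult power_mult_distrib field_simps)
    show ?case unfolding eq[symmetric] by (simp add: diff_divide_distrib[symmetric] mult.commute)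
  qed
  ultimately have "(modulus_quotient f \<longlongrightarrow> (Re (complex_of_real (\<gamma> + \<beta>)) - \<beta>) / (cmod u)\<^sup>2) (nt_at t)"
    by (rule Lim_transform_eventually)
  then show "has_boundary_d f t (ereal \<gamma>)" using u by (simp add: has_boundary_d_def)
qed

text \<open>The converse passes through the moduli: \<open>d\<^sub>f\<close> and \<open>d\<^sub>B\<close> determine \<open>d\<^sub>S\<close>, whose finiteness makes the
difference quotient of \<open>S\<close> converge, and subtracting the quotient of \<open>B\<close> leaves that of \<open>f\<close>.\<close>

theorem gen_schur_quotient_of_boundary_data:
  assumes f: "f \<in> gen_schur_class k" and w: "cmod w = 1" and t: "cmod t = 1"
    and bv: "has_boundary_value f t w" and bd: "has_boundary_d f t (ereal \<gamma>)"
  shows "(boundary_quotient f w t \<longlongrightarrow> complex_of_real \<gamma>) (nt_at t)"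
proof -
  obtain S B where S: "S \<in> schur_class" and B: "B \<in> finite_blaschke k" 
    and fSB: "\<forall>z. cmod z < 1 \<longrightarrow> B z \<noteq> 0 \<longrightarrow> f z = S z / B z"
    by (rule gen_schur_classE[OF f], rule that, assumption+)
  obtain u \<beta> where u: "cmod u = 1" and Bu: "(B \<longlongrightarrow> u) (nt_at t)" and
    qB: "(boundary_quotient B u t \<longlongrightarrow> complex_of_real \<beta>) (nt_at t)" and
    dB: "(modulus_quotient B \<longlongrightarrow> \<beta>) (nt_at t)"
    by (rule finite_blaschke_boundary[OF B t], rule that, assumption+)
  have u0: "u \<noteq> 0" using u by auto
  have ww: "cnj w * w = 1" using w cmod_power2_complex[of w] by (auto simp: mult.commute)
  have ev: "eventually (\<lambda>z. cmod z < 1 \<and> B z \<noteq> 0) (nt_at t)"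
    using eventually_nt_at_disk[OF t] tendsto_imp_eventually_ne[OF Bu u0] by eventually_elim auto
  define s where "s = w * u"
  have s: "cmod s = 1" using w u by (simp add: s_def norm_mult)
  have fw: "(f \<longlongrightarrow> w) (nt_at t)" using bv by (simp add: has_boundary_value_def)
  have fd: "(modulus_quotient f \<longlongrightarrow> \<gamma>) (nt_at t)"
    using bd by (simp add: has_boundary_d_def)
  have "((\<lambda>z. f z * B z) \<longlongrightarrow> s) (nt_at t)" unfolding s_def by (intro tendsto_intros fw Bu)
  moreover have evS: "eventually (\<lambda>z. f z * B z = S z) (nt_at t)" using ev by eventually_elim (simp add: fSB)
  ultimately have Ss: "(S \<longlongrightarrow> s) (nt_at t)" by (rule Lim_transform_eventually)
  have "((\<lambda>z. (cmod (B z))\<^sup>2 * ((1 - (cmod (f z))\<^sup>2) / (1 - (cmod z)\<^sup>2)) + (1 - (cmod (B z))\<^sup>2) / (1 - (cmod z)\<^sup>2))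
     \<longlongrightarrow> (cmod u)\<^sup>2 * \<gamma> + \<beta>) (nt_at t)"
    by (intro tendsto_intros Bu fd dB)
  moreover have "eventually (\<lambda>z. (cmod (B z))\<^sup>2 * ((1 - (cmod (f z))\<^sup>2) / (1 - (cmod z)\<^sup>2)) + (1 - (cmod (B z))\<^sup>2) / (1 - (cmod z)\<^sup>2)
     = (1 - (cmod (S z))\<^sup>2) / (1 - (cmod z)\<^sup>2)) (nt_at t)"
    using evS
  proof eventually_elim
    case (elim z)
    have "(cmod (B z))\<^sup>2 * (1 - (cmod (f z))\<^sup>2) + (1 - (cmod (B z))\<^sup>2) = 1 - (cmod (S z))\<^sup>2"
      by (simp add: elim[symmetric] norm_mult power_mult_distrib algebra_simps)
    then show ?case by (simp add: add_divide_distrib[symmetric])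
  qed
  ultimately have "(modulus_quotient S \<longlongrightarrow> (cmod u)\<^sup>2 * \<gamma> + \<beta>) (nt_at t)"
    by (rule Lim_transform_eventually)
  then have dS: "(modulus_quotient S \<longlongrightarrow> \<gamma> + \<beta>) (nt_at t)" using u by simp
  let ?F = "at t within stolz_region 2 t"
  have F: "?F \<noteq> bot" "?F \<le> ?F" using at_within_stolz_region_nontrivial[OF t] by auto
  have Fnt: "?F \<le> nt_at t" by (rule at_within_stolz_region_le_nt_at) simp
  have d1: "eventually (\<lambda>z. (1 - (cmod (S z))\<^sup>2) / (1 - (cmod z)\<^sup>2) < \<gamma> + \<beta> + 1) (nt_at t)"
    by (rule order_tendstoD(2)[OF dS]) simp
  have "eventually (\<lambda>z. 1 - (cmod (S z))\<^sup>2 \<le> (\<gamma> + \<beta> + 1) * (1 - (cmod z)\<^sup>2)) (nt_at t)"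
    using d1 eventually_nt_at_disk[OF t]
  proof eventually_elim
    case (elim z)
    moreover from this have "1 - (cmod z)\<^sup>2 > 0" by (simp add: abs_square_less_1)
    ultimately show ?case by (simp add: pos_divide_less_eq)
  qed
  note bound = this
  obtain g where 
    qS: "(boundary_quotient S s t \<longlongrightarrow> complex_of_real g) (nt_at t)" and
    dS': "(modulus_quotient S \<longlongrightarrow> g) (nt_at t)"
    by (rule julia_caratheodory_bounded[OF S s t F tendsto_mono[OF Fnt Ss] filter_leD[OF Fnt bound]], rule that, assumption+)
  have g: "g = \<gamma> + \<beta>" using tendsto_unique[OF nt_at_nontrivial[OF t] dS' dS] .
  have "((\<lambda>z. (1 - cnj s * S z) / (1 - cnj t * z) - cnj w * f z * ((1 - cnj u * B z) / (1 - cnj t * z)))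
    \<longlongrightarrow> complex_of_real g - cnj w * w * complex_of_real \<beta>) (nt_at t)"
    by (intro tendsto_intros qS qB fw)
  moreover have "eventually (\<lambda>z. (1 - cnj s * S z) / (1 - cnj t * z) - cnj w * f z * ((1 - cnj u * B z) / (1 - cnj t * z)) =
     (1 - cnj w * f z) / (1 - cnj t * z)) (nt_at t)"
    using evS
  proof eventually_elim
    case (elim z)
    show ?case by (simp add: elim[symmetric] s_def diff_divide_distrib[symmetric]) (simp add: algebra_simps)
  qed
  ultimately have "(boundary_quotient f w t \<longlongrightarrow> complex_of_real g - cnj w * w * complex_of_real \<beta>) (nt_at t)"
    by (rule Lim_transform_eventually)
  then show ?thesis by (simp add: g ww)
qed

text \<open>The kernel of a Blaschke product has rank at most its degree: splitting off one factor adds a rank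
one kernel and multiplies the rest by \<open>b z * cnj (b x)\<close>.\<close>

lemma blaschke_kernel_features:
  assumes A: "\<And>a. a \<in># A \<Longrightarrow> cmod a < 1" and c: "cmod c = 1"
  shows "\<exists>e :: nat \<Rightarrow> complex \<Rightarrow> complex. \<forall>z x. cmod z < 1 \<longrightarrow> cmod x < 1 \<longrightarrow>
    schur_kernel (\<lambda>z. c * (\<Prod>a\<in>#A. blaschke_factor a z)) z x = (\<Sum>l<size A. e l z * cnj (e l x))"
  using A
proof (induction A)
  case empty
  have "c * cnj c = 1" using c cmod_power2_complex[of c] by simp
  then show ?case by (simp add: schur_kernel_def)
next
  case (add a A)
  define B where "B = (\<lambda>z. c * (\<Prod>a\<in>#A. blaschke_factor a z))"
  from add obtain e :: "nat \<Rightarrow> complex \<Rightarrow> complex" where e: "\<And>z x. cmod z < 1 \<Longrightarrow> cmod x < 1 \<Longrightarrow>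
    schur_kernel B z x = (\<Sum>l<size A. e l z * cnj (e l x))" unfolding B_def by fastforce
  have a: "cmod a < 1" using add.prems by simp
  define b where "b = blaschke_factor a"
  define g where "g = (\<lambda>x. complex_of_real (sqrt (1 - (cmod a)\<^sup>2)) / (1 - cnj a * x))"
  define e' where "e' = (\<lambda>l z. if l < size A then b z * e l z else g z)"
  have "schur_kernel (\<lambda>z. c * (\<Prod>a\<in>#add_mset a A. blaschke_factor a z)) z x =
      (\<Sum>l<size (add_mset a A). e' l z * cnj (e' l x))" if "cmod z < 1" "cmod x < 1" for z x
  proof -
    have "schur_kernel (\<lambda>z. c * (\<Prod>a\<in>#add_mset a A. blaschke_factor a z)) z x =
      (1 - (b z * B z) * cnj (b x * B x)) / (1 - z * cnj x)"
      by (simp add: schur_kernel_def B_def b_def mult_ac)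
    also have "1 - (b z * B z) * cnj (b x * B x) = (1 - b z * cnj (b x)) + b z * cnj (b x) * (1 - B z * cnj (B x))"
      by (simp add: algebra_simps)
    also have "(\<dots>) / (1 - z * cnj x) = (1 - b z * cnj (b x)) / (1 - z * cnj x) + b z * cnj (b x) * schur_kernel B z x"
      by (simp add: add_divide_distrib schur_kernel_def)
    also have "(1 - b z * cnj (b x)) / (1 - z * cnj x) = g z * cnj (g x)"
      unfolding b_def g_def by (rule blaschke_factor_kernel_rank_one[OF a that])
    also have "b z * cnj (b x) * schur_kernel B z x = (\<Sum>l<size A. e' l z * cnj (e' l x))"
      unfolding e[OF that] by (simp add: e'_def sum_distrib_left mult_ac)
    finally show ?thesis by (simp add: e'_def)
  qed
  then show ?case by blast
qed

lemma sum_rotate: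
  "(\<Sum>i\<in>I. \<Sum>j\<in>J. \<Sum>l\<in>L. F i j l) = (\<Sum>l\<in>L. \<Sum>i\<in>I. \<Sum>j\<in>J. F i j l)"
proof -
  have "(\<Sum>i\<in>I. \<Sum>j\<in>J. \<Sum>l\<in>L. F i j l) = (\<Sum>i\<in>I. \<Sum>l\<in>L. \<Sum>j\<in>J. F i j l)"
    by (intro sum.cong refl sum.swap)
  also have "\<dots> = (\<Sum>l\<in>L. \<Sum>i\<in>I. \<Sum>j\<in>J. F i j l)" by (rule sum.swap)
  finally show ?thesis .
qed

text \<open>The kernel of \<open>f = S / B\<close> at the radial points \<open>r t\<^sub>i\<close> tends to the transpose of \<open>P\<close> as \<open>r\<close> tends to 1.
If \<open>P\<close> had more than \<open>k\<close> negative eigenvalues, then some unit combination of the corresponding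
eigenvectors would be annihilated by the \<open>k\<close> features of the kernel of \<open>B\<close>. On it the form of the
kernel of \<open>f\<close> is nonnegative, since only the contribution of \<open>S\<close> is left; but in the limit it is at
most \<open>- \<delta>\<close>, uniformly over all such combinations.\<close>

theorem negative_index_le_pole_count:
  fixes P U :: "nat \<Rightarrow> nat \<Rightarrow> complex" and d :: "nat \<Rightarrow> real"
  assumes f: "f \<in> gen_schur_class k"
    and t: "\<And>i. i < n \<Longrightarrow> cmod (t i) = 1" and inj: "inj_on t {..<n}"
    and bv: "\<And>i. i < n \<Longrightarrow> has_boundary_value f (t i) (w i)"
    and bd: "\<And>i. i < n \<Longrightarrow> has_boundary_d f (t i) (ereal (\<gamma> i))"
    and Pd: "\<And>i. i < n \<Longrightarrow> P i i = complex_of_real (\<gamma> i)"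
    and Po: "\<And>i j. i < n \<Longrightarrow> j < n \<Longrightarrow> i \<noteq> j \<Longrightarrow> P i j = (1 - cnj (w i) * w j) / (1 - cnj (t i) * t j)"
    and PU: "\<And>i j. i < n \<Longrightarrow> j < n \<Longrightarrow> P i j = (\<Sum>l<n. complex_of_real (d l) * (U i l * cnj (U j l)))"
    and U: "\<And>l m. l < n \<Longrightarrow> m < n \<Longrightarrow> (\<Sum>i<n. cnj (U i l) * U i m) = (if l = m then 1 else 0)"
  shows "card {l. l < n \<and> d l < 0} \<le> k"
proof (rule ccontr)
  define Neg where "Neg = {l. l < n \<and> d l < 0}"
  assume "\<not> card {l. l < n \<and> d l < 0} \<le> k"
  then have kNeg: "k < card Neg" by (simp add: Neg_def)
  have fin: "finite Neg" and Nn: "\<And>l. l \<in> Neg \<Longrightarrow> l < n" by (auto simp: Neg_def)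
  have ne: "Neg \<noteq> {}" using kNeg by auto
  (* normalizing the coefficients to norm 1 turns the gap delta into a uniform bound for the form of P *)
  define \<delta> where "\<delta> = Min ((\<lambda>l. - d l) ` Neg)"
  have \<delta>: "\<delta> > 0" unfolding \<delta>_def using fin ne by (subst Min_gr_iff) (auto simp: Neg_def)
  have \<delta>d: "d l \<le> - \<delta>" if "l \<in> Neg" for l
  proof -
    have "\<delta> \<le> - d l" unfolding \<delta>_def using fin that by (intro Min_le) auto
    then show ?thesis by simp
  qed
  obtain S B where S: "S \<in> schur_class" and B: "B \<in> finite_blaschke k" 
    and fSB: "\<forall>z. cmod z < 1 \<longrightarrow> B z \<noteq> 0 \<longrightarrow> f z = S z / B z"
    by (rule gen_schur_classE[OF f], rule that, assumption+)
  obtain c A where cA: "cmod c = 1" "size A = k" "\<forall>a. a \<in># A \<longrightarrow> cmod a < 1"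
    "\<forall>z. cmod z < 1 \<longrightarrow> B z = c * (\<Prod>a\<in>#A. blaschke_factor a z)"
    by (rule finite_blaschkeE[OF B], rule that, assumption+)
  obtain e :: "nat \<Rightarrow> complex \<Rightarrow> complex" where e: "\<And>z x. cmod z < 1 \<Longrightarrow> cmod x < 1 \<Longrightarrow>
     schur_kernel B z x = (\<Sum>l<k. e l z * cnj (e l x))"
  proof -
    obtain e :: "nat \<Rightarrow> complex \<Rightarrow> complex" where "\<forall>z x. cmod z < 1 \<longrightarrow> cmod x < 1 \<longrightarrow>
      schur_kernel (\<lambda>z. c * (\<Prod>a\<in>#A. blaschke_factor a z)) z x = (\<Sum>l<size A. e l z * cnj (e l x))"
      using blaschke_kernel_features[OF cA(3)[rule_format] cA(1)] by blast
    then show ?thesis using that[of e] cA(2,4) by (simp add: schur_kernel_def)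
  qed
  define K where "K = (\<lambda>r i j. schur_kernel f (complex_of_real r * t i) (complex_of_real r * t j))"
  (* a bound for the weights c i below that does not depend on r *)
  define M where "M = (\<Sum>i<n. \<Sum>l\<in>Neg. cmod (U i l))"
  have rad: "filterlim (\<lambda>r. complex_of_real r * t i) (at (t i) within stolz_region 2 (t i)) (at_left 1)" if "i < n" for i
    using filterlim_radial_stolz_region[OF t[OF that], of 2] by simp
  have limf: "((\<lambda>r. f (complex_of_real r * t i)) \<longlongrightarrow> w i) (at_left 1)" if i: "i < n" for i
  proof (rule filterlim_compose[OF _ rad[OF i]])
    show "(f \<longlongrightarrow> w i) (at (t i) within stolz_region 2 (t i))"
      using bv[OF i] unfolding has_boundary_value_def by (rule tendsto_nt_at_stolz) auto
  qed
  have K: "((\<lambda>r. K r i j) \<longlongrightarrow> P j i) (at_left 1)" if i: "i < n" and j: "j < n" for i j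
  proof (cases "i = j")
    case True
    have "(modulus_quotient f \<longlongrightarrow> \<gamma> i) (nt_at (t i))"
      using bd[OF i] by (simp add: has_boundary_d_def)
    then have "(modulus_quotient f \<longlongrightarrow> \<gamma> i) (at (t i) within stolz_region 2 (t i))"
      by (rule tendsto_nt_at_stolz) auto
    from filterlim_compose[OF this rad[OF i]]
    have "((\<lambda>r. complex_of_real ((1 - (cmod (f (complex_of_real r * t i)))\<^sup>2) / (1 - (cmod (complex_of_real r * t i))\<^sup>2))) \<longlongrightarrow> complex_of_real (\<gamma> i)) (at_left 1)"
      by (rule tendsto_of_real)
    moreover have "complex_of_real ((1 - (cmod (f (complex_of_real r * t i)))\<^sup>2) / (1 - (cmod (complex_of_real r * t i))\<^sup>2)) = K r i j" for r
      unfolding of_real_divide of_real_diff cmod_power2_complex of_real_1 K_def schur_kernel_def True ..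
    ultimately show ?thesis using Pd[OF i] True by simp
  next
    case False
    have ttj: "cnj (t j) * t j = 1" using t[OF j] cmod_power2_complex[of "t j"] by (simp add: mult.commute)
    have "t i \<noteq> t j" using inj i j False by (auto simp: inj_on_def)
    then have nz: "1 - t i * cnj (t j) \<noteq> 0" using ttj by (metis eq_iff_diff_eq_0 mult.commute mult.left_commute mult.right_neutral)
    have "((\<lambda>r. (1 - f (complex_of_real r * t i) * cnj (f (complex_of_real r * t j))) / 
       (1 - (complex_of_real r * t i) * cnj (complex_of_real r * t j))) \<longlongrightarrow>
       (1 - w i * cnj (w j)) / (1 - (complex_of_real 1 * t i) * cnj (complex_of_real 1 * t j))) (at_left 1)"
      by (intro tendsto_intros limf i j) (use nz in simp)
    then show ?thesis using Po[OF j i] False by (simp add: K_def schur_kernel_def mult.commute)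
  qed
  have "((\<lambda>r. M\<^sup>2 * (\<Sum>i<n. \<Sum>j<n. cmod (K r i j - P j i))) \<longlongrightarrow> M\<^sup>2 * (\<Sum>i<n. \<Sum>j<n. cmod (P j i - P j i))) (at_left 1)"
    by (intro tendsto_intros K) auto
  then have "((\<lambda>r. M\<^sup>2 * (\<Sum>i<n. \<Sum>j<n. cmod (K r i j - P j i))) \<longlongrightarrow> 0) (at_left 1)" by simp
  then have "eventually (\<lambda>r. M\<^sup>2 * (\<Sum>i<n. \<Sum>j<n. cmod (K r i j - P j i)) < \<delta>) (at_left 1)"
    using \<delta> by (rule order_tendstoD(2))
  moreover have "eventually (\<lambda>r. r \<in> {0<..<1}) (at_left (1::real))"
    by (rule eventually_at_leftI[of 0]) auto
  moreover have "eventually (\<lambda>r. \<forall>i\<in>{..<n}. B (complex_of_real r * t i) \<noteq> 0) (at_left 1)"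
  proof (rule eventually_ball_finite)
    show "\<forall>i\<in>{..<n}. \<forall>\<^sub>F r in at_left 1. B (complex_of_real r * t i) \<noteq> 0"
    proof
      fix i assume "i \<in> {..<n}"
      then have i: "i < n" by simp
      obtain u where u: "cmod u = 1" "(B \<longlongrightarrow> u) (nt_at (t i))"
        by (rule finite_blaschke_boundary[OF B t[OF i]], rule that, assumption+)
      have "(B \<longlongrightarrow> u) (at (t i) within stolz_region 2 (t i))"
        using u(2) by (rule tendsto_nt_at_stolz) auto
      from filterlim_compose[OF this rad[OF i]] show "\<forall>\<^sub>F r in at_left 1. B (complex_of_real r * t i) \<noteq> 0"
        by (rule tendsto_imp_eventually_ne) (use u in auto)
    qed
  qed auto
  ultimately have "eventually (\<lambda>r. M\<^sup>2 * (\<Sum>i<n. \<Sum>j<n. cmod (K r i j - P j i)) < \<delta> \<and> r \<in> {0<..<1} \<and>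
    (\<forall>i\<in>{..<n}. B (complex_of_real r * t i) \<noteq> 0)) (at_left (1::real))"
    by eventually_elim auto
  then obtain r where r: "M\<^sup>2 * (\<Sum>i<n. \<Sum>j<n. cmod (K r i j - P j i)) < \<delta>" "0 < r" "r < 1"
    "\<And>i. i < n \<Longrightarrow> B (complex_of_real r * t i) \<noteq> 0"
    using eventually_happens'[OF trivial_limit_at_left_real] by force
  define z where "z = (\<lambda>i. complex_of_real r * t i)"
  have z1: "cmod (z i) < 1" if "i < n" for i using r t[OF that] by (simp add: z_def norm_mult)
  have Bz: "B (z i) \<noteq> 0" if "i < n" for i using r(4)[OF that] by (simp add: z_def)
  (* dividing the weights by B (z i) turns the kernel of f into the difference of the
     kernels of S and B; alpha is chosen so that the features e m of B do not contribute *)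
  obtain \<alpha> where \<alpha>: "(\<Sum>l\<in>Neg. (cmod (\<alpha> l))\<^sup>2) = 1"
    "\<And>m. m < k \<Longrightarrow> (\<Sum>l\<in>Neg. (\<Sum>i<n. U i l / B (z i) * e m (z i)) * \<alpha> l) = 0"
    by (rule underdetermined_system[OF fin kNeg, of "\<lambda>m l. \<Sum>i<n. U i l / B (z i) * e m (z i)"]) blast
  define c where "c = (\<lambda>i. \<Sum>l\<in>Neg. \<alpha> l * U i l)"
  define c' where "c' = (\<lambda>i. c i / B (z i))"
  have ce: "(\<Sum>i<n. c' i * e m (z i)) = 0" if "m < k" for m
  proof -
    have "(\<Sum>i<n. c' i * e m (z i)) = (\<Sum>i<n. \<Sum>l\<in>Neg. U i l / B (z i) * e m (z i) * \<alpha> l)"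
      by (simp add: c'_def c_def sum_distrib_left sum_distrib_right sum_divide_distrib mult_ac)
    also have "\<dots> = (\<Sum>l\<in>Neg. \<Sum>i<n. U i l / B (z i) * e m (z i) * \<alpha> l)" by (rule sum.swap)
    also have "\<dots> = 0" using \<alpha>(2)[OF that] by (simp add: sum_distrib_right)
    finally show ?thesis .
  qed
  define Q where "Q = (\<Sum>i<n. \<Sum>j<n. c i * cnj (c j) * K r i j)"
  have "Q = (\<Sum>i<n. \<Sum>j<n. c' i * cnj (c' j) * schur_kernel S (z i) (z j) - 
      (\<Sum>l<k. (c' i * e l (z i)) * cnj (c' j * e l (z j))))"
    unfolding Q_def
  proof (intro sum.cong refl)
    fix i j assume "i \<in> {..<n}" "j \<in> {..<n}"
    then have i: "i < n" and j: "j < n" by auto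
    have f: "f (z i) = S (z i) / B (z i)" "f (z j) = S (z j) / B (z j)" using fSB z1 Bz i j by auto
    have "K r i j = (1 - f (z i) * cnj (f (z j))) / (1 - z i * cnj (z j))"
      by (simp add: K_def schur_kernel_def z_def)
    also have "1 - f (z i) * cnj (f (z j)) = ((1 - S (z i) * cnj (S (z j))) - (1 - B (z i) * cnj (B (z j)))) / (B (z i) * cnj (B (z j)))"
      unfolding f using Bz[OF i] Bz[OF j] by (simp add: field_simps)
    also have "\<dots> / (1 - z i * cnj (z j)) = (schur_kernel S (z i) (z j) - schur_kernel B (z i) (z j)) / (B (z i) * cnj (B (z j)))"
      by (simp add: schur_kernel_def diff_divide_distrib mult.commute)
    finally have "c i * cnj (c j) * K r i j = c' i * cnj (c' j) * (schur_kernel S (z i) (z j) - schur_kernel B (z i) (z j))"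
      by (simp add: c'_def)
    also have "\<dots> = c' i * cnj (c' j) * schur_kernel S (z i) (z j) - c' i * cnj (c' j) * schur_kernel B (z i) (z j)"
      by (simp add: algebra_simps)
    also have "c' i * cnj (c' j) * schur_kernel B (z i) (z j) = (\<Sum>l<k. (c' i * e l (z i)) * cnj (c' j * e l (z j)))"
      unfolding e[OF z1[OF i] z1[OF j]] by (simp add: sum_distrib_left mult_ac)
    finally show "c i * cnj (c j) * K r i j = c' i * cnj (c' j) * schur_kernel S (z i) (z j) - 
      (\<Sum>l<k. (c' i * e l (z i)) * cnj (c' j * e l (z j)))" .
  qed
  also have "\<dots> = (\<Sum>i<n. \<Sum>j<n. c' i * cnj (c' j) * schur_kernel S (z i) (z j)) - 
      (\<Sum>i<n. \<Sum>j<n. \<Sum>l<k. (c' i * e l (z i)) * cnj (c' j * e l (z j)))"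
    by (simp add: sum_subtractf)
  also have "(\<Sum>i<n. \<Sum>j<n. \<Sum>l<k. (c' i * e l (z i)) * cnj (c' j * e l (z j))) =
     (\<Sum>l<k. \<Sum>i<n. \<Sum>j<n. (c' i * e l (z i)) * cnj (c' j * e l (z j)))"
    by (rule sum_rotate)
  also have "\<dots> = (\<Sum>l<k. complex_of_real ((cmod (\<Sum>i<n. c' i * e l (z i)))\<^sup>2))"
    unfolding sum_sum_mult_cnj ..
  also have "\<dots> = 0" using ce by simp
  finally have Q1: "Re Q \<ge> 0"
    using schur_kernel_psd[of "{..<n}" z S c'] z1 S by simp
  define Q0 where "Q0 = (\<Sum>i<n. \<Sum>j<n. c i * cnj (c j) * P j i)"
  have cU: "(\<Sum>i<n. c i * cnj (U i l)) = (if l \<in> Neg then \<alpha> l else 0)" if l: "l < n" for l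
  proof -
    have "(\<Sum>i<n. c i * cnj (U i l)) = (\<Sum>i<n. \<Sum>m\<in>Neg. \<alpha> m * (cnj (U i l) * U i m))"
      by (simp add: c_def sum_distrib_left sum_distrib_right mult_ac)
    also have "\<dots> = (\<Sum>m\<in>Neg. \<alpha> m * (\<Sum>i<n. cnj (U i l) * U i m))"
      by (subst sum.swap) (simp add: sum_distrib_left)
    also have "\<dots> = (\<Sum>m\<in>Neg. if l = m then \<alpha> m else 0)"
      by (intro sum.cong refl) (simp add: U[OF l Nn])
    finally show ?thesis using fin by simp
  qed
  have "Q0 = (\<Sum>i<n. \<Sum>j<n. \<Sum>l<n. complex_of_real (d l) * ((c i * cnj (U i l)) * cnj (c j * cnj (U j l))))"
    unfolding Q0_def by (intro sum.cong refl) (simp add: PU sum_distrib_left mult_ac)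
  also have "\<dots> = (\<Sum>l<n. complex_of_real (d l) * (\<Sum>i<n. \<Sum>j<n. (c i * cnj (U i l)) * cnj (c j * cnj (U j l))))"
    unfolding sum_distrib_left by (rule sum_rotate)
  also have "\<dots> = (\<Sum>l<n. complex_of_real (d l * (cmod (if l \<in> Neg then \<alpha> l else 0))\<^sup>2))"
    unfolding sum_sum_mult_cnj by (intro sum.cong refl) (simp add: cU)
  also have "\<dots> = (\<Sum>l\<in>Neg. complex_of_real (d l * (cmod (\<alpha> l))\<^sup>2))"
    by (rule sum.mono_neutral_cong_right) (auto simp: Nn)
  finally have "Re Q0 = (\<Sum>l\<in>Neg. d l * (cmod (\<alpha> l))\<^sup>2)" by simp
  also have "\<dots> \<le> (\<Sum>l\<in>Neg. (- \<delta>) * (cmod (\<alpha> l))\<^sup>2)"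
    by (intro sum_mono mult_right_mono \<delta>d) auto
  also have "\<dots> = - \<delta>" unfolding sum_distrib_left[symmetric] \<alpha>(1) by simp
  finally have Q2: "Re Q0 \<le> - \<delta>" .
  have cM: "cmod (c i) \<le> M" if i: "i < n" for i
  proof -
    have al: "cmod (\<alpha> l) \<le> 1" if "l \<in> Neg" for l
    proof -
      have "(cmod (\<alpha> l))\<^sup>2 \<le> 1" using member_le_sum[of l Neg "\<lambda>l. (cmod (\<alpha> l))\<^sup>2"] that fin \<alpha>(1) by simp
      then show ?thesis by (simp add: abs_square_le_1)
    qed
    have "cmod (c i) \<le> (\<Sum>l\<in>Neg. cmod (\<alpha> l * U i l))" unfolding c_def by (rule norm_sum)
    also have "\<dots> \<le> (\<Sum>l\<in>Neg. cmod (U i l))"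
      unfolding norm_mult by (intro sum_mono mult_left_le_one_le al) auto
    also have "\<dots> \<le> M" unfolding M_def
      using member_le_sum[of i "{..<n}" "\<lambda>i. \<Sum>l\<in>Neg. cmod (U i l)"] i by (simp add: sum_nonneg)
    finally show ?thesis .
  qed
  have "Re Q - Re Q0 \<le> cmod (Q - Q0)" using complex_Re_le_cmod[of "Q - Q0"] by simp
  also have "Q - Q0 = (\<Sum>i<n. \<Sum>j<n. c i * cnj (c j) * (K r i j - P j i))"
    unfolding Q_def Q0_def by (simp add: sum_subtractf[symmetric] algebra_simps)
  also have "cmod \<dots> \<le> (\<Sum>i<n. \<Sum>j<n. cmod (c i * cnj (c j) * (K r i j - P j i)))"
    by (intro order.trans[OF norm_sum] sum_mono) simp
  also have "\<dots> \<le> (\<Sum>i<n. \<Sum>j<n. M\<^sup>2 * cmod (K r i j - P j i))"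
  proof (intro sum_mono)
    fix i j assume "i \<in> {..<n}" "j \<in> {..<n}"
    then have "cmod (c i) * cmod (c j) \<le> M * M"
      by (intro mult_mono cM order.trans[OF norm_ge_zero cM[of i]]) auto
    then show "cmod (c i * cnj (c j) * (K r i j - P j i)) \<le> M\<^sup>2 * cmod (K r i j - P j i)"
      unfolding norm_mult by (intro mult_right_mono) (auto simp: power2_eq_square)
  qed
  also have "\<dots> < \<delta>" using r(1) by (simp add: sum_distrib_left)
  finally show False using Q1 Q2 by simp
qed

section \<open>The kernel identity\<close>

lemma sum_kronecker:
  fixes x :: "nat \<Rightarrow> complex"
  assumes "i < n"
  shows "(\<Sum>l<n. (if i = l then 1 else 0) * x l) = x i" "(\<Sum>l<n. x l * (if l = i then 1 else 0)) = x i"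
proof -
  have "(\<Sum>l<n. (if i = l then 1 else 0) * x l) = (\<Sum>l<n. if i = l then x l else 0)"
    "(\<Sum>l<n. x l * (if l = i then 1 else 0)) = (\<Sum>l<n. if l = i then x l else 0)"
    by (rule sum.cong[OF refl], simp)+
  then show "(\<Sum>l<n. (if i = l then 1 else 0) * x l) = x i" "(\<Sum>l<n. x l * (if l = i then 1 else 0)) = x i"
    using assms by auto
qed

text \<open>The data of the problem without matrix types: \<open>P\<close> holds the entries of the Pick matrix and \<open>Q\<close>
those of its inverse.\<close>

locale interpolation_data =
  fixes n :: nat and t w :: "nat \<Rightarrow> complex" and \<gamma> :: "nat \<Rightarrow> real" and \<mu> :: complex
    and P Q :: "nat \<Rightarrow> nat \<Rightarrow> complex"
  assumes t_unimodular: "\<And>i. i < n \<Longrightarrow> cmod (t i) = 1"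
    and t_inj: "inj_on t {..<n}"
    and w_unimodular: "\<And>i. i < n \<Longrightarrow> cmod (w i) = 1"
    and \<mu>_unimodular: "cmod \<mu> = 1"
    and \<mu>_not_node: "\<And>i. i < n \<Longrightarrow> \<mu> \<noteq> t i"
    and P_diag: "\<And>i. i < n \<Longrightarrow> P i i = complex_of_real (\<gamma> i)"
    and P_off_diag: "\<And>i j. i < n \<Longrightarrow> j < n \<Longrightarrow> i \<noteq> j \<Longrightarrow> P i j = (1 - cnj (w i) * w j) / (1 - cnj (t i) * t j)"
    and P_Q: "\<And>i j. i < n \<Longrightarrow> j < n \<Longrightarrow> (\<Sum>k<n. P i k * Q k j) = (if i = j then 1 else 0)"
    and Q_P: "\<And>i j. i < n \<Longrightarrow> j < n \<Longrightarrow> (\<Sum>k<n. Q i k * P k j) = (if i = j then 1 else 0)"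
begin

lemma t_cnj: "i < n \<Longrightarrow> t i * cnj (t i) = 1" "i < n \<Longrightarrow> cnj (t i) * t i = 1"
  using t_unimodular[of i] cmod_power2_complex[of "t i"] by (auto simp: mult.commute)

lemma w_cnj: "i < n \<Longrightarrow> w i * cnj (w i) = 1" "i < n \<Longrightarrow> cnj (w i) * w i = 1"
  using w_unimodular[of i] cmod_power2_complex[of "w i"] by (auto simp: mult.commute)

lemma \<mu>_cnj: "\<mu> * cnj \<mu> = 1"
  using \<mu>_unimodular cmod_power2_complex[of \<mu>] by auto

lemma node_gap: "i < n \<Longrightarrow> j < n \<Longrightarrow> i \<noteq> j \<Longrightarrow> 1 - cnj (t i) * t j \<noteq> 0"
proof
  assume i: "i < n" and j: "j < n" and ij: "i \<noteq> j" and 0: "1 - cnj (t i) * t j = 0"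
  have "t i = t i * (cnj (t i) * t j)" using 0 by simp
  also have "\<dots> = t j" using t_cnj(1)[OF i] by (simp add: mult.assoc[symmetric])
  finally show False using t_inj i j ij by (auto simp: inj_on_def)
qed

text \<open>The Stein equation of the Pick matrix. The free parameters on the diagonal are multiplied by 0.\<close>

lemma stein: "i < n \<Longrightarrow> j < n \<Longrightarrow> P i j * (1 - cnj (t i) * t j) = 1 - cnj (w i) * w j"
  by (cases "i = j") (use node_gap[of i j] P_off_diag[of i j] t_cnj w_cnj in auto)

lemma P_hermitian: "i < n \<Longrightarrow> j < n \<Longrightarrow> cnj (P i j) = P j i"
  by (cases "i = j") (simp_all add: P_diag P_off_diag mult.commute)

lemma Q_hermitian: assumes i: "i < n" and j: "j < n" shows "cnj (Q i j) = Q j i"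
proof -
  have "(\<Sum>k<n. P l k * cnj (Q i k)) = (if l = i then 1 else 0)" if l: "l < n" for l
  proof -
    have "(\<Sum>k<n. P l k * cnj (Q i k)) = cnj (\<Sum>k<n. Q i k * P k l)"
      using P_hermitian l by (simp add: mult.commute)
    then show ?thesis using Q_P[OF i l] by auto
  qed
  note * = this
  have "Q j i = (\<Sum>l<n. Q j l * (\<Sum>k<n. P l k * cnj (Q i k)))"
    using i by (simp add: * sum_kronecker cong: sum.cong_simp)
  also have "\<dots> = (\<Sum>k<n. (\<Sum>l<n. Q j l * P l k) * cnj (Q i k))"
    by (simp add: sum_distrib_left sum_distrib_right mult.assoc) (rule sum.swap)
  also have "\<dots> = cnj (Q i j)"
    using j by (simp add: Q_P sum_kronecker cong: sum.cong_simp)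
  finally show ?thesis ..
qed

lemma P_injective:
  assumes "\<And>i. i < n \<Longrightarrow> (\<Sum>j<n. P i j * x j) = 0" and "k < n" shows "x k = 0"
proof -
  have "0 = (\<Sum>i<n. Q k i * (\<Sum>j<n. P i j * x j))" by (simp add: assms(1) sum_kronecker cong: sum.cong_simp)
  also have "\<dots> = (\<Sum>j<n. (\<Sum>i<n. Q k i * P i j) * x j)"
    by (simp add: sum_distrib_left sum_distrib_right mult.assoc) (rule sum.swap)
  also have "\<dots> = x k" using assms(2) by (simp add: Q_P sum_kronecker cong: sum.cong_simp)
  finally show ?thesis ..
qed

text \<open>The diagonal of \<open>(I - \<mu> T\<^sup>*)\<^sup>-\<^sup>1\<close>.\<close>

definition m :: "nat \<Rightarrow> complex" where "m l = 1 / (1 - \<mu> * cnj (t l))"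

lemma m_denominator: "l < n \<Longrightarrow> 1 - \<mu> * cnj (t l) \<noteq> 0"
proof
  assume l: "l < n" and 0: "1 - \<mu> * cnj (t l) = 0"
  have "t l = (\<mu> * cnj (t l)) * t l" using 0 by simp
  also have "\<dots> = \<mu>" using t_cnj(2)[OF l] by (simp add: mult.assoc)
  finally show False using \<mu>_not_node[OF l] by simp
qed

lemma m_nonzero: "l < n \<Longrightarrow> m l \<noteq> 0"
  using m_denominator by (simp add: m_def)

lemma m_inverse: "l < n \<Longrightarrow> m l * (1 - \<mu> * cnj (t l)) = 1"
  using m_denominator by (simp add: m_def)

text \<open>The inverse of \<open>1 - a\<close> with \<open>a\<close> on the circle has real part one half.\<close>

lemma cnj_m: assumes l: "l < n" shows "cnj (m l) = 1 - m l"
proof -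
  define a where "a = \<mu> * cnj (t l)"
  have "a * cnj a = (\<mu> * cnj \<mu>) * (t l * cnj (t l))" by (simp add: a_def algebra_simps)
  then have a: "a * cnj a = 1" using t_cnj(1)[OF l] \<mu>_cnj by simp
  have 1: "1 - a \<noteq> 0" using m_denominator[OF l] by (simp add: a_def)
  then have 2: "1 - cnj a \<noteq> 0" by (metis complex_cnj_cnj complex_cnj_diff complex_cnj_one complex_cnj_zero_iff)
  have "cnj (m l) + m l = 1 / (1 - cnj a) + 1 / (1 - a)" by (simp add: m_def a_def)
  also have "\<dots> = ((1 - a) + (1 - cnj a)) / ((1 - cnj a) * (1 - a))"
    unfolding add_frac_eq[OF 2 1] by simp
  also have "(1 - cnj a) * (1 - a) = (1 - a) + (1 - cnj a)" using a by (simp add: algebra_simps)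
  also have "((1 - a) + (1 - cnj a)) / ((1 - a) + (1 - cnj a)) = 1"
    using 1 2 \<open>(1 - cnj a) * (1 - a) = (1 - a) + (1 - cnj a)\<close> by (metis divide_self mult_eq_0_iff)
  finally show ?thesis by (simp add: algebra_simps)
qed

lemma m_inj: assumes "i < n" "j < n" "m i = m j" shows "i = j"
proof -
  have "m i * (1 - \<mu> * cnj (t i)) = m i * (1 - \<mu> * cnj (t j))" using m_inverse assms by metis
  then have "\<mu> * cnj (t i) = \<mu> * cnj (t j)" using m_nonzero[OF assms(1)] by simp
  then have "t i = t j" using \<mu>_unimodular by auto
  then show ?thesis using t_inj assms by (auto simp: inj_on_def)
qed

text \<open>The two columns of \<open>P\<^sup>-\<^sup>1 (I - \<mu> T\<^sup>*)\<^sup>-\<^sup>1 [C\<^sup>* , - E\<^sup>*]\<close>.\<close>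

definition p0 :: "nat \<Rightarrow> complex" where "p0 j = (\<Sum>l<n. Q j l * (m l * cnj (w l)))"
definition p1 :: "nat \<Rightarrow> complex" where "p1 j = (\<Sum>l<n. Q j l * (- m l))"

lemma P_mult_Q_vector: assumes "i < n" shows "(\<Sum>j<n. P i j * (\<Sum>l<n. Q j l * x l)) = x i"
proof -
  have "(\<Sum>j<n. P i j * (\<Sum>l<n. Q j l * x l)) = (\<Sum>l<n. (\<Sum>j<n. P i j * Q j l) * x l)"
    by (simp add: sum_distrib_left sum_distrib_right mult.assoc) (rule sum.swap)
  also have "\<dots> = x i" using assms by (simp add: P_Q sum_kronecker cong: sum.cong_simp)
  finally show ?thesis .
qed

text \<open>For a homogeneous parameter \<open>(e, f)\<close>, the vector \<open>y\<close> is
\<open>(z - T)\<^sup>-\<^sup>1 P\<^sup>-\<^sup>1 (I - \<mu> T\<^sup>*)\<^sup>-\<^sup>1 [C\<^sup>* , - E\<^sup>*]\<close> applied to \<open>(e, f)\<close>, and \<open>num\<close>, \<open>den\<close> are the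
components of \<open>\<Theta> z\<close> applied to \<open>(e, f)\<close>. The homogeneous form gives the entries of \<open>\<Theta>\<close> as the
special cases \<open>(1, 0)\<close> and \<open>(0, 1)\<close>. The scaling in \<open>v\<close> removes \<open>\<mu>\<close> from both identities below.\<close>

definition y :: "complex \<Rightarrow> complex \<Rightarrow> complex \<Rightarrow> nat \<Rightarrow> complex" where
  "y e f z j = (p0 j * e + p1 j * f) / (z - t j)"
definition v :: "complex \<Rightarrow> complex \<Rightarrow> complex \<Rightarrow> nat \<Rightarrow> complex" where
  "v e f z j = (\<mu> - t j) * y e f z j"
definition num :: "complex \<Rightarrow> complex \<Rightarrow> complex \<Rightarrow> complex" where
  "num e f z = e + (z - \<mu>) * (\<Sum>j<n. w j * y e f z j)"
definition den :: "complex \<Rightarrow> complex \<Rightarrow> complex \<Rightarrow> complex" where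
  "den e f z = f + (z - \<mu>) * (\<Sum>j<n. y e f z j)"

text \<open>The definition of \<open>p0\<close>, \<open>p1\<close> expresses \<open>cnj (w i) e - f\<close> through \<open>P (z - T) y\<close>, and the Stein equation
expresses the coefficients \<open>cnj (w i) w j - 1\<close> of the remaining terms through \<open>P\<close>. The two
contributions combine to the single factor \<open>1 - z cnj (t i)\<close>.\<close>

lemma node_residual:
  assumes i: "i < n" and z: "z \<notin> t ` {..<n}"
  shows "cnj (w i) * num e f z - den e f z = (1 - z * cnj (t i)) * (\<Sum>j<n. P i j * v e f z j)"
proof -
  have "(\<Sum>j<n. P i j * ((z - t j) * y e f z j)) = (\<Sum>j<n. P i j * p0 j) * e + (\<Sum>j<n. P i j * p1 j) * f"
  proof -
    have "(z - t j) * y e f z j = p0 j * e + p1 j * f" if "j < n" for j using z that by (auto simp: y_def)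
    then have "(\<Sum>j<n. P i j * ((z - t j) * y e f z j)) = (\<Sum>j<n. P i j * p0 j * e + P i j * p1 j * f)"
      by (intro sum.cong) (auto simp: distrib_left)
    then show ?thesis by (simp add: sum.distrib sum_distrib_right)
  qed
  also have "\<dots> = m i * (cnj (w i) * e - f)"
    unfolding p0_def p1_def P_mult_Q_vector[OF i] by (simp add: algebra_simps)
  finally have "(1 - \<mu> * cnj (t i)) * (\<Sum>j<n. P i j * ((z - t j) * y e f z j)) =
      (m i * (1 - \<mu> * cnj (t i))) * (cnj (w i) * e - f)" by simp
  then have 1: "cnj (w i) * e - f = (\<Sum>j<n. (1 - \<mu> * cnj (t i)) * (P i j * ((z - t j) * y e f z j)))"
    using m_inverse[OF i] by (simp add: sum_distrib_left)
  have "cnj (w i) * num e f z - den e f z =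
      (cnj (w i) * e - f) + (\<Sum>j<n. (z - \<mu>) * ((cnj (w i) * w j - 1) * y e f z j))"
    by (simp add: num_def den_def sum_distrib_left sum_subtractf algebra_simps)
  also have "\<dots> = (\<Sum>j<n. (1 - \<mu> * cnj (t i)) * (P i j * ((z - t j) * y e f z j)) +
      (z - \<mu>) * ((cnj (w i) * w j - 1) * y e f z j))"
    unfolding 1 by (simp add: sum.distrib)
  also have "\<dots> = (\<Sum>j<n. (1 - z * cnj (t i)) * (P i j * v e f z j))"
  proof (intro sum.cong refl)
    fix j assume "j \<in> {..<n}"
    then have j: "j < n" by simp
    have "cnj (w i) * w j - 1 = - (P i j * (1 - cnj (t i) * t j))" using stein[OF i j] by simp
    then have h: "cnj (w i) * w j - 1 = - (P i j * (1 - cnj (t i) * t j))" .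
    show "(1 - \<mu> * cnj (t i)) * (P i j * ((z - t j) * y e f z j)) +
      (z - \<mu>) * ((cnj (w i) * w j - 1) * y e f z j) = (1 - z * cnj (t i)) * (P i j * v e f z j)"
      unfolding h v_def by (simp add: algebra_simps)
  qed
  finally show ?thesis by (simp add: sum_distrib_left)
qed

text \<open>The \<open>J\<close>-form of \<open>\<Theta>\<close> with respect to \<open>J = diag (1, -1)\<close>. Solve the definitions of \<open>num\<close> and \<open>den\<close> for
\<open>e\<close> and \<open>f\<close>, expand, and rewrite the mixed terms by \<open>node_residual\<close> and the quadratic ones by the
Stein equation; every term becomes a multiple of \<open>cnj (y i) P i j (y j)\<close>, and the coefficients add up
because \<open>\<mu>\<close> is on the circle.\<close>

lemma kernel_identity:
  assumes z: "z \<notin> t ` {..<n}" and x: "x \<notin> t ` {..<n}"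
  shows "den e f z * cnj (den e' f' x) - num e f z * cnj (num e' f' x) =
    f * cnj f' - e * cnj e' + (1 - z * cnj x) * (\<Sum>i<n. \<Sum>j<n. cnj (v e' f' x i) * P i j * v e f z j)"
proof -
  define D where "D = den e f z"
  define N where "N = num e f z"
  define D' where "D' = cnj (den e' f' x)"
  define N' where "N' = cnj (num e' f' x)"
  define Y where "Y = (\<lambda>j. y e f z j)"
  define Y' where "Y' = (\<lambda>i. cnj (y e' f' x i))"
  have f: "f = D - (z - \<mu>) * (\<Sum>j<n. Y j)" by (simp add: D_def den_def Y_def)
  have e: "e = N - (z - \<mu>) * (\<Sum>j<n. w j * Y j)" by (simp add: N_def num_def Y_def)
  have f': "cnj f' = D' - (cnj x - cnj \<mu>) * (\<Sum>i<n. Y' i)" by (simp add: D'_def den_def Y'_def)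
  have e': "cnj e' = N' - (cnj x - cnj \<mu>) * (\<Sum>i<n. cnj (w i) * Y' i)" by (simp add: N'_def num_def Y'_def)
  (* the mixed terms contain the node residuals at x, and in A2 those at z *)
  have A1: "(\<Sum>j<n. Y j) * D' - (\<Sum>j<n. w j * Y j) * N' =
     (\<Sum>i<n. \<Sum>j<n. - (Y' i * Y j * P i j * ((1 - cnj x * t j) * (cnj \<mu> - cnj (t i)))))"
  proof -
    have "(\<Sum>j<n. Y j) * D' - (\<Sum>j<n. w j * Y j) * N' = (\<Sum>j<n. Y j * (D' - w j * N'))"
      by (simp add: sum_distrib_left sum_distrib_right sum_subtractf algebra_simps)
    also have "\<dots> = (\<Sum>j<n. \<Sum>i<n. - (Y' i * Y j * P i j * ((1 - cnj x * t j) * (cnj \<mu> - cnj (t i)))))"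
    proof (intro sum.cong refl)
      fix j assume "j \<in> {..<n}"
      then have j: "j < n" by simp
      have "D' - w j * N' = - cnj (cnj (w j) * num e' f' x - den e' f' x)" by (simp add: D'_def N'_def)
      also have "\<dots> = - ((1 - cnj x * t j) * (\<Sum>i<n. P i j * ((cnj \<mu> - cnj (t i)) * Y' i)))"
        unfolding node_residual[OF j x] using P_hermitian[OF j] by (simp add: v_def Y'_def)
      finally show "Y j * (D' - w j * N') = (\<Sum>i<n. - (Y' i * Y j * P i j * ((1 - cnj x * t j) * (cnj \<mu> - cnj (t i)))))"
        by (simp add: sum_distrib_left sum_negf mult_ac)
    qed
    also have "\<dots> = (\<Sum>i<n. \<Sum>j<n. - (Y' i * Y j * P i j * ((1 - cnj x * t j) * (cnj \<mu> - cnj (t i)))))"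
      by (rule sum.swap)
    finally show ?thesis .
  qed
  have A2: "(\<Sum>i<n. Y' i) * D - (\<Sum>i<n. cnj (w i) * Y' i) * N =
     (\<Sum>i<n. \<Sum>j<n. - (Y' i * Y j * P i j * ((1 - z * cnj (t i)) * (\<mu> - t j))))"
  proof -
    have "(\<Sum>i<n. Y' i) * D - (\<Sum>i<n. cnj (w i) * Y' i) * N = (\<Sum>i<n. Y' i * - (cnj (w i) * N - D))"
      by (simp add: sum_distrib_left sum_distrib_right sum_subtractf algebra_simps)
    also have "\<dots> = (\<Sum>i<n. \<Sum>j<n. - (Y' i * Y j * P i j * ((1 - z * cnj (t i)) * (\<mu> - t j))))"
      unfolding N_def D_def
      by (intro sum.cong refl) (simp add: node_residual[OF _ z] v_def Y_def sum_distrib_left sum_negf mult_ac)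
    finally show ?thesis .
  qed
  have A3: "(\<Sum>j<n. Y j) * (\<Sum>i<n. Y' i) - (\<Sum>j<n. w j * Y j) * (\<Sum>i<n. cnj (w i) * Y' i) =
     (\<Sum>i<n. \<Sum>j<n. Y' i * Y j * P i j * (1 - cnj (t i) * t j))"
  proof -
    have "(\<Sum>j<n. Y j) * (\<Sum>i<n. Y' i) - (\<Sum>j<n. w j * Y j) * (\<Sum>i<n. cnj (w i) * Y' i) =
      (\<Sum>i<n. \<Sum>j<n. Y' i * Y j * (1 - cnj (w i) * w j))"
    proof -
      have "(\<Sum>j<n. Y j) * (\<Sum>i<n. Y' i) = (\<Sum>i<n. \<Sum>j<n. Y' i * Y j * 1)"
        by (subst mult.commute) (simp add: sum_product)
      moreover have "(\<Sum>j<n. w j * Y j) * (\<Sum>i<n. cnj (w i) * Y' i) = (\<Sum>i<n. \<Sum>j<n. Y' i * Y j * (cnj (w i) * w j))"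
        by (subst mult.commute, unfold sum_product, intro sum.cong refl) (simp add: mult_ac)
      ultimately show ?thesis by (simp only: sum_subtractf[symmetric] right_diff_distrib)
    qed
    also have "\<dots> = (\<Sum>i<n. \<Sum>j<n. Y' i * Y j * P i j * (1 - cnj (t i) * t j))"
      by (intro sum.cong refl) (simp add: stein[symmetric] mult.assoc)
    finally show ?thesis .
  qed
  define c where "c = cnj x - cnj \<mu>"
  have "f * cnj f' - e * cnj e' = D * D' - N * N' - (z - \<mu>) * ((\<Sum>j<n. Y j) * D' - (\<Sum>j<n. w j * Y j) * N')
      - c * ((\<Sum>i<n. Y' i) * D - (\<Sum>i<n. cnj (w i) * Y' i) * N)
      + (z - \<mu>) * c * ((\<Sum>j<n. Y j) * (\<Sum>i<n. Y' i) - (\<Sum>j<n. w j * Y j) * (\<Sum>i<n. cnj (w i) * Y' i))"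
    unfolding f' e' c_def[symmetric] by (subst f, subst e) (simp add: algebra_simps)
  also have "\<dots> = D * D' - N * N' + (\<Sum>i<n. \<Sum>j<n. Y' i * Y j * P i j * 
      ((z - \<mu>) * ((1 - cnj x * t j) * (cnj \<mu> - cnj (t i))) + c * ((1 - z * cnj (t i)) * (\<mu> - t j))
        + (z - \<mu>) * c * (1 - cnj (t i) * t j)))"
    unfolding A1 A2 A3 by (simp add: sum_distrib_left sum_negf sum.distrib distrib_left mult_ac)
  also have "(\<Sum>i<n. \<Sum>j<n. Y' i * Y j * P i j * 
      ((z - \<mu>) * ((1 - cnj x * t j) * (cnj \<mu> - cnj (t i))) + c * ((1 - z * cnj (t i)) * (\<mu> - t j))
        + (z - \<mu>) * c * (1 - cnj (t i) * t j))) = 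
      (\<Sum>i<n. \<Sum>j<n. - ((1 - z * cnj x) * (cnj (v e' f' x i) * P i j * v e f z j)))"
  proof (intro sum.cong refl)
    fix i j
    have ring: "(z - \<mu>) * ((1 - X * b) * (M - a)) + (X - M) * ((1 - z * a) * (\<mu> - b))
        + (z - \<mu>) * (X - M) * (1 - a * b) = - ((1 - z * X) * ((M - a) * (\<mu> - b)))"
      if "\<mu> * M = 1" for X M a b
    proof -
      have "(z - \<mu>) * ((1 - X * b) * (M - a)) + (X - M) * ((1 - z * a) * (\<mu> - b))
        + (z - \<mu>) * (X - M) * (1 - a * b) = - ((1 - z * X) * ((M - a) * (\<mu> - b)))
        + (1 - \<mu> * M) * ((z - b) * (X - a))" by (simp add: algebra_simps)
      then show ?thesis using that by simp
    qed
    show "Y' i * Y j * P i j * 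
      ((z - \<mu>) * ((1 - cnj x * t j) * (cnj \<mu> - cnj (t i))) + c * ((1 - z * cnj (t i)) * (\<mu> - t j))
        + (z - \<mu>) * c * (1 - cnj (t i) * t j)) = - ((1 - z * cnj x) * (cnj (v e' f' x i) * P i j * v e f z j))"
      unfolding c_def ring[OF \<mu>_cnj] by (simp add: v_def Y_def Y'_def mult_ac)
  qed
  also have "\<dots> = - ((1 - z * cnj x) * (\<Sum>i<n. \<Sum>j<n. cnj (v e' f' x i) * P i j * v e f z j))"
    by (simp add: sum_distrib_left sum_negf)
  finally show ?thesis by (simp add: D_def N_def D'_def N'_def algebra_simps)
qed

text \<open>If both components vanish, then \<open>node_residual\<close> gives \<open>P v = 0\<close>, so \<open>y = 0\<close> and \<open>(e, f)\<close> is the value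
\<open>(num, den)\<close> itself.\<close>

lemma num_den_coprime:
  assumes z: "z \<notin> t ` {..<n}" and 0: "num e f z = 0" "den e f z = 0"
  shows "e = 0" "f = 0"
proof -
  have "(\<Sum>j<n. P i j * v e f z j) = 0" if i: "i < n" for i
  proof -
    have "1 - z * cnj (t i) \<noteq> 0"
    proof
      assume "1 - z * cnj (t i) = 0"
      then have "t i = (z * cnj (t i)) * t i" by simp
      also have "\<dots> = z" using t_cnj(2)[OF i] by (simp add: mult.assoc)
      finally show False using z i by auto
    qed
    then show ?thesis using node_residual[OF i z, of e f] 0 by simp
  qed
  then have "v e f z j = 0" if "j < n" for j using P_injective that by blast
  then have "y e f z j = 0" if "j < n" for j using that \<mu>_not_node by (auto simp: v_def)
  then show "e = 0" "f = 0" using 0 by (auto simp: num_def den_def)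
qed

text \<open>The Stein equation of \<open>P\<^sup>-\<^sup>1\<close>, with the weights \<open>m\<close> in the role of the nodes.\<close>

lemma inverse_stein:
  assumes i: "i < n" and j: "j < n"
  shows "p0 i * cnj (p0 j) - p1 i * cnj (p1 j) = (m i - m j) * Q i j"
proof -
  have "p0 i * cnj (p0 j) - p1 i * cnj (p1 j) =
     (\<Sum>k<n. \<Sum>l<n. Q i k * m k * (cnj (w k) * w l - 1) * cnj (m l) * Q l j)"
  proof -
    have "p0 i * cnj (p0 j) = (\<Sum>k<n. \<Sum>l<n. Q i k * m k * (cnj (w k) * w l) * cnj (m l) * Q l j)"
      unfolding p0_def cnj_sum sum_product
      by (intro sum.cong refl) (simp add: Q_hermitian[OF j] mult_ac)
    moreover have "p1 i * cnj (p1 j) = (\<Sum>k<n. \<Sum>l<n. Q i k * m k * 1 * cnj (m l) * Q l j)"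
      unfolding p1_def cnj_sum sum_product
      by (intro sum.cong refl) (simp add: Q_hermitian[OF j] mult_ac)
    ultimately show ?thesis by (simp only: sum_subtractf[symmetric] left_diff_distrib right_diff_distrib)
  qed
  also have "\<dots> = (\<Sum>k<n. \<Sum>l<n. Q i k * P k l * m l * Q l j - Q i k * m k * P k l * Q l j)"
  proof (intro sum.cong refl)
    fix k l assume "k \<in> {..<n}" "l \<in> {..<n}"
    then have k: "k < n" and l: "l < n" by auto
    have 1: "cnj (w k) * w l - 1 = - (P k l * (1 - cnj (t k) * t l))" using stein[OF k l] by simp
    have 2: "m k * cnj (m l) * (1 - cnj (t k) * t l) = m k - m l"
    proof -
      have 1: "m k * (1 - \<mu> * cnj (t k)) = 1" using m_inverse[OF k] .
      have "cnj (m l * (1 - \<mu> * cnj (t l))) = cnj 1" using m_inverse[OF l] by simp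
      then have 2: "cnj (m l) * (1 - cnj \<mu> * t l) = 1" by simp
      have "m k * cnj (m l) * (1 - cnj (t k) * t l) = m k + cnj (m l) - 1"
      proof -
        have a: "m k * (\<mu> * cnj (t k)) = m k - 1" "cnj (m l) * (cnj \<mu> * t l) = cnj (m l) - 1"
          using 1 2 by (simp_all add: algebra_simps)
        have "m k * cnj (m l) * (cnj (t k) * t l) = (\<mu> * cnj \<mu>) * (m k * cnj (m l) * (cnj (t k) * t l))"
          by (simp add: \<mu>_cnj)
        also have "\<dots> = (m k * (\<mu> * cnj (t k))) * (cnj (m l) * (cnj \<mu> * t l))" by (simp only: mult_ac)
        also have "\<dots> = (m k - 1) * (cnj (m l) - 1)" unfolding a ..
        finally show ?thesis by (simp add: algebra_simps)
      qed
      then show ?thesis unfolding cnj_m[OF l] by simp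
    qed
    have "Q i k * m k * (cnj (w k) * w l - 1) * cnj (m l) * Q l j =
       - (Q i k * P k l * Q l j) * (m k * cnj (m l) * (1 - cnj (t k) * t l))"
      unfolding 1 by (simp add: mult_ac)
    then show "Q i k * m k * (cnj (w k) * w l - 1) * cnj (m l) * Q l j =
       Q i k * P k l * m l * Q l j - Q i k * m k * P k l * Q l j"
      unfolding 2 by (simp add: algebra_simps)
  qed
  also have "\<dots> = (\<Sum>k<n. \<Sum>l<n. Q i k * P k l * m l * Q l j) - (\<Sum>k<n. Q i k * m k * (\<Sum>l<n. P k l * Q l j))"
    by (simp add: sum_subtractf sum_distrib_left mult.assoc)
  also have "(\<Sum>k<n. \<Sum>l<n. Q i k * P k l * m l * Q l j) = (\<Sum>l<n. (\<Sum>k<n. Q i k * P k l) * (m l * Q l j))"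
    by (subst sum.swap) (simp add: sum_distrib_left sum_distrib_right mult.assoc)
  also have "\<dots> = m i * Q i j" using i by (simp add: Q_P sum_kronecker cong: sum.cong_simp)
  also have "(\<Sum>k<n. Q i k * m k * (\<Sum>l<n. P k l * Q l j)) = Q i j * m j" 
    using j by (simp add: P_Q sum_kronecker cong: sum.cong_simp)
  finally have "p0 i * cnj (p0 j) - p1 i * cnj (p1 j) = m i * Q i j - Q i j * m j" .
  then show ?thesis by (simp add: algebra_simps)
qed

text \<open>The diagonal of \<open>inverse_stein\<close> gives the equality of moduli. If both numbers were 0, then
\<open>inverse_stein\<close> would make row \<open>i\<close> of \<open>Q\<close> vanish off the diagonal, as the weights are distinct, and
the definition of \<open>p0\<close> would make it vanish on the diagonal too.\<close>

lemma p_modulus: assumes i: "i < n" shows "cmod (p0 i) = cmod (p1 i)" "p0 i \<noteq> 0"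
proof -
  have "p0 i * cnj (p0 i) = p1 i * cnj (p1 i)" using inverse_stein[OF i i] by simp
  then have "complex_of_real ((cmod (p0 i))\<^sup>2) = complex_of_real ((cmod (p1 i))\<^sup>2)"
    unfolding cmod_power2_complex .
  then show 1: "cmod (p0 i) = cmod (p1 i)" by (simp only: of_real_eq_iff) simp
  show "p0 i \<noteq> 0"
  proof
    assume 0: "p0 i = 0"
    then have "p1 i = 0" using 1 by simp
    then have "(m i - m j) * Q i j = 0" if "j < n" for j using inverse_stein[OF i that] 0 by simp
    then have Q0: "Q i j = 0" if "j < n" "j \<noteq> i" for j using that m_inj[of j i] i by force
    then have "p0 i = (\<Sum>l<n. if l = i then Q i i * (m i * cnj (w i)) else 0)"
      unfolding p0_def by (intro sum.cong) auto
    then have "p0 i = Q i i * (m i * cnj (w i))" using i by simp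
    then have "Q i i = 0" using 0 m_nonzero[OF i] w_cnj[OF i] by auto
    then have "Q i j = 0" if "j < n" for j using Q0 that by (cases "j = i") auto
    then have "(\<Sum>k<n. Q i k * P k i) = 0" by simp
    then show False using Q_P[OF i i] by simp
  qed
qed

text \<open>The value of the parameter at which the residue of \<open>\<Theta>\<close> applied to \<open>(e, 1)\<close> at the node vanishes.\<close>

definition \<eta> :: "nat \<Rightarrow> complex" where "\<eta> i = - p1 i / p0 i"

lemma \<eta>_unimodular: "i < n \<Longrightarrow> cmod (\<eta> i) = 1"
  using p_modulus[of i] by (simp add: \<eta>_def norm_divide) (metis norm_eq_zero)

lemma y_at_node: "i < n \<Longrightarrow> y e 1 z i = p0 i * (e - \<eta> i) / (z - t i)"
  using p_modulus[of i] by (simp add: y_def \<eta>_def algebra_simps)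

end

section \<open>Zeros of the denominator and membership in the generalized Schur class\<close>

lemma holomorphic_factor_finite_zeros:
  assumes "finite Z" "Z \<subseteq> S" "open S" "f holomorphic_on S" "\<And>a. a \<in> Z \<Longrightarrow> f a = 0"
  shows "\<exists>g. g holomorphic_on S \<and> (\<forall>z\<in>S. f z = (\<Prod>a\<in>Z. z - a) * g z)"
  using assms
proof (induction Z rule: finite_induct)
  case empty
  then show ?case by auto
next
  case (insert a Z)
  then obtain g where g: "g holomorphic_on S" "\<And>z. z \<in> S \<Longrightarrow> f z = (\<Prod>a\<in>Z. z - a) * g z" by auto
  have a: "a \<in> S" "f a = 0" using insert.prems by auto
  moreover have "(\<Prod>b\<in>Z. a - b) \<noteq> 0" using insert.hyps by auto
  ultimately have ga: "g a = 0" using g(2)[OF a(1)] by auto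
  define h where "h = (\<lambda>z. if z = a then deriv g a else g z / (z - a) - g a / (z - a))"
  have "h holomorphic_on S"
    unfolding h_def by (rule pole_theorem_open[OF g(1) insert.prems(2)]) auto
  moreover have "f z = (\<Prod>b\<in>insert a Z. z - b) * h z" if "z \<in> S" for z
    using insert.hyps ga g(2)[OF that] by (auto simp: h_def)
  ultimately show ?case by blast
qed

lemma removable_finite_set:
  assumes "finite Z" "open S" "f holomorphic_on (S - Z)"
    and "\<And>a. a \<in> Z \<Longrightarrow> a \<in> S \<Longrightarrow> \<exists>B. eventually (\<lambda>z. norm (f z) \<le> B) (at a)"
  shows "\<exists>g. g holomorphic_on S \<and> (\<forall>z\<in>S - Z. g z = f z)"
  using assms
proof (induction Z arbitrary: f rule: finite_induct)
  case empty
  then show ?case by auto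
next
  case (insert a Z)
  have op: "open (S - Z)" using insert.hyps insert.prems(1) by (simp add: finite_imp_closed open_Diff)
  obtain g where g: "g holomorphic_on (S - Z)" "\<forall>z\<in>(S - Z) - {a}. g z = f z"
  proof (cases "a \<in> S")
    case True
    then have "a \<in> interior (S - Z)" using insert.hyps op by (simp add: interior_open)
    moreover have "f holomorphic_on (S - Z) - {a}"
      using insert.prems(2) by (metis Diff_insert)
    moreover have "\<exists>B. eventually (\<lambda>z. norm (f z) \<le> B) (at a)" using insert.prems(3) True by blast
    ultimately show ?thesis using holomorphic_on_extend_bounded[of f "S - Z" a] that by blast
  next
    case False
    then have "S - insert a Z = S - Z" by auto
    then show ?thesis using that[of f] insert.prems(2) by simp
  qed
  have "\<exists>B. eventually (\<lambda>z. norm (g z) \<le> B) (at b)" if b: "b \<in> Z" "b \<in> S" for b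
  proof -
    obtain B where B: "eventually (\<lambda>z. norm (f z) \<le> B) (at b)" using insert.prems(3) b by blast
    have "b \<in> S - (insert a Z - {b})" using b insert.hyps by auto
    moreover have "open (S - (insert a Z - {b}))"
      using insert.hyps insert.prems(1) by (intro open_Diff finite_imp_closed) auto
    ultimately have "eventually (\<lambda>z. z \<in> S - (insert a Z - {b})) (nhds b)"
      by (rule eventually_nhds_in_open[rotated])
    then have "eventually (\<lambda>z. z \<in> S - (insert a Z - {b}) \<and> z \<noteq> b) (at b)"
      by (auto simp: eventually_at_filter elim: eventually_mono)
    then have "eventually (\<lambda>z. norm (g z) \<le> B) (at b)"
      using B by eventually_elim (use g in auto)
    then show ?thesis by blast
  qed
  then obtain h where h: "h holomorphic_on S" "\<forall>z\<in>S - Z. h z = g z"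
    using insert.IH[OF insert.prems(1) g(1)] by blast
  have "\<forall>z\<in>S - insert a Z. h z = f z" using h(2) g(2) by auto
  then show ?case using h(1) by blast
qed

text \<open>A multiple zero of \<open>a + \<beta> b\<close> is a zero of the Wronskian \<open>W\<close> of \<open>a\<close> and \<open>b\<close>, and it determines \<open>\<beta>\<close>. If \<open>W\<close>
is not constant it has countably many zeros, which exclude countably many \<open>\<beta>\<close>. If \<open>W\<close> is the
constant 0, then \<open>a\<close> is a constant multiple of \<open>b\<close>, and coprimality leaves at most one bad \<open>\<beta>\<close>.\<close>

lemma generic_simple_zeros:
  assumes a: "a holomorphic_on ball 0 1" and b: "b holomorphic_on ball 0 1"
    and coprime: "\<And>z. cmod z < 1 \<Longrightarrow> a z = 0 \<Longrightarrow> b z = 0 \<Longrightarrow> False" and eps: "\<epsilon> > 0"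
  obtains \<beta> where "cmod \<beta> < \<epsilon>"
    "\<forall>z. cmod z < 1 \<longrightarrow> a z + \<beta> * b z = 0 \<longrightarrow> deriv (\<lambda>z. a z + \<beta> * b z) z \<noteq> 0"
proof -
  let ?D = "ball (0::complex) 1"
  define bad where "bad = {\<beta>. \<exists>z. cmod z < 1 \<and> a z + \<beta> * b z = 0 \<and> deriv a z + \<beta> * deriv b z = 0}"
  have da: "(a has_field_derivative deriv a z) (at z)" and db: "(b has_field_derivative deriv b z) (at z)"
    if "cmod z < 1" for z
    using a b that by (auto intro!: holomorphic_derivI[of _ ?D])
  define W where "W = (\<lambda>z. deriv a z * b z - a z * deriv b z)"
  have W: "W holomorphic_on ?D" unfolding W_def by (intro holomorphic_intros a b) auto
  have Wzero: "W z = 0 \<and> b z \<noteq> 0 \<and> \<beta> = - a z / b z"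
    if "cmod z < 1" "a z + \<beta> * b z = 0" "deriv a z + \<beta> * deriv b z = 0" for z \<beta>
  proof -
    have 1: "a z = - \<beta> * b z" and 2: "deriv a z = - \<beta> * deriv b z" using that by (auto simp: eq_neg_iff_add_eq_0)
    have "b z \<noteq> 0" using coprime[OF that(1)] 1 by auto
    then show ?thesis using 1 2 by (simp add: W_def)
  qed
  have "countable bad"
  proof (cases "W constant_on ?D")
    case False
    have "countable {z\<in>?D. W z = 0}"
    proof (rule holomorphic_countable_zeros[OF W _ _ _ False])
      obtain C :: "nat \<Rightarrow> complex set" where C: "\<And>k. compact (C k)" "\<Union>(range C) = ?D"
        using open_Union_compact_subsets[of ?D] by (metis open_ball)
      then have "fsigma (\<Union>(range C))" by (intro fsigma.intros) (auto intro: compact_imp_closed)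
      then show "fsigma ?D" using C by simp
    qed auto
    then have "countable ((\<lambda>z. - a z / b z) ` {z\<in>?D. W z = 0})" by simp
    moreover have "bad \<subseteq> (\<lambda>z. - a z / b z) ` {z\<in>?D. W z = 0}"
      using Wzero by (fastforce simp: bad_def)
    ultimately show ?thesis by (rule countable_subset[rotated])
  next
    case True
    (* W vanishes identically, so a + beta1 b is a constant multiple of b near z1; the
       constant is 0, hence a = - beta1 b in the whole disk, and z2 would be a common zero *)
    have "\<beta>1 = \<beta>2" if \<beta>: "\<beta>1 \<in> bad" "\<beta>2 \<in> bad" for \<beta>1 \<beta>2
    proof (rule ccontr)
      assume ne: "\<beta>1 \<noteq> \<beta>2"
      from \<beta> obtain z1 z2 where z1: "cmod z1 < 1" "a z1 + \<beta>1 * b z1 = 0" "deriv a z1 + \<beta>1 * deriv b z1 = 0"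
        and z2: "cmod z2 < 1" "a z2 + \<beta>2 * b z2 = 0" unfolding bad_def by blast
      have W0: "W z = 0" if "cmod z < 1" for z
        using True Wzero[OF z1] z1(1) that by (auto simp: constant_on_def)
      have bz1: "b z1 \<noteq> 0" using Wzero[OF z1] by simp
      define F where "F = (\<lambda>z. a z + \<beta>1 * b z)"
      have F: "F holomorphic_on ?D" unfolding F_def by (intro holomorphic_intros a b)
      have "isCont b z1" using db[OF z1(1)] DERIV_isCont by blast
      then have "eventually (\<lambda>z. b z \<noteq> 0) (nhds z1)"
        using bz1 unfolding isCont_def tendsto_at_iff_tendsto_nhds by (rule tendsto_imp_eventually_ne)
      moreover have "eventually (\<lambda>z. z \<in> ?D) (nhds z1)" by (rule eventually_nhds_in_open) (use z1 in auto)
      ultimately have "eventually (\<lambda>z. b z \<noteq> 0 \<and> z \<in> ?D) (nhds z1)" by eventually_elim auto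
      then obtain r where r: "r > 0" "\<And>z. dist z z1 < r \<Longrightarrow> b z \<noteq> 0 \<and> z \<in> ?D"
        unfolding eventually_nhds_metric by blast
      have "\<exists>c. \<forall>x\<in>ball z1 r. F x / b x = c"
      proof (rule has_field_derivative_zero_constant)
        show "convex (ball z1 r)" by simp
        fix x assume "x \<in> ball z1 r"
        then have x: "b x \<noteq> 0" "cmod x < 1" using r(2)[of x] by (auto simp: dist_commute)
        have "((\<lambda>z. F z / b z) has_field_derivative
          ((deriv a x + \<beta>1 * deriv b x) * b x - F x * deriv b x) / (b x * b x)) (at x)"
          unfolding F_def
          by (rule DERIV_divide[OF DERIV_add[OF da[OF x(2)] DERIV_cmult[OF db[OF x(2)]]] db[OF x(2)] x(1)])
        moreover have "(deriv a x + \<beta>1 * deriv b x) * b x - F x * deriv b x = W x"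
          by (simp add: F_def W_def algebra_simps)
        ultimately show "((\<lambda>z. F z / b z) has_field_derivative 0) (at x within ball z1 r)"
          using W0[OF x(2)] by (simp add: has_field_derivative_at_within)
      qed
      moreover have "z1 \<in> ball z1 r" using r(1) by simp
      ultimately have "\<forall>x\<in>ball z1 r. F x / b x = F z1 / b z1" by metis
      then have F0: "F z = 0" if "z \<in> ball z1 r" for z
        using that r(2)[of z] z1(2) by (force simp: F_def dist_commute)
      have "F z2 = 0"
      proof (rule analytic_continuation_open[of "ball z1 r" ?D F "\<lambda>_. 0"])
        show "ball z1 r \<subseteq> ?D" using r(2) by (auto simp: dist_commute)
      qed (use F F0 r z2 in auto)
      then have "a z2 + \<beta>1 * b z2 = 0" by (simp only: F_def)
      then have "(a z2 + \<beta>2 * b z2) - (a z2 + \<beta>1 * b z2) = 0" using z2(2) by (simp only: diff_self)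
      then have "(\<beta>2 - \<beta>1) * b z2 = 0" by (simp add: algebra_simps)
      then have "b z2 = 0" using ne by simp
      then show False using coprime[OF z2(1)] z2(2) by simp
    qed
    then have "\<exists>\<beta>. bad \<subseteq> {\<beta>}" by blast
    then show ?thesis by (meson countable_finite finite.emptyI finite.insertI finite_subset)
  qed
  moreover have "uncountable (ball (0::complex) \<epsilon>)" using eps by (rule uncountable_ball)
  ultimately have "\<not> ball 0 \<epsilon> \<subseteq> bad" using countable_subset by blast
  then obtain \<beta> where "\<beta> \<in> ball 0 \<epsilon>" "\<beta> \<notin> bad" by blast
  then have \<beta>: "cmod \<beta> < \<epsilon>" "\<beta> \<notin> bad" by simp_all
  show ?thesis
  proof (rule that[OF \<beta>(1)], intro allI impI)
    fix z assume z: "cmod z < 1" "a z + \<beta> * b z = 0"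
    have "((\<lambda>z. a z + \<beta> * b z) has_field_derivative deriv a z + \<beta> * deriv b z) (at z)"
      by (rule DERIV_add[OF da[OF z(1)] DERIV_cmult[OF db[OF z(1)]]])
    then have "deriv (\<lambda>z. a z + \<beta> * b z) z = deriv a z + \<beta> * deriv b z" by (rule DERIV_imp_deriv)
    then show "deriv (\<lambda>z. a z + \<beta> * b z) z \<noteq> 0" using \<beta>(2) z by (auto simp: bad_def)
  qed
qed

context interpolation_data
begin

lemma not_node: "cmod z < 1 \<Longrightarrow> z \<notin> t ` {..<n}"
  using t_unimodular by fastforce

lemma num_den_linear:
  "num (a * e + b * e') (a * f + b * f') z = a * num e f z + b * num e' f' z"
  "den (a * e + b * e') (a * f + b * f') z = a * den e f z + b * den e' f' z"
proof -
  have y: "y (a * e + b * e') (a * f + b * f') z j = a * y e f z j + b * y e' f' z j" for j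
    unfolding y_def times_divide_eq_right add_divide_distrib[symmetric] by (simp add: algebra_simps)
  show "num (a * e + b * e') (a * f + b * f') z = a * num e f z + b * num e' f' z"
    "den (a * e + b * e') (a * f + b * f') z = a * den e f z + b * den e' f' z"
    unfolding num_def den_def y by (simp_all add: sum.distrib sum_distrib_left algebra_simps)
qed

lemma num_den_affine:
  "num e 1 z = num 1 0 z * e + num 0 1 z" "den e 1 z = den 1 0 z * e + den 0 1 z"
  using num_den_linear[of e 1 1 0 0 1 z] by (simp_all add: mult.commute)

lemma holomorphic_num_den:
  assumes "E holomorphic_on ball 0 1"
  shows "(\<lambda>z. num (E z) f z) holomorphic_on ball 0 1" "(\<lambda>z. den (E z) f z) holomorphic_on ball 0 1"
  unfolding num_def den_def y_def
  by (intro holomorphic_intros assms; use t_unimodular in fastforce)+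

lemma den_basis_coprime:
  assumes "cmod z < 1" "den 1 0 z = 0" "den 0 1 z = 0" shows False
proof -
  note z = not_node[OF assms(1)]
  (* a parameter annihilated by the first row *)
  define a b where "a = num 0 1 z" and "b = - num 1 0 z"
  have n1: "num (a * 1 + b * 0) (a * 0 + b * 1) z = a * num 1 0 z + b * num 0 1 z"
    by (rule num_den_linear)
  have 1: "num a b z = 0" using n1 by (simp add: a_def b_def)
  have "den (a * 1 + b * 0) (a * 0 + b * 1) z = a * den 1 0 z + b * den 0 1 z"
    by (rule num_den_linear)
  then have 2: "den a b z = 0" using assms by simp
  have "num 1 0 z = 0" using num_den_coprime(2)[OF z 1 2] by (simp add: b_def)
  from num_den_coprime(1)[OF z this assms(2)] show False by simp
qed

text \<open>At the zeros of the denominator the left side of \<open>kernel_identity\<close> is minus a Szego kernel with the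
nonzero weights \<open>N z\<close>. If there were more zeros than negative eigenvalues of \<open>P\<close>, a nontrivial
combination of the zeros would be orthogonal to all negative eigenvectors; on it the right side is
nonnegative, contradicting \<open>szego_kernel_pos_def\<close>.\<close>

lemma card_zeros_le_negative_index:
  fixes U :: "nat \<Rightarrow> nat \<Rightarrow> complex" and d :: "nat \<Rightarrow> real"
  assumes PU: "\<And>i j. i < n \<Longrightarrow> j < n \<Longrightarrow> P i j = (\<Sum>l<n. complex_of_real (d l) * (U i l * cnj (U j l)))"
    and E: "E \<in> schur_class" and Z: "finite Z" "\<And>z. z \<in> Z \<Longrightarrow> cmod z < 1 \<and> den (E z) 1 z = 0"
  shows "card Z \<le> card {l. l < n \<and> d l < 0}"
proof (rule ccontr)
  define Neg where "Neg = {l. l < n \<and> d l < 0}"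
  assume "\<not> card Z \<le> card {l. l < n \<and> d l < 0}"
  then have c: "card Neg < card Z" by (simp add: Neg_def)
  have fN: "finite Neg" by (simp add: Neg_def)
  obtain h where h: "bij_betw h {..<card Neg} Neg"
    using ex_bij_betw_nat_finite[OF fN] by (auto simp: atLeast0LessThan)
  define g where "g = (\<lambda>l z. \<Sum>j<n. cnj (U j l) * v (E z) 1 z j)"
  obtain \<alpha> where \<alpha>: "(\<Sum>z\<in>Z. (cmod (\<alpha> z))\<^sup>2) = 1" "\<And>l. l < card Neg \<Longrightarrow> (\<Sum>z\<in>Z. g (h l) z * \<alpha> z) = 0"
    using underdetermined_system[OF Z(1) c, of "\<lambda>l. g (h l)"] by blast
  have gz: "(\<Sum>z\<in>Z. \<alpha> z * g l z) = 0" if "l \<in> Neg" for l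
  proof -
    obtain i where "i < card Neg" "l = h i" using h \<open>l \<in> Neg\<close> by (auto simp: bij_betw_def)
    then show ?thesis using \<alpha>(2)[of i] by (simp add: mult.commute)
  qed
  define N where "N = (\<lambda>z. num (E z) 1 z)"
  have key: "- (N z * cnj (N x)) / (1 - z * cnj x) = schur_kernel E z x +
      (\<Sum>l<n. complex_of_real (d l) * (g l z * cnj (g l x)))" if z: "z \<in> Z" and x: "x \<in> Z" for z x
  proof -
    have z1: "cmod z < 1" and x1: "cmod x < 1" and Dz: "den (E z) 1 z = 0" using Z(2) z x by auto
    have nz: "1 - z * cnj x \<noteq> 0" using one_minus_cnj_mult_neq_0[of x z] z1 x1 by (simp add: mult.commute)
    have "(\<Sum>i<n. \<Sum>j<n. cnj (v (E x) 1 x i) * P i j * v (E z) 1 z j) =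
        (\<Sum>i<n. \<Sum>j<n. \<Sum>l<n. complex_of_real (d l) * ((cnj (U j l) * v (E z) 1 z j) * cnj (cnj (U i l) * v (E x) 1 x i)))"
      by (intro sum.cong refl) (simp add: PU sum_distrib_left sum_distrib_right mult_ac)
    also have "\<dots> = (\<Sum>l<n. \<Sum>i<n. \<Sum>j<n. complex_of_real (d l) * ((cnj (U j l) * v (E z) 1 z j) * cnj (cnj (U i l) * v (E x) 1 x i)))"
      by (rule sum_rotate)
    also have "\<dots> = (\<Sum>l<n. complex_of_real (d l) * (g l z * cnj (g l x)))"
    proof (intro sum.cong refl)
      fix l
      have "g l z * cnj (g l x) = (\<Sum>j<n. \<Sum>i<n. (cnj (U j l) * v (E z) 1 z j) * cnj (cnj (U i l) * v (E x) 1 x i))"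
        unfolding g_def cnj_sum sum_product ..
      also have "\<dots> = (\<Sum>i<n. \<Sum>j<n. (cnj (U j l) * v (E z) 1 z j) * cnj (cnj (U i l) * v (E x) 1 x i))"
        by (rule sum.swap)
      finally show "(\<Sum>i<n. \<Sum>j<n. complex_of_real (d l) * ((cnj (U j l) * v (E z) 1 z j) * cnj (cnj (U i l) * v (E x) 1 x i)))
         = complex_of_real (d l) * (g l z * cnj (g l x))" by (simp add: sum_distrib_left)
    qed
    finally have "- (N z * cnj (N x)) = (1 - E z * cnj (E x)) + (1 - z * cnj x) * (\<Sum>l<n. complex_of_real (d l) * (g l z * cnj (g l x)))"
      using kernel_identity[OF not_node[OF z1] not_node[OF x1], of "E z" 1 "E x" 1] Dz by (simp add: N_def)
    then show ?thesis using nz by (simp add: schur_kernel_def add_divide_distrib)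
  qed
  have "- (\<Sum>z\<in>Z. \<Sum>x\<in>Z. (\<alpha> z * N z) * cnj (\<alpha> x * N x) / (1 - z * cnj x)) =
     (\<Sum>z\<in>Z. \<Sum>x\<in>Z. \<alpha> z * cnj (\<alpha> x) * (- (N z * cnj (N x)) / (1 - z * cnj x)))"
    by (simp add: sum_negf mult_ac)
  also have "\<dots> = (\<Sum>z\<in>Z. \<Sum>x\<in>Z. \<alpha> z * cnj (\<alpha> x) * schur_kernel E z x +
      (\<Sum>l<n. complex_of_real (d l) * ((\<alpha> z * g l z) * cnj (\<alpha> x * g l x))))"
    by (intro sum.cong refl) (simp only: key, simp add: distrib_left sum_distrib_left mult_ac)
  also have "\<dots> = (\<Sum>z\<in>Z. \<Sum>x\<in>Z. \<alpha> z * cnj (\<alpha> x) * schur_kernel E z x) +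
      (\<Sum>z\<in>Z. \<Sum>x\<in>Z. \<Sum>l<n. complex_of_real (d l) * ((\<alpha> z * g l z) * cnj (\<alpha> x * g l x)))"
    by (simp add: sum.distrib)
  also have "(\<Sum>z\<in>Z. \<Sum>x\<in>Z. \<Sum>l<n. complex_of_real (d l) * ((\<alpha> z * g l z) * cnj (\<alpha> x * g l x))) =
      (\<Sum>l<n. \<Sum>z\<in>Z. \<Sum>x\<in>Z. complex_of_real (d l) * ((\<alpha> z * g l z) * cnj (\<alpha> x * g l x)))"
    by (rule sum_rotate)
  also have "\<dots> = (\<Sum>l<n. complex_of_real (d l * (cmod (\<Sum>z\<in>Z. \<alpha> z * g l z))\<^sup>2))"
    unfolding of_real_mult sum_sum_mult_cnj[symmetric] sum_distrib_left ..
  finally have tot: "- (\<Sum>z\<in>Z. \<Sum>x\<in>Z. (\<alpha> z * N z) * cnj (\<alpha> x * N x) / (1 - z * cnj x)) =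
     (\<Sum>z\<in>Z. \<Sum>x\<in>Z. \<alpha> z * cnj (\<alpha> x) * schur_kernel E z x) + 
     (\<Sum>l<n. complex_of_real (d l * (cmod (\<Sum>z\<in>Z. \<alpha> z * g l z))\<^sup>2))" .
  have "- Re (\<Sum>z\<in>Z. \<Sum>x\<in>Z. (\<alpha> z * N z) * cnj (\<alpha> x * N x) / (1 - z * cnj x)) =
     Re (\<Sum>z\<in>Z. \<Sum>x\<in>Z. \<alpha> z * cnj (\<alpha> x) * schur_kernel E z x) + (\<Sum>l<n. d l * (cmod (\<Sum>z\<in>Z. \<alpha> z * g l z))\<^sup>2)"
    using arg_cong[OF tot, of Re] by (simp only: uminus_complex.simps plus_complex.simps Re_sum Re_complex_of_real)
  moreover have "0 \<le> Re (\<Sum>z\<in>Z. \<Sum>x\<in>Z. \<alpha> z * cnj (\<alpha> x) * schur_kernel E z x)"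
    by (rule schur_kernel_psd[OF Z(1) _ E, where z = "\<lambda>z. z"]) (use Z in auto)
  moreover have "0 \<le> (\<Sum>l<n. d l * (cmod (\<Sum>z\<in>Z. \<alpha> z * g l z))\<^sup>2)"
  proof (rule sum_nonneg)
    fix l assume "l \<in> {..<n}"
    then show "0 \<le> d l * (cmod (\<Sum>z\<in>Z. \<alpha> z * g l z))\<^sup>2"
      by (cases "l \<in> Neg") (auto simp: gz Neg_def)
  qed
  ultimately have "Re (\<Sum>z\<in>Z. \<Sum>x\<in>Z. (\<alpha> z * N z) * cnj (\<alpha> x * N x) / (1 - z * cnj x)) \<le> 0" by linarith
  then have "\<forall>z\<in>Z. \<alpha> z * N z = 0"
    by (intro szego_kernel_pos_def[where z = "\<lambda>z. z"] Z(1)) (use Z in auto)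
  moreover have "N z \<noteq> 0" if "z \<in> Z" for z
    using num_den_coprime(2)[OF not_node, of z "E z" 1] Z(2)[OF that] by (auto simp: N_def)
  ultimately have "\<forall>z\<in>Z. \<alpha> z = 0" by auto
  then show False using \<alpha>(1) by simp
qed

end

text \<open>Extending the zeros by the value 1 to a family of fixed length is harmless for the bounds below,
because \<open>z - 1\<close> and \<open>1 - z\<close> have the same modulus. A fixed length makes the families for different
parameters comparable.\<close>

lemma pad_finite_set:
  assumes "finite Z" "Z \<subseteq> ball 0 1" "card Z \<le> k"
  obtains a :: "nat \<Rightarrow> complex" where "\<forall>j<k. cmod (a j) \<le> 1"
    "\<forall>F :: complex \<Rightarrow> real. (\<Prod>j<k. F (a j)) = (\<Prod>x\<in>Z. F x) * F 1 ^ (k - card Z)"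
proof -
  obtain h where h: "bij_betw h {..<card Z} Z"
    using ex_bij_betw_nat_finite[OF assms(1)] by (auto simp: atLeast0LessThan)
  define a where "a = (\<lambda>j. if j < card Z then h j else 1)"
  have hZ: "h j \<in> Z" if "j < card Z" for j using h that by (auto simp: bij_betw_def)
  show ?thesis
  proof (rule that[of a])
    show "\<forall>j<k. cmod (a j) \<le> 1"
    proof (intro allI impI)
      fix j show "cmod (a j) \<le> 1" using hZ[of j] assms(2) by (auto simp: a_def less_imp_le subset_iff)
    qed
    show "\<forall>F :: complex \<Rightarrow> real. (\<Prod>j<k. F (a j)) = (\<Prod>x\<in>Z. F x) * F 1 ^ (k - card Z)"
    proof
      fix F :: "complex \<Rightarrow> real"
      have u: "{..<k} = {..<card Z} \<union> {card Z..<k}" using assms(3) by auto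
      have "(\<Prod>j<k. F (a j)) = (\<Prod>j<card Z. F (a j)) * (\<Prod>j\<in>{card Z..<k}. F (a j))"
        unfolding u by (rule prod.union_disjoint) auto
      also have "(\<Prod>j<card Z. F (a j)) = (\<Prod>j<card Z. F (h j))" by (simp add: a_def)
      also have "\<dots> = (\<Prod>x\<in>Z. F x)" by (rule prod.reindex_bij_betw[OF h])
      also have "(\<Prod>j\<in>{card Z..<k}. F (a j)) = F 1 ^ (k - card Z)" by (simp add: a_def)
      finally show "(\<Prod>j<k. F (a j)) = (\<Prod>x\<in>Z. F x) * F 1 ^ (k - card Z)" .
    qed
  qed
qed

context interpolation_data
begin

text \<open>Multiplying \<open>den\<close> and \<open>v\<close> by \<open>\<Prod>\<^sub>l (z - t\<^sub>l)\<close> gives polynomials in \<open>z\<close> and \<open>e\<close>, which extend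
continuously to the nodes, where compactness can be used.\<close>

definition cofactor :: "nat \<Rightarrow> complex \<Rightarrow> complex" where
  "cofactor j z = (\<Prod>l\<in>{..<n} - {j}. z - t l)"

definition nodal :: "complex \<Rightarrow> complex" where "nodal z = (\<Prod>l<n. z - t l)"

definition cleared_den :: "complex \<Rightarrow> complex \<Rightarrow> complex" where
  "cleared_den z e = nodal z + (z - \<mu>) * (\<Sum>j<n. (p0 j * e + p1 j) * cofactor j z)"

definition cleared_v :: "complex \<Rightarrow> complex \<Rightarrow> nat \<Rightarrow> complex" where
  "cleared_v z e j = (\<mu> - t j) * ((p0 j * e + p1 j) * cofactor j z)"

lemma nodal_cofactor: "j < n \<Longrightarrow> nodal z = (z - t j) * cofactor j z"
  unfolding nodal_def cofactor_def by (rule prod.remove) auto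

lemma nodal_nonzero: "z \<notin> t ` {..<n} \<Longrightarrow> nodal z \<noteq> 0"
  by (auto simp: nodal_def)

lemma nodal_mult_y:
  assumes "z \<notin> t ` {..<n}" "j < n"
  shows "nodal z * y e 1 z j = (p0 j * e + p1 j) * cofactor j z"
  using assms by (auto simp: nodal_cofactor[OF assms(2)] y_def)

lemma cleared_den: "z \<notin> t ` {..<n} \<Longrightarrow> nodal z * den e 1 z = cleared_den z e"
  by (simp add: den_def cleared_den_def distrib_left sum_distrib_left mult.left_commute[of "nodal z"] nodal_mult_y)

lemma cleared_v: "z \<notin> t ` {..<n} \<Longrightarrow> j < n \<Longrightarrow> nodal z * v e 1 z j = cleared_v z e j"
  by (simp add: v_def cleared_v_def mult.left_commute[of "nodal z"] nodal_mult_y)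

lemma kernel_identity_diagonal:
  assumes z: "z \<notin> t ` {..<n}"
  shows "(cmod (den e 1 z))\<^sup>2 - (cmod (num e 1 z))\<^sup>2 = 1 - (cmod e)\<^sup>2 +
    (1 - (cmod z)\<^sup>2) * Re (\<Sum>i<n. \<Sum>j<n. cnj (v e 1 z i) * P i j * v e 1 z j)"
proof -
  have "complex_of_real ((cmod (den e 1 z))\<^sup>2 - (cmod (num e 1 z))\<^sup>2) =
    complex_of_real (1 - (cmod e)\<^sup>2) + complex_of_real (1 - (cmod z)\<^sup>2) * (\<Sum>i<n. \<Sum>j<n. cnj (v e 1 z i) * P i j * v e 1 z j)"
    using kernel_identity[OF z z, of e 1 e 1] unfolding of_real_diff cmod_power2_complex of_real_1 by simp
  from arg_cong[OF this, of Re] show ?thesis by simp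
qed

text \<open>At a node only the residue survives, and it vanishes only for the unimodular parameter \<open>\<eta> i\<close>.
Elsewhere on the circle the kernel identity gives \<open>\<bar>den\<bar>\<^sup>2 > \<bar>num\<bar>\<^sup>2\<close>.\<close>

lemma cleared_den_nonzero_on_circle:
  assumes z: "cmod z = 1" and e: "cmod e < 1" shows "cleared_den z e \<noteq> 0"
proof (cases "z \<in> t ` {..<n}")
  case True
  then obtain i where i: "i < n" "z = t i" by auto
  have "cofactor j z = 0" if "j < n" "j \<noteq> i" for j
    unfolding cofactor_def using i that by (intro prod_zero) auto
  then have "(\<Sum>j<n. (p0 j * e + p1 j) * cofactor j z) = (\<Sum>j<n. if j = i then (p0 i * e + p1 i) * cofactor i z else 0)"
    by (intro sum.cong) auto
  then have eq: "cleared_den z e = (t i - \<mu>) * ((p0 i * e + p1 i) * cofactor i z)"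
    using i by (simp add: cleared_den_def nodal_cofactor[OF i(1)])
  have "cofactor i z \<noteq> 0"
    using t_inj i by (auto simp: cofactor_def inj_on_def)
  moreover have "p0 i * e + p1 i \<noteq> 0"
  proof
    assume "p0 i * e + p1 i = 0"
    then have "cmod (p1 i) = cmod (p0 i * e)" by (metis add_eq_0_iff norm_minus_cancel)
    also have "\<dots> < cmod (p0 i)" using p_modulus(2)[OF i(1)] e by (simp add: norm_mult)
    finally show False using p_modulus(1)[OF i(1)] by simp
  qed
  moreover have "t i - \<mu> \<noteq> 0" using \<mu>_not_node[OF i(1)] by auto
  ultimately show ?thesis unfolding eq by simp
next
  case False
  have "1 - (cmod e)\<^sup>2 > 0" using e by (simp add: abs_square_less_1)
  then have "(cmod (den e 1 z))\<^sup>2 - (cmod (num e 1 z))\<^sup>2 > 0"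
    unfolding kernel_identity_diagonal[OF False] using z by simp
  then have "den e 1 z \<noteq> 0" by (metis diff_gt_0_iff_gt norm_zero not_less zero_le_power2 zero_power2)
  then show ?thesis using cleared_den[OF False, of e] nodal_nonzero[OF False] by (metis mult_eq_0_iff)
qed

lemma continuous_cleared:
  "continuous_on A (\<lambda>p. cleared_den (fst p) (snd p))"
  "continuous_on A (\<lambda>p. \<Sum>i<n. \<Sum>j<n. cnj (cleared_v (fst p) (snd p) i) * P i j * cleared_v (fst p) (snd p) j)"
  unfolding cleared_den_def nodal_def cofactor_def cleared_v_def by (intro continuous_intros)+

text \<open>Compactness: the zeros of the cleared denominator with \<open>\<bar>e\<bar> \<le> \<rho>\<close> stay away from the circle.\<close>

lemma cleared_den_lower_bound:
  assumes \<rho>: "\<rho> < 1"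
  obtains r c where "r < 1" "c > 0" "\<forall>z e. r \<le> cmod z \<longrightarrow> cmod z \<le> 1 \<longrightarrow> cmod e \<le> \<rho> \<longrightarrow> c \<le> cmod (cleared_den z e)"
proof -
  define X where "X = cball (0::complex) 1 \<times> cball (0::complex) \<rho>"
  define F where "F = (\<lambda>p. cleared_den (fst p) (snd p))"
  have F: "continuous_on A F" for A unfolding F_def by (rule continuous_cleared)
  have "compact X" by (simp add: X_def compact_Times)
  define C where "C = X \<inter> F -` {0}"
  have "compact C"
  proof -
    have "closed (F -` {0})" by (rule closed_vimage[OF closed_singleton F])
    then show ?thesis unfolding C_def using \<open>compact X\<close> by (rule compact_Int_closed[rotated])
  qed
  obtain r1 where r1: "r1 < 1" "\<And>p. p \<in> C \<Longrightarrow> cmod (fst p) \<le> r1"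
  proof (cases "C = {}")
    case True
    then show ?thesis using that[of 0] by simp
  next
    case False
    have "continuous_on C (\<lambda>p. cmod (fst p))" by (intro continuous_intros)
    then obtain p where p: "p \<in> C" "\<forall>q\<in>C. cmod (fst q) \<le> cmod (fst p)"
      using continuous_attains_sup[OF \<open>compact C\<close> False] by blast
    have p': "cmod (fst p) \<le> 1" "cmod (snd p) < 1" "F p = 0" using p(1) \<rho> by (auto simp: C_def X_def)
    then have "cmod (fst p) \<noteq> 1" using cleared_den_nonzero_on_circle[of "fst p" "snd p"] by (auto simp: F_def)
    then show ?thesis using that[of "cmod (fst p)"] p(2) p'(1) by auto
  qed
  (* r1 bounds the moduli of the zeros, so any radius between r1 and 1 works *)
  define r where "r = (1 + r1) / 2"
  define K where "K = X \<inter> {p. r \<le> cmod (fst p)}"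
  have r: "r < 1" "r1 < r" using r1(1) by (auto simp: r_def)
  have "closed {p :: complex \<times> complex. r \<le> cmod (fst p)}" by (intro closed_Collect_le continuous_intros)
  then have cK: "compact K" unfolding K_def using \<open>compact X\<close> by (rule compact_Int_closed[rotated])
  have FK: "F p \<noteq> 0" if "p \<in> K" for p
    using r1(2)[of p] that r by (auto simp: K_def C_def)
  show ?thesis
  proof (cases "K = {}")
    case True
    then have "\<forall>z e. r \<le> cmod z \<longrightarrow> cmod z \<le> 1 \<longrightarrow> cmod e \<le> \<rho> \<longrightarrow> 1 \<le> cmod (cleared_den z e)"
    proof (intro allI impI)
      fix z e :: complex assume "r \<le> cmod z" "cmod z \<le> 1" "cmod e \<le> \<rho>"
      then have "(z, e) \<in> K" by (simp add: K_def X_def)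
      then show "1 \<le> cmod (cleared_den z e)" using True by simp
    qed
    then show ?thesis using that[of r 1] r by simp
  next
    case False
    have "continuous_on K (\<lambda>p. cmod (F p))" by (intro continuous_intros F)
    then obtain p where p: "p \<in> K" "\<forall>q\<in>K. cmod (F p) \<le> cmod (F q)"
      using continuous_attains_inf[OF cK False] by blast
    have "cmod (F p) > 0" using FK[OF p(1)] by simp
    moreover have "\<forall>z e. r \<le> cmod z \<longrightarrow> cmod z \<le> 1 \<longrightarrow> cmod e \<le> \<rho> \<longrightarrow> cmod (F p) \<le> cmod (cleared_den z e)"
    proof (intro allI impI)
      fix z e :: complex assume "r \<le> cmod z" "cmod z \<le> 1" "cmod e \<le> \<rho>"
      then have "(z, e) \<in> K" by (simp add: K_def X_def)
      then show "cmod (F p) \<le> cmod (cleared_den z e)" using p(2) by (force simp: F_def)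
    qed
    ultimately show ?thesis using that[of r "cmod (F p)"] r by blast
  qed
qed

lemma cleared_form_bounded:
  obtains K where "K \<ge> 0"
    "\<forall>z e. cmod z \<le> 1 \<longrightarrow> cmod e \<le> 1 \<longrightarrow> cmod (\<Sum>i<n. \<Sum>j<n. cnj (cleared_v z e i) * P i j * cleared_v z e j) \<le> K"
proof -
  define X where "X = cball (0::complex) 1 \<times> cball (0::complex) 1"
  define F where "F = (\<lambda>p. \<Sum>i<n. \<Sum>j<n. cnj (cleared_v (fst p) (snd p) i) * P i j * cleared_v (fst p) (snd p) j)"
  have "compact X" by (simp add: X_def compact_Times)
  moreover have "continuous_on X F" unfolding F_def by (rule continuous_cleared)
  ultimately have "compact (F ` X)" by (rule compact_continuous_image[rotated])
  then obtain K where K: "\<And>p. p \<in> X \<Longrightarrow> cmod (F p) \<le> K" "K > 0"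
    using compact_imp_bounded bounded_pos by (metis imageI)
  show ?thesis
  proof (rule that)
    show "\<forall>z e. cmod z \<le> 1 \<longrightarrow> cmod e \<le> 1 \<longrightarrow> cmod (\<Sum>i<n. \<Sum>j<n. cnj (cleared_v z e i) * P i j * cleared_v z e j) \<le> K"
    proof (intro allI impI)
      fix z e :: complex assume "cmod z \<le> 1" "cmod e \<le> 1"
      then have "(z, e) \<in> X" by (simp add: X_def)
      from K(1)[OF this] show "cmod (\<Sum>i<n. \<Sum>j<n. cnj (cleared_v z e i) * P i j * cleared_v z e j) \<le> K"
        by (simp add: F_def)
    qed
  qed (use K in simp)
qed

text \<open>Near the circle the cleared denominator has modulus at least \<open>c\<close> and the cleared form is at most \<open>K\<close>, so
the kernel identity gives \<open>\<bar>num / den\<bar>\<^sup>2 \<le> 1 + (1 - \<bar>z\<bar>\<^sup>2) K / c\<^sup>2\<close> there. The zeros of the denominator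
are finite in number and simple, so their Blaschke product cancels them exactly and the maximum
principle applies.\<close>

lemma blaschke_bound_simple_zeros:
  fixes U :: "nat \<Rightarrow> nat \<Rightarrow> complex" and d :: "nat \<Rightarrow> real"
  assumes PU: "\<And>i j. i < n \<Longrightarrow> j < n \<Longrightarrow> P i j = (\<Sum>l<n. complex_of_real (d l) * (U i l * cnj (U j l)))"
    and E: "E holomorphic_on ball 0 1" and \<rho>: "\<rho> < 1" and Eb: "\<And>z. cmod z < 1 \<Longrightarrow> cmod (E z) \<le> \<rho>"
    and simple: "\<forall>z. cmod z < 1 \<longrightarrow> den (E z) 1 z = 0 \<longrightarrow> deriv (\<lambda>z. den (E z) 1 z) z \<noteq> 0"
  obtains Z where "finite Z" "Z \<subseteq> ball 0 1" "card Z \<le> card {l. l < n \<and> d l < 0}"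
    "\<forall>z. cmod z < 1 \<longrightarrow> cmod (num (E z) 1 z) * (\<Prod>a\<in>Z. cmod (z - a)) \<le>
        cmod (den (E z) 1 z) * (\<Prod>a\<in>Z. cmod (1 - cnj a * z))"
proof -
  let ?k = "card {l. l < n \<and> d l < 0}"
  define D where "D = (\<lambda>z. den (E z) 1 z)"
  define N where "N = (\<lambda>z. num (E z) 1 z)"
  have hD: "D holomorphic_on ball 0 1" and hN: "N holomorphic_on ball 0 1"
    unfolding D_def N_def using holomorphic_num_den[OF E] by auto
  have Es: "E \<in> schur_class" using E Eb \<rho> by (intro schur_classI) (auto intro: order.trans less_imp_le)
  define Z where "Z = {z. cmod z < 1 \<and> D z = 0}"
  have card: "card Z' \<le> ?k" if "finite Z'" "Z' \<subseteq> Z" for Z'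
    by (rule card_zeros_le_negative_index[OF PU Es that(1)]) (use that in \<open>auto simp: Z_def D_def\<close>)
  have fin: "finite Z"
  proof (rule ccontr)
    assume "infinite Z"
    then obtain Z' where "Z' \<subseteq> Z" "finite Z'" "card Z' = Suc ?k" by (meson infinite_arbitrarily_large)
    then show False using card[of Z'] by simp
  qed
  have Zsub: "Z \<subseteq> ball 0 1" by (auto simp: Z_def)
  obtain g where g: "g holomorphic_on ball 0 1" "\<forall>z\<in>ball 0 1. D z = (\<Prod>a\<in>Z. z - a) * g z"
    using holomorphic_factor_finite_zeros[OF fin Zsub open_ball hD] by (auto simp: Z_def)
  (* a zero of g would be a zero of D of order at least two *)
  have gnz: "g z \<noteq> 0" if z: "cmod z < 1" for z
  proof
    assume g0: "g z = 0"
    then have zZ: "z \<in> Z" using g(2) z by (simp add: Z_def)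
    define p where "p = (\<lambda>z. \<Prod>a\<in>Z. z - a)"
    have pz: "p z = 0" using fin zZ by (auto simp: p_def)
    have "(p has_field_derivative deriv p z) (at z)"
      unfolding p_def by (rule holomorphic_derivI[of _ UNIV]) (auto intro!: holomorphic_intros)
    moreover have "(g has_field_derivative deriv g z) (at z)"
      by (rule holomorphic_derivI[OF g(1)]) (use z in auto)
    ultimately have "((\<lambda>x. p x * g x) has_field_derivative (deriv p z * g z + deriv g z * p z)) (at z)"
      by (rule DERIV_mult)
    then have "((\<lambda>x. p x * g x) has_field_derivative 0) (at z)" using g0 pz by simp
    moreover have "eventually (\<lambda>x. x \<in> ball 0 1) (nhds z)" by (rule eventually_nhds_in_open) (use z in auto)
    then have ev: "eventually (\<lambda>x. p x * g x = D x) (nhds z)" by eventually_elim (use g in \<open>simp add: p_def\<close>)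
    ultimately have "(D has_field_derivative 0) (at z)" using DERIV_cong_ev[OF refl ev refl] by blast
    then have "deriv D z = 0" by (rule DERIV_imp_deriv)
    then show False using simple z zZ by (auto simp: Z_def D_def)
  qed
  define S where "S = (\<lambda>z. N z / (g z * (\<Prod>a\<in>Z. 1 - cnj a * z)))"
  have prodnz: "(\<Prod>a\<in>Z. 1 - cnj a * z) \<noteq> 0" if "cmod z < 1" for z
  proof -
    have "1 - cnj a * z \<noteq> 0" if "a \<in> Z" for a
      using one_minus_cnj_mult_neq_0[of a z] that \<open>cmod z < 1\<close> by (simp add: Z_def)
    then show ?thesis using fin by simp
  qed
  have S: "S holomorphic_on ball 0 1"
    unfolding S_def using gnz prodnz by (intro holomorphic_intros hN g(1)) auto
  obtain r c where rc: "r < 1" "c > 0" and rcF: "\<forall>z e. r \<le> cmod z \<longrightarrow> cmod z \<le> 1 \<longrightarrow> cmod e \<le> \<rho> \<longrightarrow> c \<le> cmod (cleared_den z e)"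
    by (rule cleared_den_lower_bound[OF \<rho>], rule that, assumption+)
  obtain K where K: "K \<ge> 0" and KF: "\<forall>z e. cmod z \<le> 1 \<longrightarrow> cmod e \<le> 1 \<longrightarrow>
      cmod (\<Sum>i<n. \<Sum>j<n. cnj (cleared_v z e i) * P i j * cleared_v z e j) \<le> K"
    by (rule cleared_form_bounded, rule that, assumption+)
  have S1: "cmod (S z) \<le> 1" if "cmod z < 1" for z
  proof (rule maximum_principle_radial_bound[OF S _ rc(1) _ that])
    show "((\<lambda>s. sqrt (1 + (1 - s\<^sup>2) * (K / c\<^sup>2))) \<longlongrightarrow> 1) (at_left (1::real))"
      by (rule tendsto_eq_intros refl | simp)+
    fix z assume r: "r < cmod z" and z: "cmod z < 1"
    note nn = not_node[OF z]
    have e1: "cmod (E z) \<le> \<rho>" "cmod (E z) \<le> 1" using Eb[OF z] \<rho> by auto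
    have cD: "c \<le> cmod (nodal z * D z)" using rcF r z e1 by (simp add: D_def cleared_den[OF nn])
    then have D0: "D z \<noteq> 0" using rc by auto
    have "(cmod (nodal z))\<^sup>2 * ((cmod (D z))\<^sup>2 - (cmod (N z))\<^sup>2) = (cmod (nodal z))\<^sup>2 * (1 - (cmod (E z))\<^sup>2) +
       (1 - (cmod z)\<^sup>2) * ((cmod (nodal z))\<^sup>2 * Re (\<Sum>i<n. \<Sum>j<n. cnj (v (E z) 1 z i) * P i j * v (E z) 1 z j))"
      unfolding D_def N_def kernel_identity_diagonal[OF nn] by (simp add: algebra_simps)
    also have "(cmod (nodal z))\<^sup>2 * Re (\<Sum>i<n. \<Sum>j<n. cnj (v (E z) 1 z i) * P i j * v (E z) 1 z j) =
       Re (complex_of_real ((cmod (nodal z))\<^sup>2) * (\<Sum>i<n. \<Sum>j<n. cnj (v (E z) 1 z i) * P i j * v (E z) 1 z j))"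
      by simp
    also have "complex_of_real ((cmod (nodal z))\<^sup>2) * (\<Sum>i<n. \<Sum>j<n. cnj (v (E z) 1 z i) * P i j * v (E z) 1 z j) =
       (\<Sum>i<n. \<Sum>j<n. cnj (cleared_v z (E z) i) * P i j * cleared_v z (E z) j)"
      unfolding cmod_power2_complex sum_distrib_left
      by (intro sum.cong refl) (simp add: cleared_v[OF nn, symmetric] mult_ac)
    finally have id: "(cmod (nodal z))\<^sup>2 * ((cmod (D z))\<^sup>2 - (cmod (N z))\<^sup>2) = (cmod (nodal z))\<^sup>2 * (1 - (cmod (E z))\<^sup>2) +
       (1 - (cmod z)\<^sup>2) * Re (\<Sum>i<n. \<Sum>j<n. cnj (cleared_v z (E z) i) * P i j * cleared_v z (E z) j)" .
    have "cmod (\<Sum>i<n. \<Sum>j<n. cnj (cleared_v z (E z) i) * P i j * cleared_v z (E z) j) \<le> K"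
      using KF[rule_format, of z "E z"] z e1(2) by linarith
    then have "Re (\<Sum>i<n. \<Sum>j<n. cnj (cleared_v z (E z) i) * P i j * cleared_v z (E z) j) \<ge> - K"
      using abs_Re_le_cmod[of "\<Sum>i<n. \<Sum>j<n. cnj (cleared_v z (E z) i) * P i j * cleared_v z (E z) j"]
      by linarith
    moreover have z2: "1 - (cmod z)\<^sup>2 \<ge> 0" using z by (simp add: abs_square_le_1)
    ultimately have "(1 - (cmod z)\<^sup>2) * Re (\<Sum>i<n. \<Sum>j<n. cnj (cleared_v z (E z) i) * P i j * cleared_v z (E z) j) \<ge> (1 - (cmod z)\<^sup>2) * (- K)"
      by (intro mult_left_mono)
    moreover have "(cmod (nodal z))\<^sup>2 * (1 - (cmod (E z))\<^sup>2) \<ge> 0"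
      using e1 by (intro mult_nonneg_nonneg) (auto simp: abs_square_le_1)
    ultimately have "(cmod (nodal z))\<^sup>2 * ((cmod (D z))\<^sup>2 - (cmod (N z))\<^sup>2) \<ge> - ((1 - (cmod z)\<^sup>2) * K)"
      unfolding id by simp
    then have "(cmod (nodal z * N z))\<^sup>2 \<le> (cmod (nodal z * D z))\<^sup>2 + (1 - (cmod z)\<^sup>2) * K"
      by (simp add: norm_mult power_mult_distrib algebra_simps)
    also have "\<dots> \<le> (cmod (nodal z * D z))\<^sup>2 + (1 - (cmod z)\<^sup>2) * (K / c\<^sup>2) * (cmod (nodal z * D z))\<^sup>2"
    proof -
      have "c\<^sup>2 \<le> (cmod (nodal z * D z))\<^sup>2" using cD rc by (intro power_mono) auto
      then have "((1 - (cmod z)\<^sup>2) * (K / c\<^sup>2)) * c\<^sup>2 \<le> ((1 - (cmod z)\<^sup>2) * (K / c\<^sup>2)) * (cmod (nodal z * D z))\<^sup>2"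
        using z2 K by (intro mult_left_mono mult_nonneg_nonneg) auto
      then show ?thesis using rc(2) by simp
    qed
    finally have "(cmod (nodal z * N z))\<^sup>2 \<le> (1 + (1 - (cmod z)\<^sup>2) * (K / c\<^sup>2)) * (cmod (nodal z * D z))\<^sup>2"
      by (simp add: algebra_simps)
    then have "(cmod (nodal z))\<^sup>2 * (cmod (N z))\<^sup>2 \<le> (cmod (nodal z))\<^sup>2 * ((1 + (1 - (cmod z)\<^sup>2) * (K / c\<^sup>2)) * (cmod (D z))\<^sup>2)"
      by (simp add: norm_mult power_mult_distrib mult_ac)
    moreover have "(cmod (nodal z))\<^sup>2 > 0" using nodal_nonzero[OF nn] by simp
    ultimately have "(cmod (N z))\<^sup>2 \<le> (1 + (1 - (cmod z)\<^sup>2) * (K / c\<^sup>2)) * (cmod (D z))\<^sup>2"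
      by (simp only: mult_le_cancel_left_pos)
    then have "(cmod (N z / D z))\<^sup>2 \<le> 1 + (1 - (cmod z)\<^sup>2) * (K / c\<^sup>2)"
      using D0 by (simp add: norm_divide power_divide pos_divide_le_eq)
    then have ND: "cmod (N z / D z) \<le> sqrt (1 + (1 - (cmod z)\<^sup>2) * (K / c\<^sup>2))" by (rule real_le_rsqrt)
    have "S z = N z / D z * (\<Prod>a\<in>Z. blaschke_factor a z)"
      using g(2) z D0 prodnz[OF z] gnz[OF z] unfolding S_def blaschke_factor_def prod_dividef by auto
    moreover have "cmod (\<Prod>a\<in>Z. blaschke_factor a z) \<le> 1"
      unfolding prod_norm[symmetric] by (intro prod_le_1) (use blaschke_factor_less_1[of _ z] z in \<open>auto simp: Z_def less_imp_le\<close>)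
    ultimately have "cmod (S z) \<le> cmod (N z / D z)" by (simp only: norm_mult) (simp add: mult_left_le)
    then show "cmod (S z) \<le> sqrt (1 + (1 - (cmod z)\<^sup>2) * (K / c\<^sup>2))" using ND by linarith
  qed
  show ?thesis
  proof (rule that[OF fin Zsub card[OF fin order.refl]], intro allI impI)
    fix z :: complex assume z: "cmod z < 1"
    have NS: "N z = S z * (g z * (\<Prod>a\<in>Z. 1 - cnj a * z))" using gnz[OF z] prodnz[OF z] by (simp add: S_def)
    have "cmod (N z) * (\<Prod>a\<in>Z. cmod (z - a)) = cmod (S z) * (cmod (g z) * (\<Prod>a\<in>Z. cmod (1 - cnj a * z)) * (\<Prod>a\<in>Z. cmod (z - a)))"
      unfolding NS by (simp add: norm_mult prod_norm)
    also have "\<dots> \<le> 1 * (cmod (g z) * (\<Prod>a\<in>Z. cmod (1 - cnj a * z)) * (\<Prod>a\<in>Z. cmod (z - a)))"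
      by (intro mult_right_mono S1[OF z] mult_nonneg_nonneg prod_nonneg) auto
    also have "\<dots> = cmod (D z) * (\<Prod>a\<in>Z. cmod (1 - cnj a * z))"
      using g(2) z by (simp add: norm_mult prod_norm mult_ac)
    finally show "cmod (num (E z) 1 z) * (\<Prod>a\<in>Z. cmod (z - a)) \<le>
        cmod (den (E z) 1 z) * (\<Prod>a\<in>Z. cmod (1 - cnj a * z))" by (simp add: D_def N_def)
  qed
qed

text \<open>The parameters \<open>\<rho> E + \<beta>\<close> with \<open>\<rho>\<close> tending to 1 and \<open>\<beta>\<close> to 0 satisfy the hypotheses of
\<open>blaschke_bound_simple_zeros\<close>, and a subsequence of their families of zeros converges in the closed
disk. Zeros that reach the circle cancel from both sides of the limiting inequality; this is how
poles of the transform can get lost.\<close>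

lemma blaschke_bound:
  fixes U :: "nat \<Rightarrow> nat \<Rightarrow> complex" and d :: "nat \<Rightarrow> real"
  assumes PU: "\<And>i j. i < n \<Longrightarrow> j < n \<Longrightarrow> P i j = (\<Sum>l<n. complex_of_real (d l) * (U i l * cnj (U j l)))"
    and E: "E \<in> schur_class"
  defines "\<kappa> \<equiv> card {l. l < n \<and> d l < 0}"
  obtains a :: "nat \<Rightarrow> complex" where "\<forall>j<\<kappa>. cmod (a j) \<le> 1"
    "\<forall>z. cmod z < 1 \<longrightarrow> cmod (num (E z) 1 z) * (\<Prod>j<\<kappa>. cmod (z - a j)) \<le>
        cmod (den (E z) 1 z) * (\<Prod>j<\<kappa>. cmod (1 - cnj (a j) * z))"
proof -
  define \<rho> where "\<rho> = (\<lambda>k::nat. 1 - 1 / (real k + 2))"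
  have approx: "\<exists>\<beta> a. cmod \<beta> < 1 / (2 * (real k + 2)) \<and> (\<forall>j<\<kappa>. cmod (a j) \<le> 1) \<and>
    (\<forall>z. cmod z < 1 \<longrightarrow> cmod (num (complex_of_real (\<rho> k) * E z + \<beta>) 1 z) * (\<Prod>j<\<kappa>. cmod (z - a j)) \<le>
        cmod (den (complex_of_real (\<rho> k) * E z + \<beta>) 1 z) * (\<Prod>j<\<kappa>. cmod (1 - cnj (a j) * z)))" for k
  proof -
    let ?r = "complex_of_real (\<rho> k)"
    have \<rho>: "0 \<le> \<rho> k" by (simp add: \<rho>_def)
    note hE = schur_classD(1)[OF E]
    have h1: "(\<lambda>z. den (?r * E z) 1 z) holomorphic_on ball 0 1"
      by (rule holomorphic_num_den) (intro holomorphic_intros hE)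
    have h2: "(\<lambda>z. den 1 0 z) holomorphic_on ball 0 1"
      by (rule holomorphic_num_den) (intro holomorphic_intros)
    have cop: "False" if "cmod z < 1" "den (?r * E z) 1 z = 0" "den 1 0 z = 0" for z
      using den_basis_coprime[OF that(1,3)] that(2,3) num_den_affine(2)[of "?r * E z" z] by simp
    obtain \<beta> where \<beta>: "cmod \<beta> < 1 / (2 * (real k + 2))"
      "\<forall>z. cmod z < 1 \<longrightarrow> den (?r * E z) 1 z + \<beta> * den 1 0 z = 0 \<longrightarrow> deriv (\<lambda>z. den (?r * E z) 1 z + \<beta> * den 1 0 z) z \<noteq> 0"
      by (rule generic_simple_zeros[OF h1 h2, where \<epsilon> = "1 / (2 * (real k + 2))"],
          erule cop, assumption+, simp, rule that, assumption+)
    define E' where "E' = (\<lambda>z. ?r * E z + \<beta>)"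
    have den_E': "den (E' z) 1 z = den (?r * E z) 1 z + \<beta> * den 1 0 z" for z
      unfolding E'_def num_den_affine(2)[of "?r * E z + \<beta>"] num_den_affine(2)[of "?r * E z"]
      by (simp add: algebra_simps)
    have hE': "E' holomorphic_on ball 0 1" unfolding E'_def by (intro holomorphic_intros hE)
    (* the bound for beta is half of 1 - rho k, which leaves the other half as a margin *)
    define \<sigma> where "\<sigma> = 1 - 1 / (2 * (real k + 2))"
    have \<sigma>: "\<sigma> < 1" by (simp add: \<sigma>_def)
    have bE': "cmod (E' z) \<le> \<sigma>" if "cmod z < 1" for z
    proof -
      have "cmod (E' z) \<le> cmod (?r * E z) + cmod \<beta>" unfolding E'_def by (rule norm_triangle_ineq)
      also have "cmod (?r * E z) \<le> \<rho> k * 1"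
        unfolding norm_mult norm_of_real using schur_classD(2)[OF E that] \<rho> by (intro mult_mono) auto
      finally have "cmod (E' z) \<le> \<rho> k + 1 / (2 * (real k + 2))" using \<beta>(1) by simp
      also have "\<rho> k + 1 / (2 * (real k + 2)) = \<sigma>"
      proof -
        have half: "1 / (2 * (real k + 2)) = 1 / (real k + 2) / 2" by (metis divide_divide_eq_left mult.commute)
        have "1 - x + x / 2 = 1 - x / 2" for x :: real by simp
        then show ?thesis unfolding \<rho>_def \<sigma>_def half .
      qed
      finally show ?thesis .
    qed
    have sz: "\<forall>z. cmod z < 1 \<longrightarrow> den (E' z) 1 z = 0 \<longrightarrow> deriv (\<lambda>z. den (E' z) 1 z) z \<noteq> 0"
      unfolding den_E' by (rule \<beta>(2))
    obtain Z where Z: "finite Z" "Z \<subseteq> ball 0 1" "card Z \<le> \<kappa>"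
      "\<forall>z. cmod z < 1 \<longrightarrow> cmod (num (E' z) 1 z) * (\<Prod>a\<in>Z. cmod (z - a)) \<le>
        cmod (den (E' z) 1 z) * (\<Prod>a\<in>Z. cmod (1 - cnj a * z))"
      unfolding \<kappa>_def
      by (rule blaschke_bound_simple_zeros[OF _ hE' \<sigma> _ sz], rule PU, assumption+, rule bE', assumption,
          rule that[unfolded \<kappa>_def], assumption+)
    obtain a where a: "\<forall>j<\<kappa>. cmod (a j) \<le> 1"
      "\<forall>F :: complex \<Rightarrow> real. (\<Prod>j<\<kappa>. F (a j)) = (\<Prod>x\<in>Z. F x) * F 1 ^ (\<kappa> - card Z)"
      by (rule pad_finite_set[OF Z(1-3)], rule that, assumption+)
    have "cmod (num (E' z) 1 z) * (\<Prod>j<\<kappa>. cmod (z - a j)) \<le>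
        cmod (den (E' z) 1 z) * (\<Prod>j<\<kappa>. cmod (1 - cnj (a j) * z))" if z: "cmod z < 1" for z
    proof -
      have "(\<Prod>j<\<kappa>. cmod (z - a j)) = (\<Prod>x\<in>Z. cmod (z - x)) * cmod (z - 1) ^ (\<kappa> - card Z)"
        using a(2)[rule_format, of "\<lambda>x. cmod (z - x)"] .
      moreover have "(\<Prod>j<\<kappa>. cmod (1 - cnj (a j) * z)) = (\<Prod>x\<in>Z. cmod (1 - cnj x * z)) * cmod (z - 1) ^ (\<kappa> - card Z)"
        using a(2)[rule_format, of "\<lambda>x. cmod (1 - cnj x * z)"] by (simp add: norm_minus_commute)
      moreover have "(cmod (num (E' z) 1 z) * (\<Prod>x\<in>Z. cmod (z - x))) * cmod (z - 1) ^ (\<kappa> - card Z) \<le>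
         (cmod (den (E' z) 1 z) * (\<Prod>x\<in>Z. cmod (1 - cnj x * z))) * cmod (z - 1) ^ (\<kappa> - card Z)"
        using Z(4) z by (intro mult_right_mono) auto
      ultimately show ?thesis by (simp only: mult.assoc)
    qed
    then show ?thesis using \<beta>(1) a(1) unfolding E'_def by blast
  qed
  obtain \<beta> a where \<beta>: "\<And>k. cmod (\<beta> k) < 1 / (2 * (real k + 2))" and a: "\<And>k j. j < \<kappa> \<Longrightarrow> cmod (a k j) \<le> 1"
    and ineq: "\<And>k z. cmod z < 1 \<Longrightarrow> cmod (num (complex_of_real (\<rho> k) * E z + \<beta> k) 1 z) * (\<Prod>j<\<kappa>. cmod (z - a k j)) \<le>
        cmod (den (complex_of_real (\<rho> k) * E z + \<beta> k) 1 z) * (\<Prod>j<\<kappa>. cmod (1 - cnj (a k j) * z))"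
  proof -
    have "\<forall>k. \<exists>p. cmod (fst p) < 1 / (2 * (real k + 2)) \<and> (\<forall>j<\<kappa>. cmod (snd p j) \<le> 1) \<and>
    (\<forall>z. cmod z < 1 \<longrightarrow> cmod (num (complex_of_real (\<rho> k) * E z + fst p) 1 z) * (\<Prod>j<\<kappa>. cmod (z - snd p j)) \<le>
        cmod (den (complex_of_real (\<rho> k) * E z + fst p) 1 z) * (\<Prod>j<\<kappa>. cmod (1 - cnj (snd p j) * z)))"
      using approx by simp
    from choice[OF this] obtain p where "\<forall>k. cmod (fst (p k)) < 1 / (2 * (real k + 2)) \<and> (\<forall>j<\<kappa>. cmod (snd (p k) j) \<le> 1) \<and>
    (\<forall>z. cmod z < 1 \<longrightarrow> cmod (num (complex_of_real (\<rho> k) * E z + fst (p k)) 1 z) * (\<Prod>j<\<kappa>. cmod (z - snd (p k) j)) \<le>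
        cmod (den (complex_of_real (\<rho> k) * E z + fst (p k)) 1 z) * (\<Prod>j<\<kappa>. cmod (1 - cnj (snd (p k) j) * z)))" by blast
    then show ?thesis by (intro that[of "\<lambda>k. fst (p k)" "\<lambda>k. snd (p k)"]) blast+
  qed
  have c: "countable {..<\<kappa>}" by simp
  obtain k :: "nat \<Rightarrow> nat" where k: "strict_mono k" "\<And>j. j \<in> {..<\<kappa>} \<Longrightarrow> \<exists>l. (\<lambda>m. a (k m) j) \<longlonglongrightarrow> l"
    using function_convergent_subsequence[OF c, of a 1] a by (metis lessThan_iff)
  define l where "l = (\<lambda>j. lim (\<lambda>m. a (k m) j))"
  have l: "(\<lambda>m. a (k m) j) \<longlonglongrightarrow> l j" if "j < \<kappa>" for j
    using k(2)[of j] that unfolding l_def by (simp add: convergent_def convergent_LIMSEQ_iff[symmetric])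
  have rlim: "(\<lambda>m. complex_of_real (\<rho> (k m))) \<longlonglongrightarrow> 1"
  proof -
    have "\<rho> \<longlonglongrightarrow> 1" unfolding \<rho>_def by real_asymp
    then have "(\<lambda>m. \<rho> (k m)) \<longlonglongrightarrow> 1" using LIMSEQ_subseq_LIMSEQ[OF _ k(1)] by (fastforce simp: comp_def)
    from tendsto_of_real[OF this, where 'a = complex] show ?thesis by simp
  qed
  have blim: "(\<lambda>m. \<beta> (k m)) \<longlonglongrightarrow> 0"
  proof -
    have "(\<lambda>m. 1 / (2 * (real m + 2))) \<longlonglongrightarrow> 0" by real_asymp
    then have "\<beta> \<longlonglongrightarrow> 0"
      by (rule Lim_null_comparison[rotated]) (intro always_eventually allI less_imp_le \<beta>)
    then show ?thesis using LIMSEQ_subseq_LIMSEQ[OF _ k(1)] by (fastforce simp: comp_def)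
  qed
  show ?thesis
  proof (rule that[of l], safe)
    fix j assume j: "j < \<kappa>"
    show "cmod (l j) \<le> 1"
      by (rule Lim_norm_ubound[OF sequentially_bot l[OF j]]) (simp add: a j)
  next
    fix z :: complex assume z: "cmod z < 1"
    have "(\<lambda>m. complex_of_real (\<rho> (k m)) * E z + \<beta> (k m)) \<longlonglongrightarrow> 1 * E z + 0"
      by (intro tendsto_intros rlim blim)
    then have e: "(\<lambda>m. complex_of_real (\<rho> (k m)) * E z + \<beta> (k m)) \<longlonglongrightarrow> E z" by simp
    show "cmod (num (E z) 1 z) * (\<Prod>j<\<kappa>. cmod (z - l j)) \<le> cmod (den (E z) 1 z) * (\<Prod>j<\<kappa>. cmod (1 - cnj (l j) * z))"
    proof (rule tendsto_le[OF sequentially_bot])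
      show "(\<lambda>m. cmod (num (complex_of_real (\<rho> (k m)) * E z + \<beta> (k m)) 1 z) * (\<Prod>j<\<kappa>. cmod (z - a (k m) j))) \<longlonglongrightarrow>
        cmod (num (E z) 1 z) * (\<Prod>j<\<kappa>. cmod (z - l j))"
        unfolding num_den_affine(1)[of "_ + _"] num_den_affine(1)[of "E z"] by (intro tendsto_intros e l) auto
      show "(\<lambda>m. cmod (den (complex_of_real (\<rho> (k m)) * E z + \<beta> (k m)) 1 z) * (\<Prod>j<\<kappa>. cmod (1 - cnj (a (k m) j) * z))) \<longlonglongrightarrow>
        cmod (den (E z) 1 z) * (\<Prod>j<\<kappa>. cmod (1 - cnj (l j) * z))"
        unfolding num_den_affine(2)[of "_ + _"] num_den_affine(2)[of "E z"] by (intro tendsto_intros e l) auto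
    qed (intro always_eventually allI ineq z)
  qed
qed

end

text \<open>Choose a multiset \<open>A\<close> of least size whose Blaschke product \<open>B\<close> satisfies \<open>\<bar>N B\<bar> \<le> \<bar>D\<bar>\<close>. Every zero of
\<open>D\<close> is a zero of \<open>B\<close>, so \<open>N B / D\<close> extends to a Schur function \<open>S\<close>. A common zero of \<open>S\<close> and \<open>B\<close>
could be divided out of both by Schwarz's lemma, against the minimality of \<open>A\<close>.\<close>

lemma gen_schur_of_blaschke_bound:
  assumes N: "N holomorphic_on ball 0 1" and D: "D holomorphic_on ball 0 1"
    and coprime: "\<And>z. cmod z < 1 \<Longrightarrow> N z = 0 \<Longrightarrow> D z = 0 \<Longrightarrow> False"
    and a: "\<forall>j<\<kappa>. cmod (a j) \<le> 1"
    and bound: "\<forall>z. cmod z < 1 \<longrightarrow> cmod (N z) * (\<Prod>j<\<kappa>. cmod (z - a j)) \<le> cmod (D z) * (\<Prod>j<\<kappa>. cmod (1 - cnj (a j) * z))"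
  obtains k where "k \<le> \<kappa>" "\<forall>f. (\<forall>z. cmod z < 1 \<longrightarrow> D z \<noteq> 0 \<longrightarrow> f z = N z / D z) \<longrightarrow> f \<in> gen_schur_class k"
proof -
  define ok where "ok = (\<lambda>A. (\<forall>x. x \<in># A \<longrightarrow> cmod x < 1) \<and>
    (\<forall>z. cmod z < 1 \<longrightarrow> cmod (N z * (\<Prod>x\<in>#A. blaschke_factor x z)) \<le> cmod (D z)))"
  (* the factors on the circle have equal moduli on both sides and cancel *)
  define J where "J = {j. j < \<kappa> \<and> cmod (a j) < 1}"
  define A0 where "A0 = image_mset a (mset_set J)"
  have finJ: "finite J" by (simp add: J_def)
  have "size A0 \<le> \<kappa>" using card_mono[of "{..<\<kappa>}" J] by (auto simp: A0_def J_def)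
  moreover have "ok A0"
    unfolding ok_def
  proof (intro conjI allI impI)
    fix x assume "x \<in># A0" then show "cmod x < 1" using finJ by (auto simp: A0_def J_def)
  next
    fix z :: complex assume z: "cmod z < 1"
    have split: "(\<Prod>j<\<kappa>. F (a j)) = (\<Prod>j\<in>J. F (a j)) * (\<Prod>j\<in>{..<\<kappa>} - J. F (a j))" for F :: "complex \<Rightarrow> real"
      using prod.subset_diff[of J "{..<\<kappa>}" "\<lambda>j. F (a j)"] by (simp add: J_def subset_iff mult.commute)
    have rest: "(\<Prod>j\<in>{..<\<kappa>} - J. cmod (z - a j)) = (\<Prod>j\<in>{..<\<kappa>} - J. cmod (1 - cnj (a j) * z))"
    proof (rule prod.cong[OF refl])
      fix j assume "j \<in> {..<\<kappa>} - J"
      then have aj: "cmod (a j) = 1" using a by (force simp: J_def)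
      then have "cnj (a j) * a j = 1" using cmod_power2_complex[of "a j"] by (simp add: mult.commute)
      then have "1 - cnj (a j) * z = cnj (a j) * (a j - z)" by (simp add: algebra_simps)
      then show "cmod (z - a j) = cmod (1 - cnj (a j) * z)" using aj by (simp add: norm_mult norm_minus_commute)
    qed
    have nz: "1 - cnj (a j) * z \<noteq> 0" if "j < \<kappa>" for j
      using one_minus_cnj_mult_neq_0[of "a j" z] a that z by simp
    define R where "R = (\<Prod>j\<in>{..<\<kappa>} - J. cmod (1 - cnj (a j) * z))"
    define T where "T = (\<Prod>j\<in>J. cmod (1 - cnj (a j) * z))"
    have R: "R > 0" unfolding R_def by (rule prod_pos) (use nz in auto)
    have T: "T > 0" unfolding T_def by (rule prod_pos) (use nz in \<open>auto simp: J_def\<close>)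
    have "cmod (N z) * ((\<Prod>j\<in>J. cmod (z - a j)) * R) \<le> cmod (D z) * (T * R)"
      using bound[rule_format, OF z] unfolding split[of "\<lambda>x. cmod (z - x)"] split[of "\<lambda>x. cmod (1 - cnj x * z)"] rest
      by (simp add: R_def T_def)
    then have "(cmod (N z) * (\<Prod>j\<in>J. cmod (z - a j))) * R \<le> (cmod (D z) * T) * R" by (simp add: mult_ac)
    then have "cmod (N z) * (\<Prod>j\<in>J. cmod (z - a j)) \<le> cmod (D z) * T" using R by simp
    then have "cmod (N z) * (\<Prod>j\<in>J. cmod (z - a j)) / T \<le> cmod (D z)" using T by (simp add: pos_divide_le_eq)
    moreover have "cmod (N z * (\<Prod>x\<in>#A0. blaschke_factor x z)) = cmod (N z) * (\<Prod>j\<in>J. cmod (z - a j)) / T"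
    proof -
      have "(\<Prod>x\<in>#A0. blaschke_factor x z) = (\<Prod>j\<in>J. blaschke_factor (a j) z)"
        by (simp add: A0_def image_mset.compositionality comp_def prod_unfold_prod_mset)
      also have "cmod \<dots> = (\<Prod>j\<in>J. cmod (z - a j)) / T"
        by (simp add: prod_norm[symmetric] blaschke_factor_def norm_divide prod_dividef T_def)
      finally show ?thesis by (simp add: norm_mult)
    qed
    ultimately show "cmod (N z * (\<Prod>x\<in>#A0. blaschke_factor x z)) \<le> cmod (D z)" by simp
  qed
  ultimately obtain A where A: "ok A" "\<And>A'. ok A' \<Longrightarrow> size A \<le> size A'" "size A \<le> \<kappa>"
    using ex_has_least_nat[of ok A0 size] by (metis order_trans)
  have A1: "cmod x < 1" if "x \<in># A" for x using A(1) that by (simp add: ok_def)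
  define B where "B = (\<lambda>z. \<Prod>x\<in>#A. blaschke_factor x z)"
  have NBD: "cmod (N z * B z) \<le> cmod (D z)" if "cmod z < 1" for z using A(1) that by (simp add: ok_def B_def)
  have Bs: "B \<in> schur_class" using finite_blaschke_extends_to_circle(3)[of A 1 1] A1 by (simp add: B_def)
  have BA: "z \<in># A" if "B z = 0" "cmod z < 1" for z
  proof -
    have "0 \<in># image_mset (\<lambda>x. blaschke_factor x z) A"
      using that(1) unfolding B_def prod_mset_zero_iff .
    then obtain x where x: "x \<in># A" "0 = blaschke_factor x z" by (metis in_image_mset imageE)
    then have "z = x" using one_minus_cnj_mult_neq_0[of x z] A1[OF x(1)] that(2) by (auto simp: blaschke_factor_def)
    then show ?thesis using x by simp
  qed
  have DB: "B z = 0" if "D z = 0" "cmod z < 1" for z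
    using NBD[OF that(2)] that coprime[OF that(2)] by auto
  define S0 where "S0 = (\<lambda>z. N z * B z / D z)"
  have hol: "S0 holomorphic_on ball 0 1 - set_mset A"
    unfolding S0_def using DB BA
    by (intro holomorphic_intros holomorphic_on_subset[OF N] holomorphic_on_subset[OF D] holomorphic_on_subset[OF schur_classD(1)[OF Bs]]) auto
  have S0b: "cmod (S0 z) \<le> 1" if "cmod z < 1" for z
    using NBD[OF that] by (cases "D z = 0") (auto simp: S0_def norm_divide)
  have evb: "eventually (\<lambda>z. cmod (S0 z) \<le> 1) (at x)" if "cmod x < 1" for x
  proof -
    have "eventually (\<lambda>z. z \<in> ball 0 1) (nhds x)" by (rule eventually_nhds_in_open) (use that in auto)
    then have "eventually (\<lambda>z. z \<in> ball 0 1) (at x)" by (auto simp: eventually_at_filter elim: eventually_mono)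
    then show ?thesis by eventually_elim (use S0b in auto)
  qed
  obtain S where S: "S holomorphic_on ball 0 1" "\<forall>z\<in>ball 0 1 - set_mset A. S z = S0 z"
    using removable_finite_set[OF finite_set_mset open_ball hol] evb by auto
  (* inequalities and identities between continuous functions extend across the finite set A *)
  have limit_closed: "P x" if x: "cmod x < 1" and P: "\<And>z. cmod z < 1 \<Longrightarrow> z \<notin> set_mset A \<Longrightarrow> P z" 
    and cl: "eventually P (at x) \<Longrightarrow> P x" for P x
  proof -
    have "eventually (\<lambda>z. z \<in> ball 0 1 - (set_mset A - {x})) (nhds x)"
      by (rule eventually_nhds_in_open) (use x in \<open>auto intro!: open_Diff finite_imp_closed\<close>)
    then have "eventually P (at x)" unfolding eventually_at_filter
      by eventually_elim (use P in auto)
    then show "P x" by (rule cl)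
  qed
  have tends: "(f \<longlongrightarrow> f x) (at x)" if "f holomorphic_on ball 0 1" "cmod x < 1" for f x
    using that by (metis at_within_open centre_in_ball continuous_on holomorphic_on_imp_continuous_on mem_ball_0 open_ball)
  have Seq: "S z * D z = N z * B z" if z: "cmod z < 1" for z
  proof (rule limit_closed[OF z])
    fix z assume z: "cmod z < 1" "z \<notin> set_mset A"
    then have "D z \<noteq> 0" using DB BA by blast
    then show "S z * D z = N z * B z" using S(2) z by (simp add: S0_def)
  next
    assume ev: "eventually (\<lambda>z. S z * D z = N z * B z) (at z)"
    have "((\<lambda>z. S z * D z) \<longlongrightarrow> S z * D z) (at z)" "((\<lambda>z. N z * B z) \<longlongrightarrow> N z * B z) (at z)"
      by (rule tends; intro holomorphic_intros S N D schur_classD[OF Bs] z)+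
    then show "S z * D z = N z * B z"
      using Lim_transform_eventually[OF _ ev] tendsto_unique[OF at_neq_bot] by blast
  qed
  have Sb: "cmod (S z) \<le> 1" if z: "cmod z < 1" for z
  proof (rule limit_closed[OF z])
    fix z assume z: "cmod z < 1" "z \<notin> set_mset A"
    then show "cmod (S z) \<le> 1" using S(2) S0b[OF z(1)] by simp
  next
    assume "eventually (\<lambda>z. cmod (S z) \<le> 1) (at z)"
    then show "cmod (S z) \<le> 1" by (rule Lim_norm_ubound[OF at_neq_bot tends[OF S(1) z]])
  qed
  have Ss: "S \<in> schur_class" using S(1) Sb by (rule schur_classI)
  have coprimeSB: "\<not> (S x = 0 \<and> B x = 0)" if x: "cmod x < 1" for x
  proof
    assume 0: "S x = 0 \<and> B x = 0"
    then have xA: "x \<in># A" using BA x by blast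
    obtain S1 where S1: "S1 \<in> schur_class" "\<And>z. cmod z < 1 \<Longrightarrow> S z = blaschke_factor x z * S1 z"
      using schur_class_divide_blaschke_factor[OF Ss x] 0 by metis
    define A' where "A' = A - {#x#}"
    have AA': "A = add_mset x A'" using xA by (simp add: A'_def)
    define B' where "B' = (\<lambda>z. \<Prod>x\<in>#A'. blaschke_factor x z)"
    have BB': "B z = blaschke_factor x z * B' z" for z by (simp add: B_def B'_def AA')
    have B's: "B' \<in> schur_class" using finite_blaschke_extends_to_circle(3)[of A' 1 1] A1 by (simp add: B'_def AA')
    have "cmod (N z * B' z) \<le> cmod (D z)" if z: "cmod z < 1" for z
    proof (rule limit_closed[OF z])
      fix z assume z: "cmod z < 1" "z \<notin> set_mset A"
      then have "z \<noteq> x" using xA by auto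
      then have b: "blaschke_factor x z \<noteq> 0"
        using one_minus_cnj_mult_neq_0[of x z] x z by (simp add: blaschke_factor_def)
      have "blaschke_factor x z * (S1 z * D z) = blaschke_factor x z * (N z * B' z)"
        using Seq[OF z(1)] S1(2)[OF z(1)] BB'[of z] by (simp add: mult_ac)
      then have "N z * B' z = S1 z * D z" using b by simp
      then show "cmod (N z * B' z) \<le> cmod (D z)"
        using schur_classD(2)[OF S1(1) z(1)] by (simp add: norm_mult mult_left_le_one_le)
    next
      assume "eventually (\<lambda>z. cmod (N z * B' z) \<le> cmod (D z)) (at z)"
      moreover have "((\<lambda>z. cmod (N z * B' z)) \<longlongrightarrow> cmod (N z * B' z)) (at z)" "((\<lambda>z. cmod (D z)) \<longlongrightarrow> cmod (D z)) (at z)"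
        by (intro tendsto_intros tends[OF N z] tends[OF D z] tends[OF schur_classD(1)[OF B's] z])+
      ultimately show "cmod (N z * B' z) \<le> cmod (D z)" using tendsto_le[OF at_neq_bot] by blast
    qed
    then have "ok A'" using A1 by (auto simp: ok_def B'_def AA')
    from A(2)[OF this] show False by (simp add: AA')
  qed
  show ?thesis
  proof (rule that[OF A(3)], intro allI impI)
    fix f assume f: "\<forall>z. cmod z < 1 \<longrightarrow> D z \<noteq> 0 \<longrightarrow> f z = N z / D z"
    have "B \<in> finite_blaschke (size A)"
      unfolding finite_blaschke_def B_def blaschke_factor_def
      using A1 by (intro CollectI exI[of _ 1] exI[of _ A]) (auto simp: subset_iff)
    moreover have "f z = S z / B z" if z: "cmod z < 1" "B z \<noteq> 0" for z
    proof -
      have "D z \<noteq> 0" using DB z by blast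
      moreover from this have "f z = N z / D z" using f z(1) by blast
      moreover have "N z / D z = S z / B z"
        using Seq[OF z(1)] \<open>D z \<noteq> 0\<close> z(2) by (simp add: frac_eq_eq)
      ultimately show ?thesis by simp
    qed
    ultimately show "f \<in> gen_schur_class (size A)"
      unfolding gen_schur_class_def using Ss coprimeSB by (intro CollectI bexI[of _ S] bexI[of _ B]) auto
  qed
qed

section \<open>Boundary behaviour at the nodes\<close>

lemma one_minus_cmod_le:
  assumes "cmod \<eta> = 1" "cmod e \<le> 1"
  shows "1 - (cmod e)\<^sup>2 \<le> 2 * cmod (e - \<eta>)"
proof -
  have "1 - cmod e \<le> cmod (e - \<eta>)"
    using norm_triangle_ineq2[of \<eta> e] assms(1) by (simp add: norm_minus_commute)
  then have "(1 - cmod e) * (1 + cmod e) \<le> cmod (e - \<eta>) * 2"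
    using assms by (intro mult_mono) auto
  then show ?thesis by (simp add: power2_eq_square algebra_simps)
qed

lemma stolz_region_bound:
  assumes "z \<in> stolz_region a s" "a > 1"
  shows "cmod (z - s) \<le> a * (1 - (cmod z)\<^sup>2)"
proof -
  have z: "cmod z < 1" and st: "cmod (z - s) < a * (1 - cmod z)" using assms by (auto simp: stolz_region_def)
  have "1 - cmod z \<le> 1 - (cmod z)\<^sup>2" using z by (simp add: power2_eq_square mult_left_le)
  then have "a * (1 - cmod z) \<le> a * (1 - (cmod z)\<^sup>2)" using assms(2) by (intro mult_left_mono) auto
  then show ?thesis using st by linarith
qed

text \<open>The counterpart for filters of passing to a subsequence.\<close>

lemma frequently_subfilter:
  assumes "\<not> eventually (\<lambda>z. \<not> P z) F"
  obtains G where "G \<noteq> bot" "G \<le> F" "eventually P G"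
proof (rule that)
  show "inf F (principal {z. P z}) \<noteq> bot"
    using assms by (simp add: trivial_limit_def eventually_inf_principal)
  show "inf F (principal {z. P z}) \<le> F" by simp
  show "eventually P (inf F (principal {z. P z}))" by (simp add: eventually_inf_principal)
qed

text \<open>If the boundary value is not \<open>\<eta>\<close>, the numerator stays away from 0 along some filter. If \<open>d\<^sub>E\<close> is
infinite, then \<open>1 - \<bar>E\<bar>\<^sup>2 \<le> 2 \<bar>E - \<eta>\<bar>\<close>, and \<open>1 - \<bar>z\<bar>\<^sup>2\<close> is comparable to \<open>\<bar>z - s\<bar>\<close> from below in a Stolz
region.\<close>

lemma approach_rate_unbounded:
  assumes E: "E \<in> schur_class" and \<eta>: "cmod \<eta> = 1" and s: "cmod s = 1"
    and C: "\<not> has_boundary_value E s \<eta> \<or> has_boundary_d E s \<infinity>"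
  obtains a F where "a > 1" "F \<noteq> bot" "F \<le> at s within stolz_region a s"
    "filterlim (\<lambda>z. cmod (E z - \<eta>) / cmod (z - s)) at_top F"
  using C
proof
  assume "\<not> has_boundary_value E s \<eta>"
  then obtain a where a: "a > 1" "\<not> (E \<longlongrightarrow> \<eta>) (at s within stolz_region a s)"
    unfolding has_boundary_value_def tendsto_nt_at_iff by blast
  then obtain e where e: "e > 0" "\<not> eventually (\<lambda>z. dist (E z) \<eta> < e) (at s within stolz_region a s)"
    unfolding tendsto_iff by blast
  then have "\<not> eventually (\<lambda>z. \<not> e \<le> cmod (E z - \<eta>)) (at s within stolz_region a s)"
    by (simp add: dist_norm not_le)
  then obtain G where G: "G \<noteq> bot" "G \<le> at s within stolz_region a s" "eventually (\<lambda>z. e \<le> cmod (E z - \<eta>)) G"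
    by (rule frequently_subfilter)
  have "filterlim (\<lambda>z. z - s) (at 0) (at s within stolz_region a s)"
    by (rule filterlim_at_withinI[where A = UNIV, simplified])
       (auto intro!: tendsto_eq_intros simp: eventually_at_filter)
  then have "filterlim (\<lambda>z. z - s) (at 0) G" using G(2) by (rule filterlim_mono[OF _ order.refl])
  then have "filterlim (\<lambda>z. inverse (z - s)) at_infinity G"
    by (rule filterlim_compose[OF filterlim_inverse_at_infinity])
  then have "filterlim (\<lambda>z. cmod (inverse (z - s))) at_top G"
    by (rule filterlim_at_infinity_imp_norm_at_top)
  then have "filterlim (\<lambda>z. e * cmod (inverse (z - s))) at_top G"
    by (intro filterlim_tendsto_pos_mult_at_top[OF tendsto_const e(1)])
  moreover have "eventually (\<lambda>z. e * cmod (inverse (z - s)) \<le> cmod (E z - \<eta>) / cmod (z - s)) G"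
    using G(3) by eventually_elim (simp add: norm_inverse divide_inverse mult_right_mono)
  ultimately have "filterlim (\<lambda>z. cmod (E z - \<eta>) / cmod (z - s)) at_top G"
    by (rule filterlim_at_top_mono)
  with a(1) G(1,2) show ?thesis by (rule that)
next
  assume d: "has_boundary_d E s \<infinity>"
  let ?F = "at s within stolz_region 2 s"
  have "((\<lambda>z. ereal ((1 - (cmod (E z))\<^sup>2) / (1 - (cmod z)\<^sup>2))) \<longlongrightarrow> \<infinity>) ?F"
    using d unfolding has_boundary_d_def by (rule tendsto_nt_at_stolz) auto
  then have "filterlim (modulus_quotient E) at_top ?F"
    by (simp add: tendsto_PInfty_eq_at_top)
  then have "filterlim (\<lambda>z. 1 / 4 * ((1 - (cmod (E z))\<^sup>2) / (1 - (cmod z)\<^sup>2))) at_top ?F"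
    by (intro filterlim_tendsto_pos_mult_at_top[OF tendsto_const]) auto
  moreover have "eventually (\<lambda>z. 1 / 4 * ((1 - (cmod (E z))\<^sup>2) / (1 - (cmod z)\<^sup>2)) \<le> cmod (E z - \<eta>) / cmod (z - s)) ?F"
    using eventually_stolz_region(1)[OF s order.refl]
  proof eventually_elim
    case (elim z)
    then have z: "cmod z < 1" by (simp add: stolz_region_def)
    then have zs: "cmod (z - s) > 0" using s by auto
    have pos: "1 - (cmod z)\<^sup>2 > 0" using z by (simp add: abs_square_less_1)
    have "(1 - (cmod (E z))\<^sup>2) * cmod (z - s) \<le> (2 * cmod (E z - \<eta>)) * (2 * (1 - (cmod z)\<^sup>2))"
      using one_minus_cmod_le[OF \<eta> schur_classD(2)[OF E z]] stolz_region_bound[OF elim]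
      by (intro mult_mono) auto
    then show ?case using pos zs by (simp add: field_simps)
  qed
  ultimately have "filterlim (\<lambda>z. cmod (E z - \<eta>) / cmod (z - s)) at_top ?F"
    by (rule filterlim_at_top_mono)
  then show ?thesis using at_within_stolz_region_nontrivial[OF s, of 2] by (intro that[of 2 ?F]) auto
qed

text \<open>If \<open>d\<^sub>E\<close> is not infinite, it is bounded along some nontangential filter, so Julia's inequality holds in
the whole disk. In a Stolz region it bounds \<open>\<bar>E - \<eta>\<bar>\<^sup>2\<close> by a multiple of \<open>\<bar>E - \<eta>\<bar> \<bar>z - s\<bar>\<close>.\<close>

lemma approach_rate_bounded:
  assumes E: "E \<in> schur_class" and \<eta>: "cmod \<eta> = 1" and s: "cmod s = 1"
    and v: "has_boundary_value E s \<eta>" and d: "\<not> has_boundary_d E s \<infinity>"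
  obtains C where "C \<ge> 0" "\<forall>z\<in>stolz_region 2 s. cmod (E z - \<eta>) \<le> C * cmod (z - s)"
proof -
  obtain a where a: "a > 1" "\<not> ((\<lambda>z. ereal ((1 - (cmod (E z))\<^sup>2) / (1 - (cmod z)\<^sup>2))) \<longlongrightarrow> \<infinity>) (at s within stolz_region a s)"
    using d unfolding has_boundary_d_def tendsto_nt_at_iff by blast
  then obtain r where r: "\<not> eventually (\<lambda>z. \<not> (1 - (cmod (E z))\<^sup>2) / (1 - (cmod z)\<^sup>2) \<le> r) (at s within stolz_region a s)"
    by (auto simp: tendsto_PInfty not_le)
  obtain G where G: "G \<noteq> bot" "G \<le> at s within stolz_region a s" "eventually (\<lambda>z. (1 - (cmod (E z))\<^sup>2) / (1 - (cmod z)\<^sup>2) \<le> r) G"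
    using r by (rule frequently_subfilter)
  note ev = eventually_stolz_region[OF s G(2)]
  define \<alpha> where "\<alpha> = max r 0"
  have bound: "eventually (\<lambda>z. 1 - (cmod (E z))\<^sup>2 \<le> \<alpha> * (1 - (cmod z)\<^sup>2)) G"
    using G(3) ev(2)
  proof eventually_elim
    case (elim z)
    then have pos: "1 - (cmod z)\<^sup>2 > 0" by (simp add: abs_square_less_1)
    then have "1 - (cmod (E z))\<^sup>2 \<le> r * (1 - (cmod z)\<^sup>2)" using elim by (simp add: pos_divide_le_eq)
    also have "\<dots> \<le> \<alpha> * (1 - (cmod z)\<^sup>2)" using pos by (intro mult_right_mono) (auto simp: \<alpha>_def)
    finally show ?case .
  qed
  have lim: "(E \<longlongrightarrow> \<eta>) G"
    using v unfolding has_boundary_value_def by (rule tendsto_nt_at_stolz[OF _ a(1) G(2)])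
  have \<eta>\<eta>: "cnj \<eta> * \<eta> = 1" and ss: "cnj s * s = 1"
    using \<eta> s cmod_power2_complex[of \<eta>] cmod_power2_complex[of s] by (auto simp: mult.commute)
  have "cmod (E z - \<eta>) \<le> (4 * \<alpha>) * cmod (z - s)" if z: "z \<in> stolz_region 2 s" for z
  proof -
    have z1: "cmod z < 1" using z by (simp add: stolz_region_def)
    have zs: "cmod (z - s) > 0" using z1 s by auto
    have "1 - cnj \<eta> * E z = cnj \<eta> * (\<eta> - E z)" using \<eta>\<eta> by (simp add: algebra_simps)
    then have 1: "cmod (1 - cnj \<eta> * E z) = cmod (E z - \<eta>)" using \<eta> by (simp add: norm_mult norm_minus_commute)
    have "1 - cnj s * z = cnj s * (s - z)" using ss by (simp add: algebra_simps)
    then have 2: "cmod (1 - cnj s * z) = cmod (z - s)" using s by (simp add: norm_mult norm_minus_commute)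
    define X where "X = cmod (E z - \<eta>)"
    define Y where "Y = cmod (z - s)"
    have julia: "X\<^sup>2 * (1 - (cmod z)\<^sup>2) \<le> \<alpha> * (1 - (cmod (E z))\<^sup>2) * Y\<^sup>2"
      using julia_lemma[OF E G(1) ev(2,3) lim bound z1] unfolding 1 2 X_def Y_def .
    have "X\<^sup>2 * Y \<le> X\<^sup>2 * (2 * (1 - (cmod z)\<^sup>2))"
      using stolz_region_bound[OF z] unfolding Y_def by (intro mult_left_mono) auto
    also have "\<dots> = 2 * (X\<^sup>2 * (1 - (cmod z)\<^sup>2))" by simp
    also have "\<dots> \<le> 2 * (\<alpha> * (1 - (cmod (E z))\<^sup>2) * Y\<^sup>2)" using julia by (rule mult_left_mono) simp
    also have "\<dots> \<le> 2 * (\<alpha> * (2 * X) * Y\<^sup>2)"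
      unfolding X_def using one_minus_cmod_le[OF \<eta> schur_classD(2)[OF E z1]]
      by (intro mult_left_mono mult_right_mono) (auto simp: \<alpha>_def)
    finally have "(X * Y) * X \<le> (X * Y) * (4 * \<alpha> * Y)" by (simp add: power2_eq_square mult_ac)
    moreover have "X \<ge> 0" "Y > 0" using zs by (auto simp: X_def Y_def)
    ultimately have "X \<le> 4 * \<alpha> * Y"
      by (cases "X = 0") (auto simp: \<alpha>_def mult_le_cancel_left_pos)
    then show ?thesis by (simp add: X_def Y_def)
  qed
  then show ?thesis by (intro that[of "4 * \<alpha>"]) (auto simp: \<alpha>_def)
qed

context interpolation_data
begin

lemma y_off_node_bounded:
  assumes E: "E \<in> schur_class" and i: "i < n" and j: "j < n" "j \<noteq> i" and F: "F \<le> at (t i) within stolz_region a (t i)"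
  shows "eventually (\<lambda>z. cmod (y (E z) 1 z j) \<le> (cmod (p0 j) + cmod (p1 j)) / cmod (z - t j)) F"
    "((\<lambda>z. (cmod (p0 j) + cmod (p1 j)) / cmod (z - t j)) \<longlongrightarrow> (cmod (p0 j) + cmod (p1 j)) / cmod (t i - t j)) F"
proof -
  note ev = eventually_stolz_region[OF t_unimodular[OF i] F]
  show "eventually (\<lambda>z. cmod (y (E z) 1 z j) \<le> (cmod (p0 j) + cmod (p1 j)) / cmod (z - t j)) F"
    using ev(2)
  proof eventually_elim
    case (elim z)
    have "cmod (p0 j * E z + p1 j * 1) \<le> cmod (p0 j) * cmod (E z) + cmod (p1 j)"
      using norm_triangle_ineq[of "p0 j * E z" "p1 j"] by (simp add: norm_mult)
    also have "\<dots> \<le> cmod (p0 j) + cmod (p1 j)"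
      using schur_classD(2)[OF E elim] by (simp add: mult_left_le)
    finally show ?case unfolding y_def norm_divide by (rule divide_right_mono) simp
  qed
  have "t i \<noteq> t j" using t_inj i j by (auto simp: inj_on_def)
  then show "((\<lambda>z. (cmod (p0 j) + cmod (p1 j)) / cmod (z - t j)) \<longlongrightarrow> (cmod (p0 j) + cmod (p1 j)) / cmod (t i - t j)) F"
    by (intro tendsto_intros ev(3)) auto
qed

text \<open>The component \<open>y i\<close> tends to infinity while the others stay bounded, so after division by \<open>y i\<close> the
denominator tends to \<open>t i - \<mu>\<close> and \<open>v / den\<close> to minus the \<open>i\<close>-th unit vector. By \<open>node_residual\<close> the
quotient tends to \<open>P i i\<close>.\<close>

lemma quotient_limit_of_unbounded_rate:
  assumes E: "E \<in> schur_class" and i: "i < n" and F: "F \<le> at (t i) within stolz_region a (t i)"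
    and rate: "filterlim (\<lambda>z. cmod (E z - \<eta> i) / cmod (z - t i)) at_top F"
    and f: "\<And>z. cmod z < 1 \<Longrightarrow> f z = num (E z) 1 z / den (E z) 1 z"
  shows "(boundary_quotient f (w i) (t i) \<longlongrightarrow> complex_of_real (\<gamma> i)) F"
proof -
  note ev = eventually_stolz_region[OF t_unimodular[OF i] F]
  define Y where "Y = (\<lambda>j z. y (E z) 1 z j)"
  define D where "D = (\<lambda>z. den (E z) 1 z)"
  have "filterlim (\<lambda>z. cmod (p0 i) * (cmod (E z - \<eta> i) / cmod (z - t i))) at_top F"
    using p_modulus(2)[OF i] by (intro filterlim_tendsto_pos_mult_at_top[OF tendsto_const _ rate]) auto
  then have "filterlim (\<lambda>z. cmod (Y i z)) at_top F"
    by (simp add: Y_def y_at_node[OF i] norm_divide norm_mult)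
  then have Yinf: "filterlim (Y i) at_infinity F" by (rule filterlim_norm_at_top_imp_at_infinity)
  have Yinv: "((\<lambda>z. inverse (Y i z)) \<longlongrightarrow> 0) F"
    using Yinf by (rule filterlim_compose[OF tendsto_inverse_0])
  have Yne: "eventually (\<lambda>z. Y i z \<noteq> 0) F"
    using Yinf by (rule filterlim_at_infinity_imp_eventually_ne)
  have ratio: "((\<lambda>z. Y j z * inverse (Y i z)) \<longlongrightarrow> (if j = i then 1 else 0)) F" if j: "j < n" for j
  proof (cases "j = i")
    case True
    have "((\<lambda>z. Y j z * inverse (Y i z)) \<longlongrightarrow> 1) F"
      by (rule tendsto_eventually, rule eventually_mono[OF Yne]) (simp add: True)
    then show ?thesis using True by simp
  next
    case False
    note b = y_off_node_bounded[OF E i j False F]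
    have "((\<lambda>z. (cmod (p0 j) + cmod (p1 j)) / cmod (z - t j) * cmod (inverse (Y i z))) \<longlongrightarrow>
        (cmod (p0 j) + cmod (p1 j)) / cmod (t i - t j) * cmod 0) F"
      by (intro tendsto_mult tendsto_norm b(2) Yinv)
    then have "((\<lambda>z. (cmod (p0 j) + cmod (p1 j)) / cmod (z - t j) * cmod (inverse (Y i z))) \<longlongrightarrow> 0) F" by simp
    then have "((\<lambda>z. Y j z * inverse (Y i z)) \<longlongrightarrow> 0) F"
    proof (rule Lim_null_comparison[rotated])
      show "eventually (\<lambda>z. norm (Y j z * inverse (Y i z)) \<le> (cmod (p0 j) + cmod (p1 j)) / cmod (z - t j) * cmod (inverse (Y i z))) F"
        using b(1) by eventually_elim (simp only: norm_mult Y_def mult_right_mono norm_ge_zero)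
    qed
    then show ?thesis using False by simp
  qed
  have "((\<lambda>z. inverse (Y i z) + (z - \<mu>) * (\<Sum>j<n. Y j z * inverse (Y i z))) \<longlongrightarrow>
      0 + (t i - \<mu>) * (\<Sum>j<n. if j = i then 1 else 0)) F"
    by (intro tendsto_intros Yinv ev(3) ratio) auto
  moreover have "inverse (Y i z) + (z - \<mu>) * (\<Sum>j<n. Y j z * inverse (Y i z)) = D z * inverse (Y i z)" for z
    unfolding sum_distrib_right[symmetric] by (simp add: D_def den_def Y_def algebra_simps)
  ultimately have DY: "((\<lambda>z. D z * inverse (Y i z)) \<longlongrightarrow> t i - \<mu>) F" using i by simp
  have tm: "t i - \<mu> \<noteq> 0" using \<mu>_not_node[OF i] by auto
  have "((\<lambda>z. - (\<Sum>j<n. P i j * ((\<mu> - t j) * ((Y j z * inverse (Y i z)) / (D z * inverse (Y i z)))))) \<longlongrightarrow>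
     - (\<Sum>j<n. P i j * ((\<mu> - t j) * ((if j = i then 1 else 0) / (t i - \<mu>))))) F"
    by (intro tendsto_intros ratio DY tm) auto
  moreover have "- (\<Sum>j<n. P i j * ((\<mu> - t j) * ((if j = i then 1 else 0) / (t i - \<mu>)))) = complex_of_real (\<gamma> i)"
  proof -
    have "(\<Sum>j<n. P i j * ((\<mu> - t j) * ((if j = i then 1 else 0) / (t i - \<mu>)))) = 
       (\<Sum>j<n. if j = i then P i i * ((\<mu> - t i) / (t i - \<mu>)) else 0)"
      by (intro sum.cong) auto
    also have "\<dots> = P i i * ((\<mu> - t i) / (t i - \<mu>))" using i by simp
    also have "(\<mu> - t i) / (t i - \<mu>) = -1" using tm by (simp add: field_simps)
    finally show ?thesis using P_diag[OF i] by simp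
  qed
  moreover have "eventually (\<lambda>z. - (\<Sum>j<n. P i j * ((\<mu> - t j) * ((Y j z * inverse (Y i z)) / (D z * inverse (Y i z))))) =
      (1 - cnj (w i) * f z) / (1 - cnj (t i) * z)) F"
    using ev(2) Yne tendsto_imp_eventually_ne[OF DY tm]
  proof eventually_elim
    case (elim z)
    have nz: "1 - cnj (t i) * z \<noteq> 0" using one_minus_cnj_mult_neq_0[of "t i" z] t_unimodular[OF i] elim(1) by simp
    have Dz: "D z \<noteq> 0" using elim by auto
    have fz: "f z * D z = num (E z) 1 z" using f[OF elim(1)] Dz by (simp add: D_def)
    have "- (\<Sum>j<n. P i j * ((\<mu> - t j) * ((Y j z * inverse (Y i z)) / (D z * inverse (Y i z))))) =
      - (\<Sum>j<n. P i j * v (E z) 1 z j) / D z"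
      using elim(2) by (simp add: v_def Y_def sum_divide_distrib)
    also have "(\<Sum>j<n. P i j * v (E z) 1 z j) = (cnj (w i) * num (E z) 1 z - D z) / (1 - cnj (t i) * z)"
      using node_residual[OF i not_node[OF elim(1)], of "E z" 1] nz by (simp add: D_def mult.commute)
    also have "- ((cnj (w i) * num (E z) 1 z - D z) / (1 - cnj (t i) * z)) / D z = (1 - cnj (w i) * f z) / (1 - cnj (t i) * z)"
      unfolding fz[symmetric] using Dz nz by (simp add: field_simps)
    finally show ?case .
  qed
  ultimately show ?thesis using Lim_transform_eventually by fastforce
qed

text \<open>The boundary data determine the limits of all the boundary quotients at \<open>t i\<close>, the one at node \<open>j\<close>
being \<open>P j i\<close>: for \<open>j = i\<close> by the Julia-Caratheodory theorem, for \<open>j \<noteq> i\<close> by continuity. Multiplication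
by \<open>Q\<close> recovers the limit of \<open>v / den\<close>, and \<open>1 / den\<close> is an affine function of \<open>v / den\<close>.\<close>

lemma inverse_den_tendsto_0:
  assumes E: "E \<in> schur_class" and i: "i < n" and F: "F \<le> at (t i) within stolz_region a (t i)" "a > 1"
    and f: "\<And>z. cmod z < 1 \<Longrightarrow> f z = num (E z) 1 z / den (E z) 1 z"
    and gs: "f \<in> gen_schur_class k" and bv: "has_boundary_value f (t i) (w i)" and bd: "has_boundary_d f (t i) (ereal (\<gamma> i))"
  shows "((\<lambda>z. inverse (den (E z) 1 z)) \<longlongrightarrow> 0) F" "eventually (\<lambda>z. den (E z) 1 z \<noteq> 0) F"
proof -
  note ev = eventually_stolz_region[OF t_unimodular[OF i] F(1)]
  define D where "D = (\<lambda>z. den (E z) 1 z)"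
  have fw: "(f \<longlongrightarrow> w i) F" using bv unfolding has_boundary_value_def by (rule tendsto_nt_at_stolz[OF _ F(2,1)])
  have w0: "w i \<noteq> 0" using w_unimodular[OF i] by auto
  have Dne: "eventually (\<lambda>z. D z \<noteq> 0) F"
    using ev(2) tendsto_imp_eventually_ne[OF fw w0] by eventually_elim (auto simp: D_def f)
  then show "eventually (\<lambda>z. den (E z) 1 z \<noteq> 0) F" by (simp add: D_def)
  define b where "b = (\<lambda>j z. (1 - cnj (w j) * f z) / (1 - cnj (t j) * z))"
  have b: "(b j \<longlongrightarrow> P j i) F" if j: "j < n" for j
  proof (cases "j = i")
    case True
    show ?thesis unfolding b_def True P_diag[OF i]
      by (rule tendsto_nt_at_stolz[OF gen_schur_quotient_of_boundary_data[OF gs w_unimodular[OF i] t_unimodular[OF i] bv bd] F(2,1)])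
  next
    case False
    show ?thesis unfolding b_def P_off_diag[OF j i False]
      by (intro tendsto_intros fw ev(3) node_gap[OF j i False])
  qed
  define u where "u = (\<lambda>j z. v (E z) 1 z j / D z)"
  have u: "(u l \<longlongrightarrow> (if l = i then -1 else 0)) F" if l: "l < n" for l
  proof -
    have "((\<lambda>z. \<Sum>j<n. Q l j * (- b j z)) \<longlongrightarrow> (\<Sum>j<n. Q l j * (- P j i))) F"
      by (intro tendsto_intros b) auto
    moreover have "(\<Sum>j<n. Q l j * (- P j i)) = (if l = i then -1 else 0)"
      using Q_P[OF l i] by (simp add: sum_negf)
    moreover have "eventually (\<lambda>z. (\<Sum>j<n. Q l j * (- b j z)) = u l z) F"
      using ev(2) Dne
    proof eventually_elim
      case (elim z)
      have "- b j z = (\<Sum>r<n. P j r * u r z)" if j: "j < n" for j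
      proof -
        have nz: "1 - cnj (t j) * z \<noteq> 0" using one_minus_cnj_mult_neq_0[of "t j" z] t_unimodular[OF j] elim(1) by simp
        have fz: "f z * D z = num (E z) 1 z" using f[OF elim(1)] elim(2) by (simp add: D_def)
        have "(\<Sum>r<n. P j r * u r z) = (\<Sum>r<n. P j r * v (E z) 1 z r) / D z"
          by (simp add: u_def sum_divide_distrib)
        also have "(\<Sum>r<n. P j r * v (E z) 1 z r) = (cnj (w j) * num (E z) 1 z - D z) / (1 - cnj (t j) * z)"
          using node_residual[OF j not_node[OF elim(1)], of "E z" 1] nz by (simp add: D_def mult.commute)
        also have "\<dots> / D z = - b j z"
          unfolding b_def fz[symmetric] using elim(2) nz by (simp add: field_simps)
        finally show ?thesis ..
      qed
      then have "(\<Sum>j<n. Q l j * (- b j z)) = (\<Sum>j<n. Q l j * (\<Sum>r<n. P j r * u r z))" by simp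
      also have "\<dots> = (\<Sum>r<n. (\<Sum>j<n. Q l j * P j r) * u r z)"
        by (simp add: sum_distrib_left sum_distrib_right mult.assoc) (rule sum.swap)
      also have "\<dots> = u l z" using l by (simp add: Q_P sum_kronecker cong: sum.cong_simp)
      finally show ?case .
    qed
    ultimately show ?thesis using Lim_transform_eventually by fastforce
  qed
  have m0: "\<mu> - t j \<noteq> 0" if "j < n" for j using \<mu>_not_node[OF that] by simp
  have "((\<lambda>z. 1 - (z - \<mu>) * (\<Sum>j<n. u j z / (\<mu> - t j))) \<longlongrightarrow> 1 - (t i - \<mu>) * (\<Sum>j<n. (if j = i then -1 else 0) / (\<mu> - t j))) F"
    by (intro tendsto_intros ev(3) u m0) auto
  moreover have "1 - (t i - \<mu>) * (\<Sum>j<n. (if j = i then -1 else 0) / (\<mu> - t j)) = 0"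
  proof -
    have "(\<Sum>j<n. (if j = i then -1 else 0) / (\<mu> - t j)) = (\<Sum>j<n. if j = i then -1 / (\<mu> - t i) else 0)"
      by (intro sum.cong) auto
    also have "\<dots> = -1 / (\<mu> - t i)" using i by simp
    finally show ?thesis using m0[OF i] by (simp add: field_simps)
  qed
  moreover have "eventually (\<lambda>z. 1 - (z - \<mu>) * (\<Sum>j<n. u j z / (\<mu> - t j)) = inverse (D z)) F"
    using Dne
  proof eventually_elim
    case (elim z)
    have "(\<Sum>j<n. u j z / (\<mu> - t j)) = (\<Sum>j<n. y (E z) 1 z j) / D z"
      unfolding sum_divide_distrib using m0 by (intro sum.cong refl) (simp add: u_def v_def)
    moreover have "1 - (z - \<mu>) * ((\<Sum>j<n. y (E z) 1 z j) / D z) = (D z - (z - \<mu>) * (\<Sum>j<n. y (E z) 1 z j)) / D z"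
      using elim by (simp add: diff_divide_distrib)
    moreover have "D z - (z - \<mu>) * (\<Sum>j<n. y (E z) 1 z j) = 1" by (simp add: D_def den_def)
    ultimately show ?case by (simp add: inverse_eq_divide)
  qed
  ultimately show "((\<lambda>z. inverse (den (E z) 1 z)) \<longlongrightarrow> 0) F"
    unfolding D_def using Lim_transform_eventually by fastforce
qed

text \<open>A bounded rate keeps every component of \<open>y\<close>, hence the denominator, bounded in the Stolz region,
whereas its inverse tends to 0.\<close>

lemma boundary_data_excludes_bounded_rate:
  assumes E: "E \<in> schur_class" and i: "i < n" 
    and f: "\<And>z. cmod z < 1 \<Longrightarrow> f z = num (E z) 1 z / den (E z) 1 z"
    and gs: "f \<in> gen_schur_class k" and bv: "has_boundary_value f (t i) (w i)" and bd: "has_boundary_d f (t i) (ereal (\<gamma> i))"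
    and C: "C \<ge> 0" "\<forall>z\<in>stolz_region 2 (t i). cmod (E z - \<eta> i) \<le> C * cmod (z - t i)"
  shows False
proof -
  let ?F = "at (t i) within stolz_region 2 (t i)"
  note ev = eventually_stolz_region[OF t_unimodular[OF i] order.refl[of ?F]]
  have nb: "?F \<noteq> bot" using at_within_stolz_region_nontrivial[OF t_unimodular[OF i], of 2] by simp
  have inv0: "((\<lambda>z. inverse (den (E z) 1 z)) \<longlongrightarrow> 0) ?F" and ne: "eventually (\<lambda>z. den (E z) 1 z \<noteq> 0) ?F"
    by (rule inverse_den_tendsto_0[OF E i order.refl _ _ gs bv bd]; simp add: f)+
  define h where "h = (\<lambda>j z. if j = i then cmod (p0 i) * C else (cmod (p0 j) + cmod (p1 j)) / cmod (z - t j))"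
  have hb: "eventually (\<lambda>z. cmod (y (E z) 1 z j) \<le> h j z) ?F" if j: "j < n" for j
  proof (cases "j = i")
    case True
    show ?thesis using ev(1)
    proof eventually_elim
      case (elim z)
      have "z \<noteq> t i" using elim t_unimodular[OF i] by (auto simp: stolz_region_def)
      then have zt: "cmod (z - t i) > 0" by simp
      have "cmod (E z - \<eta> i) \<le> C * cmod (z - t i)" using C(2) elim by blast
      then have "cmod (E z - \<eta> i) / cmod (z - t i) \<le> C" using zt by (simp add: pos_divide_le_eq)
      then have "cmod (p0 i) * (cmod (E z - \<eta> i) / cmod (z - t i)) \<le> cmod (p0 i) * C"
        by (intro mult_left_mono) auto
      then show ?case unfolding True y_at_node[OF i] norm_divide norm_mult by (simp add: h_def)
    qed
  next
    case False
    then show ?thesis using y_off_node_bounded(1)[OF E i j False order.refl] by (simp add: h_def)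
  qed
  define L where "L = (\<lambda>j. if j = i then cmod (p0 i) * C else (cmod (p0 j) + cmod (p1 j)) / cmod (t i - t j))"
  have hl: "(h j \<longlongrightarrow> L j) ?F" if j: "j < n" for j
    using y_off_node_bounded(2)[OF E i j _ order.refl] by (cases "j = i") (auto simp: h_def L_def)
  have "((\<lambda>z. (1 + cmod (z - \<mu>) * (\<Sum>j<n. h j z)) * cmod (inverse (den (E z) 1 z))) \<longlongrightarrow>
     (1 + cmod (t i - \<mu>) * (\<Sum>j<n. L j)) * cmod 0) ?F"
    by (intro tendsto_mult tendsto_add tendsto_const tendsto_norm tendsto_diff ev(3) tendsto_sum hl inv0) auto
  then have lim0: "((\<lambda>z. (1 + cmod (z - \<mu>) * (\<Sum>j<n. h j z)) * cmod (inverse (den (E z) 1 z))) \<longlongrightarrow> 0) ?F" by simp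
  have "eventually (\<lambda>z. \<forall>j\<in>{..<n}. cmod (y (E z) 1 z j) \<le> h j z) ?F"
    by (rule eventually_ball_finite) (use hb in auto)
  then have "eventually (\<lambda>z. 1 \<le> (1 + cmod (z - \<mu>) * (\<Sum>j<n. h j z)) * cmod (inverse (den (E z) 1 z))) ?F"
    using ne
  proof eventually_elim
    case (elim z)
    have "cmod (den (E z) 1 z) \<le> 1 + cmod (z - \<mu>) * cmod (\<Sum>j<n. y (E z) 1 z j)"
      unfolding den_def using norm_triangle_ineq[of 1 "(z - \<mu>) * (\<Sum>j<n. y (E z) 1 z j)"] by (simp add: norm_mult)
    also have "cmod (\<Sum>j<n. y (E z) 1 z j) \<le> (\<Sum>j<n. h j z)"
      using elim(1) by (intro order.trans[OF norm_sum] sum_mono) auto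
    finally have "cmod (den (E z) 1 z) \<le> 1 + cmod (z - \<mu>) * (\<Sum>j<n. h j z)" by (simp add: mult_left_mono)
    then have "cmod (den (E z) 1 z) * cmod (inverse (den (E z) 1 z)) \<le> (1 + cmod (z - \<mu>) * (\<Sum>j<n. h j z)) * cmod (inverse (den (E z) 1 z))"
      by (rule mult_right_mono) simp
    then show ?case using elim(2) by (simp add: norm_inverse)
  qed
  then have "1 \<le> (0::real)" by (rule tendsto_lowerbound[OF lim0 _ nb])
  then show False by simp
qed

text \<open>Only the summand \<open>y i\<close> of \<open>den\<close> has a pole at \<open>t i\<close>, and its residue does not depend on \<open>z\<close> because \<open>e\<close> and
\<open>f\<close> are constants here.\<close>

lemma residue_limit:
  assumes i: "i < n"
  shows "((\<lambda>z. (z - t i) * den e f z) \<longlongrightarrow> (t i - \<mu>) * (p0 i * e + p1 i * f)) (nt_at (t i))"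
proof -
  define g where "g = (\<lambda>z. (z - t i) * f + (z - \<mu>) * ((p0 i * e + p1 i * f) + (\<Sum>j\<in>{..<n} - {i}. (z - t i) * y e f z j)))"
  have "isCont g (t i)"
    unfolding g_def y_def using t_inj i by (intro continuous_intros) (auto simp: inj_on_def)
  then have "(g \<longlongrightarrow> g (t i)) (nt_at (t i))" by (rule tendsto_nt_at_if_continuous)
  moreover have "g (t i) = (t i - \<mu>) * (p0 i * e + p1 i * f)" by (simp add: g_def)
  moreover have "g z = (z - t i) * den e f z" if z: "cmod z < 1" for z
  proof -
    have "z - t i \<noteq> 0" using z t_unimodular[OF i] by auto
    then have "(z - t i) * y e f z i = p0 i * e + p1 i * f" by (simp add: y_def)
    moreover have "(\<Sum>j<n. (z - t i) * y e f z j) = (z - t i) * y e f z i + (\<Sum>j\<in>{..<n} - {i}. (z - t i) * y e f z j)"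
      using i by (intro sum.remove) auto
    ultimately have "(z - t i) * (\<Sum>j<n. y e f z j) = (p0 i * e + p1 i * f) + (\<Sum>j\<in>{..<n} - {i}. (z - t i) * y e f z j)"
      by (simp add: sum_distrib_left)
    then show ?thesis unfolding g_def den_def by (simp add: algebra_simps)
  qed
  ultimately show ?thesis using tendsto_nt_at_cong[of g, OF _ t_unimodular[OF i]] by simp
qed

end

section \<open>The entries of the matrix function\<close>

lemma mat_inv_eqI:
  assumes A: "A \<in> carrier_mat n n" and B: "B \<in> carrier_mat n n" and AB: "A * B = 1\<^sub>m n" and BA: "B * A = 1\<^sub>m n"
  shows "mat_inv A = B"
proof (cases "mat_inverse A")
  case None
  have "A \<in> Units (ring_mat TYPE(complex) n ())"
    using A B AB BA unfolding Units_def ring_mat_def by auto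
  then show ?thesis using mat_inverse(1)[OF A None, of "()"] by blast
next
  case (Some C)
  have "A * C = 1\<^sub>m n \<and> C * A = 1\<^sub>m n \<and> C \<in> carrier_mat n n" by (rule mat_inverse(2)[OF A Some])
  then have CA: "C * A = 1\<^sub>m n" and C': "C \<in> carrier_mat n n" by auto
  have "C = C * (A * B)" unfolding AB by (rule right_mult_one_mat[OF C', symmetric])
  also have "\<dots> = (C * A) * B" by (rule assoc_mult_mat[OF C' A B, symmetric])
  also have "\<dots> = B" unfolding CA by (rule left_mult_one_mat[OF B])
  finally show ?thesis by (simp add: mat_inv_def Some)
qed

lemma mat_inv_diag:
  assumes "\<And>i. i < n \<Longrightarrow> f i \<noteq> 0"
  shows "mat_inv (mat_diag n f) = mat_diag n (\<lambda>i. 1 / f i)"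
proof (rule mat_inv_eqI)
  show "mat_diag n f * mat_diag n (\<lambda>i. 1 / f i) = 1\<^sub>m n"
    unfolding mat_diag_diag by (rule eq_matI) (use assms in \<open>auto simp: mat_diag_def\<close>)
  show "mat_diag n (\<lambda>i. 1 / f i) * mat_diag n f = 1\<^sub>m n"
    unfolding mat_diag_diag by (rule eq_matI) (use assms in \<open>auto simp: mat_diag_def\<close>)
qed auto

lemma Theta_index:
  assumes z: "\<And>j. j < n \<Longrightarrow> z \<noteq> t j" and \<mu>: "\<And>j. j < n \<Longrightarrow> 1 - \<mu> * cnj (t j) \<noteq> 0"
    and Q: "mat_inv (pick_matrix n t w \<gamma>) \<in> carrier_mat n n"
    and a: "a < 2" and b: "b < 2"
  shows "Theta n t w \<gamma> \<mu> z $$ (a, b) = (if a = b then 1 else 0) + (z - \<mu>) *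
    (\<Sum>j<n. (if a = 0 then w j else 1) * ((\<Sum>l<n. mat_inv (pick_matrix n t w \<gamma>) $$ (j, l) *
       (1 / (1 - \<mu> * cnj (t l)) * (if b = 0 then cnj (w l) else -1))) / (z - t j)))"
proof -
  define T where "T = mat_diag n t"
  define G where "G = Matrix.mat 1 n (\<lambda>(_, j). w j) @\<^sub>r Matrix.mat 1 n (\<lambda>_. 1)"
  define H where "H = mat_adjoint (Matrix.mat 1 n (\<lambda>(_, j). w j) @\<^sub>r (- Matrix.mat 1 n (\<lambda>_. 1)))"
  define R where "R = mat_inv (z \<cdot>\<^sub>m 1\<^sub>m n - T)"
  define M where "M = mat_inv (1\<^sub>m n - \<mu> \<cdot>\<^sub>m mat_adjoint T)"
  define PI where "PI = mat_inv (pick_matrix n t w \<gamma>)"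
  have PI: "PI \<in> carrier_mat n n" using Q by (simp add: PI_def)
  have Th: "Theta n t w \<gamma> \<mu> z = 1\<^sub>m 2 + (z - \<mu>) \<cdot>\<^sub>m (G * R * PI * M * H)"
    unfolding Theta_def Let_def T_def G_def H_def R_def M_def PI_def ..
  have T: "T \<in> carrier_mat n n" by (simp add: T_def)
  have "z \<cdot>\<^sub>m 1\<^sub>m n - T = mat_diag n (\<lambda>j. z - t j)"
    by (rule eq_matI) (auto simp: T_def mat_diag_def)
  then have R: "R = mat_diag n (\<lambda>j. 1 / (z - t j))"
    unfolding R_def using mat_inv_diag[of n "\<lambda>j. z - t j"] z by simp
  have adjT: "mat_adjoint T = mat_diag n (\<lambda>j. cnj (t j))"
    by (rule eq_matI) (use mat_adjoint_carrier[OF T] mat_adjoint_index[OF T] in \<open>auto simp: T_def mat_diag_def\<close>)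
  have "1\<^sub>m n - \<mu> \<cdot>\<^sub>m mat_adjoint T = mat_diag n (\<lambda>j. 1 - \<mu> * cnj (t j))"
    unfolding adjT by (rule eq_matI) (auto simp: mat_diag_def)
  then have M: "M = mat_diag n (\<lambda>j. 1 / (1 - \<mu> * cnj (t j)))"
    unfolding M_def using mat_inv_diag[of n "\<lambda>j. 1 - \<mu> * cnj (t j)"] \<mu> by simp
  have G: "G \<in> carrier_mat 2 n" by (auto simp: G_def append_rows_def)
  have Gi: "G $$ (a, j) = (if a = 0 then w j else 1)" if "j < n" for j
    using that a by (auto simp: G_def append_rows_def)
  have H0: "Matrix.mat 1 n (\<lambda>(_, j). w j) @\<^sub>r (- Matrix.mat 1 n (\<lambda>_. 1)) \<in> carrier_mat 2 n"
    by (auto simp: append_rows_def)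
  have H: "H \<in> carrier_mat n 2" unfolding H_def by (rule mat_adjoint_carrier[OF H0])
  have Hi: "H $$ (l, b) = (if b = 0 then cnj (w l) else -1)" if "l < n" for l
    unfolding H_def mat_adjoint_index[OF H0 that b] using that b by (auto simp: append_rows_def)
  have GR: "G * R = Matrix.mat 2 n (\<lambda>(i, j). G $$ (i, j) * (1 / (z - t j)))"
    unfolding R by (rule mat_diag_mult_right[OF G])
  have GRc: "G * R \<in> carrier_mat 2 n" unfolding GR by simp
  have GRP: "G * R * PI \<in> carrier_mat 2 n" by (rule mult_carrier_mat[OF GRc PI])
  have GRPM: "G * R * PI * M = Matrix.mat 2 n (\<lambda>(i, j). (G * R * PI) $$ (i, j) * (1 / (1 - \<mu> * cnj (t j))))"
    unfolding M by (rule mat_diag_mult_right[OF GRP])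
  have GRPMc: "G * R * PI * M \<in> carrier_mat 2 n" unfolding GRPM by simp
  have tot: "G * R * PI * M * H \<in> carrier_mat 2 2" by (rule mult_carrier_mat[OF GRPMc H])
  have "(G * R * PI * M * H) $$ (a, b) = (\<Sum>l<n. (G * R * PI * M) $$ (a, l) * H $$ (l, b))"
    by (rule mat_mult_index_sum[OF GRPMc H a b])
  also have "\<dots> = (\<Sum>l<n. ((\<Sum>j<n. (G * R) $$ (a, j) * PI $$ (j, l)) * (1 / (1 - \<mu> * cnj (t l)))) * (if b = 0 then cnj (w l) else -1))"
  proof (intro sum.cong refl)
    fix l assume "l \<in> {..<n}"
    then have l: "l < n" by simp
    have "(G * R * PI * M) $$ (a, l) = (G * R * PI) $$ (a, l) * (1 / (1 - \<mu> * cnj (t l)))"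
      unfolding GRPM using a l by simp
    also have "(G * R * PI) $$ (a, l) = (\<Sum>j<n. (G * R) $$ (a, j) * PI $$ (j, l))"
      by (rule mat_mult_index_sum[OF GRc PI a l])
    finally show "(G * R * PI * M) $$ (a, l) * H $$ (l, b) =
      ((\<Sum>j<n. (G * R) $$ (a, j) * PI $$ (j, l)) * (1 / (1 - \<mu> * cnj (t l)))) * (if b = 0 then cnj (w l) else -1)"
      by (simp only: Hi[OF l])
  qed
  also have "\<dots> = (\<Sum>l<n. \<Sum>j<n. (if a = 0 then w j else 1) * (1 / (z - t j)) * PI $$ (j, l) * (1 / (1 - \<mu> * cnj (t l))) * (if b = 0 then cnj (w l) else -1))"
  proof (intro sum.cong refl)
    fix l
    have "(\<Sum>j<n. (G * R) $$ (a, j) * PI $$ (j, l)) = (\<Sum>j<n. (if a = 0 then w j else 1) * (1 / (z - t j)) * PI $$ (j, l))"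
      unfolding GR using a by (intro sum.cong refl) (simp add: Gi)
    then show "((\<Sum>j<n. (G * R) $$ (a, j) * PI $$ (j, l)) * (1 / (1 - \<mu> * cnj (t l)))) * (if b = 0 then cnj (w l) else -1) =
      (\<Sum>j<n. (if a = 0 then w j else 1) * (1 / (z - t j)) * PI $$ (j, l) * (1 / (1 - \<mu> * cnj (t l))) * (if b = 0 then cnj (w l) else -1))"
      by (simp only: sum_distrib_right)
  qed
  also have "\<dots> = (\<Sum>j<n. \<Sum>l<n. (if a = 0 then w j else 1) * (1 / (z - t j)) * PI $$ (j, l) * (1 / (1 - \<mu> * cnj (t l))) * (if b = 0 then cnj (w l) else -1))"
    by (rule sum.swap)
  also have "\<dots> = (\<Sum>j<n. (if a = 0 then w j else 1) * ((\<Sum>l<n. PI $$ (j, l) * (1 / (1 - \<mu> * cnj (t l)) * (if b = 0 then cnj (w l) else -1))) / (z - t j)))"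
    unfolding sum_distrib_left sum_divide_distrib by (intro sum.cong refl) (simp add: mult_ac)
  finally have X: "(G * R * PI * M * H) $$ (a, b) = \<dots>" .
  have "Theta n t w \<gamma> \<mu> z $$ (a, b) = 1\<^sub>m 2 $$ (a, b) + (z - \<mu>) * (G * R * PI * M * H) $$ (a, b)"
  proof -
    define K where "K = G * R * PI * M * H"
    have "K \<in> carrier_mat 2 2" using tot by (simp only: K_def)
    then show ?thesis unfolding Th K_def[symmetric] using a b by auto
  qed
  then show ?thesis unfolding X unfolding PI_def using a b by simp
qed

context interpolation_data
begin

lemma Theta_entries:
  assumes z: "z \<notin> t ` {..<n}" and Q: "mat_inv (pick_matrix n t w \<gamma>) \<in> carrier_mat n n"
    and Qe: "\<And>j l. j < n \<Longrightarrow> l < n \<Longrightarrow> Q j l = mat_inv (pick_matrix n t w \<gamma>) $$ (j, l)"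
  shows "Theta n t w \<gamma> \<mu> z $$ (0, 0) = num 1 0 z" "Theta n t w \<gamma> \<mu> z $$ (0, 1) = num 0 1 z"
    "Theta n t w \<gamma> \<mu> z $$ (1, 0) = den 1 0 z" "Theta n t w \<gamma> \<mu> z $$ (1, 1) = den 0 1 z"
proof -
  have z': "\<And>j. j < n \<Longrightarrow> z \<noteq> t j" using z by auto
  note idx = Theta_index[where t = t and n = n, OF z' m_denominator Q]
  have q0: "(\<Sum>l<n. mat_inv (pick_matrix n t w \<gamma>) $$ (j, l) * (1 / (1 - \<mu> * cnj (t l)) * cnj (w l))) = p0 j" if "j < n" for j
    unfolding p0_def m_def by (intro sum.cong refl) (simp add: Qe that)
  have q1: "(\<Sum>l<n. mat_inv (pick_matrix n t w \<gamma>) $$ (j, l) * (1 / (1 - \<mu> * cnj (t l)) * -1)) = p1 j" if "j < n" for j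
    unfolding p1_def m_def by (intro sum.cong refl) (simp add: Qe that)
  show "Theta n t w \<gamma> \<mu> z $$ (0, 0) = num 1 0 z"
    using idx[of 0 0] q0 by (simp add: num_def y_def cong: sum.cong_simp)
  show "Theta n t w \<gamma> \<mu> z $$ (0, 1) = num 0 1 z"
    using idx[of 0 1] q1 by (simp add: num_def y_def cong: sum.cong_simp)
  show "Theta n t w \<gamma> \<mu> z $$ (1, 0) = den 1 0 z"
    using idx[of 1 0] q0 by (simp add: den_def y_def cong: sum.cong_simp)
  show "Theta n t w \<gamma> \<mu> z $$ (1, 1) = den 0 1 z"
    using idx[of 1 1] q1 by (simp add: den_def y_def cong: sum.cong_simp)
qed

text \<open>The quotient of conjugates in the definition of \<open>eta\<close> equals \<open>- p1 i / p0 i\<close> because \<open>p0 i\<close> and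
\<open>p1 i\<close> have the same modulus.\<close>

lemma eta_eq:
  assumes i: "i < n"
    and T10: "\<And>z. cmod z < 1 \<Longrightarrow> \<Theta> z $$ (1, 0) = den 1 0 z" and T11: "\<And>z. cmod z < 1 \<Longrightarrow> \<Theta> z $$ (1, 1) = den 0 1 z"
  shows "eta \<Theta> (t i) = \<eta> i"
proof -
  note ti = t_unimodular[OF i]
  note nb = nt_at_nontrivial[OF ti]
  have "((\<lambda>z. (z - t i) * \<Theta> z $$ (1, 0)) \<longlongrightarrow> (t i - \<mu>) * p0 i) (nt_at (t i))"
  proof -
    have "((\<lambda>z. (z - t i) * \<Theta> z $$ (1, 0)) \<longlongrightarrow> L) (nt_at (t i)) \<longleftrightarrow> ((\<lambda>z. (z - t i) * den 1 0 z) \<longlongrightarrow> L) (nt_at (t i))" for L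
      by (rule tendsto_nt_at_cong[OF _ ti]) (simp only: T10)
    then show ?thesis using residue_limit[OF i, of 1 0] by simp
  qed
  then have c: "Lim (nt_at (t i)) (\<lambda>z. (z - t i) * \<Theta> z $$ (1, 0)) = (t i - \<mu>) * p0 i"
    by (rule tendsto_Lim[OF nb])
  have "((\<lambda>z. (z - t i) * \<Theta> z $$ (1, 1)) \<longlongrightarrow> (t i - \<mu>) * p1 i) (nt_at (t i))"
  proof -
    have "((\<lambda>z. (z - t i) * \<Theta> z $$ (1, 1)) \<longlongrightarrow> L) (nt_at (t i)) \<longleftrightarrow> ((\<lambda>z. (z - t i) * den 0 1 z) \<longlongrightarrow> L) (nt_at (t i))" for L
      by (rule tendsto_nt_at_cong[OF _ ti]) (simp only: T11)
    then show ?thesis using residue_limit[OF i, of 0 1] by simp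
  qed
  then have e: "Lim (nt_at (t i)) (\<lambda>z. (z - t i) * \<Theta> z $$ (1, 1)) = (t i - \<mu>) * p1 i"
    by (rule tendsto_Lim[OF nb])
  have p: "p0 i \<noteq> 0" "p1 i \<noteq> 0" using p_modulus[OF i] by auto
  have "p0 i * cnj (p0 i) = p1 i * cnj (p1 i)"
    unfolding cmod_power2_complex[symmetric] using p_modulus(1)[OF i] by simp
  then have "cnj (p0 i) / cnj (p1 i) = p1 i / p0 i" using p by (simp add: field_simps)
  moreover have "cnj (t i - \<mu>) \<noteq> 0" using \<mu>_not_node[OF i] by (metis complex_cnj_zero_iff eq_iff_diff_eq_0)
  ultimately show ?thesis
    unfolding eta_def c_tilde_def e_tilde_def c e \<eta>_def complex_cnj_minus complex_cnj_mult
    by simp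
qed

end

theorem theorem2p6:
  fixes n \<kappa> :: nat
    and t w :: "nat \<Rightarrow> complex"
    and \<gamma> :: "nat \<Rightarrow> real"
    and \<mu> :: complex
    and \<E> :: "complex \<Rightarrow> complex"
  defines "\<Theta> \<equiv> Theta n t w \<gamma> \<mu>"
  assumes "n \<ge> 1"
    and "\<And>i. i < n \<Longrightarrow> cmod (t i) = 1"
    and "inj_on t {..<n}"
    and "\<And>i. i < n \<Longrightarrow> cmod (w i) = 1"
    and "invertible_mat (pick_matrix n t w \<gamma>)"
    and "num_neg_eigenvalues (pick_matrix n t w \<gamma>) = \<kappa>"
    and "cmod \<mu> = 1"
    and "\<mu> \<notin> t ` {..<n}"
    and "\<E> \<in> schur_class"
  shows "is_solution n t w \<gamma> \<kappa> (lin_frac \<Theta> \<E>) \<longleftrightarrow>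
    (\<forall>i<n. cond_C1 \<Theta> (t i) \<E> \<or> cond_C2 \<Theta> (t i) \<E>)"
proof -
  note t = assms(3) and inj = assms(4) and w = assms(5) and E = assms(10)
  define A where "A = pick_matrix n t w \<gamma>"
  have A: "A \<in> carrier_mat n n" by (simp add: A_def pick_matrix_def)
  obtain A' where A': "A * A' = 1\<^sub>m n" "A' * A = 1\<^sub>m n" "A' \<in> carrier_mat n n"
  proof -
    obtain A' where "inverts_mat A A'" "inverts_mat A' A"
      using assms(6) unfolding A_def invertible_mat_def by blast
    then have 1: "A * A' = 1\<^sub>m n" "A' * A = 1\<^sub>m (dim_row A')" using A by (auto simp: inverts_mat_def)
    have dc: "dim_col A' = n" using arg_cong[OF 1(1), of dim_col] by simp
    have dr: "dim_row A' = n" using arg_cong[OF 1(2), of dim_col] A by simp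
    show ?thesis by (rule that[OF 1(1) 1(2)[unfolded dr] carrier_matI[OF dr dc]])
  qed
  have inv: "mat_inv A = A'" by (rule mat_inv_eqI[OF A A'(3,1,2)])
  define P where "P = (\<lambda>i j. A $$ (i, j))"
  define Q where "Q = (\<lambda>i j. A' $$ (i, j))"
  interpret interpolation_data n t w \<gamma> \<mu> P Q
  proof
    fix i assume i: "i < n"
    show "cmod (t i) = 1" "cmod (w i) = 1" by (rule t[OF i], rule w[OF i])
    show "\<mu> \<noteq> t i" using assms(9) i by auto
    show "P i i = complex_of_real (\<gamma> i)" using i by (simp add: P_def A_def pick_matrix_def)
  next
    fix i j assume i: "i < n" and j: "j < n"
    show "P i j = (1 - cnj (w i) * w j) / (1 - cnj (t i) * t j)" if "i \<noteq> j"
      using i j that by (simp add: P_def A_def pick_matrix_def)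
    show "(\<Sum>k<n. P i k * Q k j) = (if i = j then 1 else 0)"
      unfolding P_def Q_def using mat_mult_index_sum[OF A A'(3) i j] A'(1) i j by simp
    show "(\<Sum>k<n. Q i k * P k j) = (if i = j then 1 else 0)"
      unfolding P_def Q_def using mat_mult_index_sum[OF A'(3) A i j] A'(2) i j by simp
  qed (rule inj, rule assms(8))
  obtain U :: "nat \<Rightarrow> nat \<Rightarrow> complex" and d :: "nat \<Rightarrow> real" where
    PU: "\<And>i j. i < n \<Longrightarrow> j < n \<Longrightarrow> P i j = (\<Sum>l<n. complex_of_real (d l) * (U i l * cnj (U j l)))" and
    U: "\<And>l m. l < n \<Longrightarrow> m < n \<Longrightarrow> (\<Sum>i<n. cnj (U i l) * U i m) = (if l = m then 1 else 0)" and
    neg: "num_neg_eigenvalues A = card {l. l < n \<and> d l < 0}"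
  proof (rule hermitian_inertia[OF A])
    show "A $$ (i, j) = cnj (A $$ (j, i))" if "i < n" "j < n" for i j
      using P_hermitian[OF that(2,1)] by (simp add: P_def)
  qed (rule that, unfold P_def)
  have \<kappa>: "\<kappa> = card {l. l < n \<and> d l < 0}" using neg assms(7) by (simp add: A_def)
  have Qc: "mat_inv (pick_matrix n t w \<gamma>) \<in> carrier_mat n n" using A'(3) inv by (simp add: A_def)
  have Qe: "Q j l = mat_inv (pick_matrix n t w \<gamma>) $$ (j, l)" for j l
    using inv by (simp add: Q_def A_def)
  note entries = Theta_entries[OF not_node Qc Qe, folded \<Theta>_def]
  define f where "f = lin_frac \<Theta> \<E>"
  have f: "f z = num (\<E> z) 1 z / den (\<E> z) 1 z" if "cmod z < 1" for z
    unfolding f_def lin_frac_def entries[OF that] num_den_affine[of "\<E> z"] ..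
  have eta: "eta \<Theta> (t i) = \<eta> i" if "i < n" for i
    by (rule eta_eq[OF that entries(3,4)])
  note hE = schur_classD(1)[OF E]
  obtain a where a: "\<forall>j<\<kappa>. cmod (a j) \<le> 1"
    "\<forall>z. cmod z < 1 \<longrightarrow> cmod (num (\<E> z) 1 z) * (\<Prod>j<\<kappa>. cmod (z - a j)) \<le>
        cmod (den (\<E> z) 1 z) * (\<Prod>j<\<kappa>. cmod (1 - cnj (a j) * z))"
  proof (rule blaschke_bound[where U = U and d = d, OF _ E])
    show "P i j = (\<Sum>l<n. complex_of_real (d l) * (U i l * cnj (U j l)))" if "i < n" "j < n" for i j
      by (rule PU[OF that])
  qed (rule that, simp_all only: \<kappa>)
  (* in general k may be smaller than kappa *)
  obtain k where k: "k \<le> \<kappa>" "f \<in> gen_schur_class k"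
  proof (rule gen_schur_of_blaschke_bound[OF holomorphic_num_den[OF hE] _ a])
    fix z assume "cmod z < 1" "num (\<E> z) 1 z = 0" "den (\<E> z) 1 z = 0"
    then show False using num_den_coprime(2)[OF not_node] by fastforce
  next
    fix k assume "k \<le> \<kappa>" "\<forall>f. (\<forall>z. cmod z < 1 \<longrightarrow> den (\<E> z) 1 z \<noteq> 0 \<longrightarrow> f z = num (\<E> z) 1 z / den (\<E> z) 1 z) \<longrightarrow> f \<in> gen_schur_class k"
    then show thesis using that[of k] f by blast
  qed
  have "is_solution n t w \<gamma> \<kappa> f \<longleftrightarrow> (\<forall>i<n. \<not> has_boundary_value \<E> (t i) (\<eta> i) \<or> has_boundary_d \<E> (t i) \<infinity>)"
  proof (intro iffI allI impI)
    fix i assume sol: "is_solution n t w \<gamma> \<kappa> f" and i: "i < n"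
    show "\<not> has_boundary_value \<E> (t i) (\<eta> i) \<or> has_boundary_d \<E> (t i) \<infinity>"
    proof (rule ccontr)
      assume "\<not> (\<not> has_boundary_value \<E> (t i) (\<eta> i) \<or> has_boundary_d \<E> (t i) \<infinity>)"
      then have h: "has_boundary_value \<E> (t i) (\<eta> i)" "\<not> has_boundary_d \<E> (t i) \<infinity>" by auto
      obtain C where C: "C \<ge> 0" "\<forall>z\<in>stolz_region 2 (t i). cmod (\<E> z - \<eta> i) \<le> C * cmod (z - t i)"
        by (rule approach_rate_bounded[OF E \<eta>_unimodular[OF i] t[OF i] h], rule that, assumption+)
      show False
        by (rule boundary_data_excludes_bounded_rate[OF E i f _ _ _ C]) (use sol i in \<open>auto simp: is_solution_def\<close>)
    qed
  next
    assume cond: "\<forall>i<n. \<not> has_boundary_value \<E> (t i) (\<eta> i) \<or> has_boundary_d \<E> (t i) \<infinity>"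
    have bd: "has_boundary_value f (t i) (w i) \<and> has_boundary_d f (t i) (ereal (\<gamma> i))" if i: "i < n" for i
    proof -
      obtain b F where F: "b > 1" "F \<noteq> bot" "F \<le> at (t i) within stolz_region b (t i)"
        "filterlim (\<lambda>z. cmod (\<E> z - \<eta> i) / cmod (z - t i)) at_top F"
        by (rule approach_rate_unbounded[OF E \<eta>_unimodular[OF i] t[OF i] cond[rule_format, OF i]], rule that, assumption+)
      have "(boundary_quotient f (w i) (t i) \<longlongrightarrow> complex_of_real (\<gamma> i)) F"
        by (rule quotient_limit_of_unbounded_rate[OF E i F(3,4) f])
      then show ?thesis
        using gen_schur_boundary_data_of_quotient[OF k(2) w[OF i] t[OF i] F(2,1,3)] by blast
    qed
    (* the boundary conditions rule out a loss of poles *)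
    have "card {l. l < n \<and> d l < 0} \<le> k"
      by (rule negative_index_le_pole_count[OF k(2) t inj _ _ P_diag P_off_diag PU U]) (use bd in auto)
    then have "k = \<kappa>" using k(1) \<kappa> by simp
    then show "is_solution n t w \<gamma> \<kappa> f" using k(2) bd by (simp add: is_solution_def)
  qed
  also have "\<dots> \<longleftrightarrow> (\<forall>i<n. cond_C1 \<Theta> (t i) \<E> \<or> cond_C2 \<Theta> (t i) \<E>)"
    using eta by (auto simp: cond_C1_def cond_C2_def)
  finally show ?thesis unfolding f_def .
qed

end
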